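(* The set $\mathbf{DI}_{\nu,{\boldsymbol{\omega}}}$ is thick (i.e. its intersection with every nonempty open subset of the space of real $m\times n$ matrices has Hausdorff dimension $mn$) in each of the following cases: (a) $m,n\ge1$ and the weight vector ${\boldsymbol{\omega}}$ are arbitrary, and $\nu$ is the Euclidean norm on $\mathbb{R}^{m+n}$; (b) $m=2$, $n=1$, ${\boldsymbol{\omega}}$ is arbitrary, and $\nu$ is a norm on $\mathbb{R}^3$ of the form $\nu(x,y,z)=\max\{\eta(x,y),|z|\}$ for some norm $\eta$ on $\mathbb{R}^2$.
   Context: $d=m+n$; weights ${\boldsymbol{\omega}}=({\boldsymbol{\alpha}},{\boldsymbol{\beta}})\in\mathbb{R}_{>0}^m\times\mathbb{R}_{>0}^n$ with $\sum_i\alpha_i=\sum_j\beta_j=1$. $X_d$ is the space of unimodular lattices in $\mathbb{R}^d$; $B_\nu(r)=\{{\bf x}:\nu({\bf x})<r\}$; $r_\nu=\sup\{r:\Lambda\cap B_\nu(r)=\{{\bf 0}\}\text{ for some }\Lambda\in X_d\}$. For a real $m\times n$ matrix $A$, $\Lambda_A=\begin{bmatrix}I_m&A\\0&I_n\end{bmatrix}\mathbb{Z}^d$. For $c>0$, ${\bf x}\in\mathbb{R}^k$, $c^{\bf x}=\operatorname{diag}(c^{x_1},\dots,c^{x_k})$. For $\psi:\mathbb{R}_{>0}\to\mathbb{R}_{>0}$, $D_{\nu,{\boldsymbol{\omega}}}(\psi)$ is the set of $A$ with $\Lambda_A\cap\begin{bmatrix}\psi(t)^{\boldsymbol{\alpha}}&0\\0&t^{\boldsymbol{\beta}}\end{bmatrix}B_\nu(r_\nu)\ne\{{\bf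 0}\}$ for all sufficiently large $t$; with $\psi_1(t)=1/t$, $\mathbf{DI}_{\nu,{\boldsymbol{\omega}}}=\bigcup_{0<c<1}D_{\nu,{\boldsymbol{\omega}}}(c\psi_1)$. *)

theory Defs
  imports "HOL-Analysis.Analysis"
begin

section \<open>Hausdorff dimension\<close>

text \<open>
  The conventions are \<open>diam(\<emptyset>)\<^sup>s = 0\<close> for every \<open>s\<close> and \<open>diam(U)\<^sup>0 = 1\<close> for \<open>U \<noteq> \<emptyset>\<close>. The case
  \<open>s = 0\<close> is separated because \<open>0 powr 0 = 0\<close>.
\<close>

definition diam_pow :: "real \<Rightarrow> 'a::metric_space set \<Rightarrow> ennreal" where
  "diam_pow s U =
     (if U = {} then 0 else if s = 0 then 1 else ennreal (diameter U powr s))"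

text \<open>Boundedness is required because \<open>diameter\<close> is unspecified on unbounded sets.\<close>

definition delta_covers :: "real \<Rightarrow> 'a::metric_space set \<Rightarrow> (nat \<Rightarrow> 'a set) set" where
  "delta_covers \<delta> E =
     {U. E \<subseteq> (\<Union>i. U i) \<and> (\<forall>i. bounded (U i) \<and> diameter (U i) \<le> \<delta>)}"

definition hausdorff_measure :: "real \<Rightarrow> 'a::metric_space set \<Rightarrow> ennreal" where
  "hausdorff_measure s E =
     (SUP \<delta>\<in>{0<..}. INF U\<in>delta_covers \<delta> E. \<Sum>i. diam_pow s (U i))"

definition hausdorff_dim :: "'a::metric_space set \<Rightarrow> ennreal" where
  "hausdorff_dim E = Inf {ennreal s |s. 0 \<le> s \<and> hausdorff_measure s E = 0}"

text \<open>
  The metric on \<^typ>\<open>real^'n^'m\<close> is the Euclidean one on the \<open>m n\<close> matrix entries.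
\<close>

definition thick :: "(real^'n^'m) set \<Rightarrow> bool" where
  "thick S \<longleftrightarrow>
     (\<forall>U. open U \<and> U \<noteq> {} \<longrightarrow> hausdorff_dim (S \<inter> U) = of_nat (CARD('m) * CARD('n)))"

section \<open>Norms and lattices\<close>

definition is_norm :: "('a::real_vector \<Rightarrow> real) \<Rightarrow> bool" where
  "is_norm \<nu> \<longleftrightarrow>
     (\<forall>x. 0 \<le> \<nu> x) \<and> (\<forall>x. \<nu> x = 0 \<longleftrightarrow> x = 0) \<and>
     (\<forall>c x. \<nu> (c *\<^sub>R x) = \<bar>c\<bar> * \<nu> x) \<and> (\<forall>x y. \<nu> (x + y) \<le> \<nu> x + \<nu> y)"

definition norm_ball :: "('a \<Rightarrow> real) \<Rightarrow> real \<Rightarrow> 'a set" where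
  "norm_ball \<nu> r = {x. \<nu> x < r}"

definition int_vectors :: "(real^'d) set" where
  "int_vectors = {x. \<forall>i. x $ i \<in> \<int>}"

definition unimodular_lattices :: "(real^'d) set set" where
  "unimodular_lattices = {(\<lambda>x. g *v x) ` int_vectors |g::real^'d^'d. \<bar>det g\<bar> = 1}"

definition critical_radius :: "(real^'d \<Rightarrow> real) \<Rightarrow> real" where
  "critical_radius \<nu> = Sup {r. \<exists>\<Lambda>\<in>unimodular_lattices. \<Lambda> \<inter> norm_ball \<nu> r = {0}}"

section \<open>Dirichlet-improvable matrices\<close>

text \<open>
  The space \<open>\<real>\<^sup>d\<close> with \<open>d = m + n\<close> is \<^typ>\<open>real^('m + 'n)\<close>: the first \<open>m\<close> coordinates are indexed by
  \<open>Inl\<close>, the last \<open>n\<close> by \<open>Inr\<close>.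
\<close>

definition block_matrix ::
  "real^'m^'m \<Rightarrow> real^'n^'m \<Rightarrow> real^'m^'n \<Rightarrow> real^'n^'n \<Rightarrow> real^('m + 'n)^('m + 'n)" where
  "block_matrix P Q R S =
     (\<chi> i j. case i of
        Inl a \<Rightarrow> (case j of Inl b \<Rightarrow> P $ a $ b | Inr b \<Rightarrow> Q $ a $ b)
      | Inr a \<Rightarrow> (case j of Inl b \<Rightarrow> R $ a $ b | Inr b \<Rightarrow> S $ a $ b))"

definition diag_powr :: "real \<Rightarrow> real^'k \<Rightarrow> real^'k^'k" where
  "diag_powr c x = (\<chi> i j. if i = j then c powr (x $ i) else 0)"

definition weight_vector :: "real^'m \<Rightarrow> real^'n \<Rightarrow> bool" where
  "weight_vector \<alpha> \<beta> \<longleftrightarrow>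
     (\<forall>i. 0 < \<alpha> $ i) \<and> (\<forall>j. 0 < \<beta> $ j) \<and>
     (\<Sum>i\<in>UNIV. \<alpha> $ i) = 1 \<and> (\<Sum>j\<in>UNIV. \<beta> $ j) = 1"

definition matrix_lattice :: "real^'n^'m \<Rightarrow> (real^('m + 'n)) set" where
  "matrix_lattice A = (\<lambda>x. block_matrix (mat 1) A 0 (mat 1) *v x) ` int_vectors"

definition dirichlet_set ::
  "(real^('m + 'n) \<Rightarrow> real) \<Rightarrow> real^'m \<Rightarrow> real^'n \<Rightarrow> (real \<Rightarrow> real) \<Rightarrow> (real^'n^'m) set" where
  "dirichlet_set \<nu> \<alpha> \<beta> \<psi> =
     {A. \<forall>\<^sub>F t in at_top.
           matrix_lattice A \<inter>
             (\<lambda>x. block_matrix (diag_powr (\<psi> t) \<alpha>) 0 0 (diag_powr t \<beta>) *v x)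
               ` norm_ball \<nu> (critical_radius \<nu>) \<noteq> {0}}"

definition DI :: "(real^('m + 'n) \<Rightarrow> real) \<Rightarrow> real^'m \<Rightarrow> real^'n \<Rightarrow> (real^'n^'m) set" where
  "DI \<nu> \<alpha> \<beta> = (\<Union>c\<in>{0<..<1}. dirichlet_set \<nu> \<alpha> \<beta> (\<lambda>t. c * (1 / t)))"

end

theory Submission
  imports Defs
begin

text \<open>
  \<open>A\<close> is Dirichlet-improvable once the renormalised orbit \<open>s \<mapsto> g\<^sub>s \<Lambda>\<^sub>A\<close> eventually stays away from the
  critical locus, the lattices having no nonzero vector in the open ball \<open>B\<^sub>\<nu>(r\<^sub>\<nu>)\<close>. Subdivide a box of
  matrices into the sub-boxes that the flow separates during a long time \<open>T\<close>, and discard those whose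
  orbit comes close to the critical locus meanwhile. If at most half of them are lost at each step,
  the remaining Cantor set has dimension tending to \<open>m n\<close> as \<open>T \<rightarrow> \<infinity>\<close>. By Mahler's criterion the
  critical locus is compact, so it suffices to count the sub-boxes that actually meet it, starting
  from an arbitrary limit lattice.

  For the Euclidean norm a critical lattice corresponds to a perfect quadratic form, which is
  determined by its minimal vectors; finitely many sets of minimal vectors are possible during one
  unit of time, so a bounded number of sub-boxes per unit of time is lost, against exponentially many
  in total.

  For a cylinder a critical lattice has a vector on the top face, which restricts the time to finitely
  many values, and either a vector on the lateral face that is not horizontal, or two independent
  horizontal vectors. In the first case the matrix lies on a convex curve, which meets few
  sub-boxes. The second case is excluded by keeping the orbits of the lattice and of its dual bounded;
  this loses few further sub-boxes by the simplex lemma.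
\<close>

section \<open>Hausdorff measure and thickness\<close>

text \<open>A cell of generation \<open>s + T\<close> is tested at the times
  \<open>{s - T..s}\<close>, in its past. There the flow contracts the rescaled parameter
  \<open>b\<close> of the cell: \<open>j\<close> units before \<open>s\<close> only
  \<open>shrink \<alpha> \<beta> j b\<close> matters, and it stays in the unit box. Hence a unit of
  time costs boundedly many points or curves, uniformly in the lattice, whereas in its future a box
  unfolds exponentially. The gap below the critical radius is chosen after \<open>T\<close>: cells
  are counted for exact hits of the critical locus, and compactness then supplies a gap for this
  \<open>T\<close>. The price is that only properties surviving a limit of lattices can be used. For
  the cylinder the history of a box is therefore turned into a lower bound for the dual vectors five
  generations earlier. With the bound \<open>exp (- 3 * T)\<close> for bad approximability, this
  delay forces the covolume of a horizontal lattice plane to be of order \<open>exp (2 * T)\<close>,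
  too large for two contact vectors even after flowing back for a time up to
  \<open>T\<close>.\<close>

lemma norm_mat_le_sum: "norm (X::real^'n^'m) \<le> (\<Sum>i\<in>UNIV. \<Sum>j\<in>UNIV. \<bar>X$i$j\<bar>)"
proof -
  have "norm X \<le> (\<Sum>i\<in>UNIV. norm (X$i))"
    unfolding norm_vec_def by (rule L2_set_le_sum) auto
  also have "\<dots> \<le> (\<Sum>i\<in>UNIV. \<Sum>j\<in>UNIV. \<bar>X$i$j\<bar>)"
    by (intro sum_mono norm_le_l1_cart)
  finally show ?thesis .
qed

lemma component_le_norm_mat: "\<bar>X$i$j\<bar> \<le> norm (X::real^'n^'m)"
  by (meson component_le_norm_cart order_trans Finite_Cartesian_Product.norm_nth_le)

lemma dist_mat_le:
  fixes X Y :: "real^'n^'m"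
  assumes "\<And>i j. \<bar>X$i$j - Y$i$j\<bar> \<le> L"
  shows "dist X Y \<le> real (CARD('m) * CARD('n)) * L"
proof -
  have "dist X Y \<le> (\<Sum>i\<in>UNIV. \<Sum>j\<in>UNIV. \<bar>(X - Y)$i$j\<bar>)"
    unfolding dist_norm by (rule norm_mat_le_sum)
  also have "\<dots> \<le> (\<Sum>i\<in>(UNIV::'m set). \<Sum>j\<in>(UNIV::'n set). L)"
    by (intro sum_mono) (use assms in auto)
  finally show ?thesis by simp
qed

text \<open>Cutting the cube into \<open>K ^ D\<close> equal cubes of diameter at most
  \<open>a / K\<close> gives the sum \<open>a powr s * K powr (D - s)\<close>, which tends to 0
  because \<open>s > D\<close>.\<close>

lemma cube_cover:
  fixes p \<delta> e s :: real
  assumes p: "p > 0" and \<delta>: "\<delta> > 0" and e: "e > 0" and s: "s > real (CARD('m) * CARD('n))"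
  shows "\<exists>U::nat \<Rightarrow> (real^'n^'m) set. {X. \<forall>i j. \<bar>X$i$j\<bar> \<le> p} \<subseteq> (\<Union>i. U i) \<and>
     (\<forall>i. bounded (U i) \<and> diameter (U i) \<le> \<delta>) \<and> (\<Sum>i. diam_pow s (U i)) \<le> ennreal e"
proof -
  define D where "D = CARD('m) * CARD('n)"
  have D: "D > 0" unfolding D_def by simp
  define a where "a = real D * (2 * p)"
  have a: "a > 0" using D p by (simp add: a_def)
  have "(\<lambda>K. a powr s * real K powr (real D - s)) \<longlonglongrightarrow> a powr s * 0"
    by (intro tendsto_mult tendsto_const tendsto_neg_powr filterlim_real_sequentially)
       (use s in \<open>simp add: D_def\<close>)
  then have "eventually (\<lambda>K. a powr s * real K powr (real D - s) < e) sequentially"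
    using e by (auto dest!: order_tendstoD(2)[where a = e])
  moreover have "(\<lambda>K. a / real K) \<longlonglongrightarrow> 0" by (rule lim_const_over_n)
  then have "eventually (\<lambda>K. a / real K < \<delta>) sequentially"
    using \<delta> by (auto dest!: order_tendstoD(2)[where a = \<delta>])
  moreover have "eventually (\<lambda>K. K > 0) sequentially" by (rule eventually_gt_at_top)
  ultimately have "eventually (\<lambda>K. K > 0 \<and> a / real K < \<delta> \<and> a powr s * real K powr (real D - s) < e) sequentially"
    by eventually_elim auto
  then obtain K where K: "K > 0" "a / real K < \<delta>" "a powr s * real K powr (real D - s) < e"
    by (auto simp: eventually_at_top_linorder)
  define cube :: "('m \<times> 'n \<Rightarrow> nat) \<Rightarrow> (real^'n^'m) set" where
    "cube c = {X. \<forall>i j. -p + 2*p/K * c (i,j) \<le> X$i$j \<and> X$i$j \<le> -p + 2*p/K * (c (i,j) + 1)}" for c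
  define I where "I = PiE (UNIV::('m \<times> 'n) set) (\<lambda>_. {..<K})"
  have cI: "card I = K ^ D" unfolding I_def D_def
    by (subst card_PiE) auto
  have fI: "finite I" unfolding I_def by (rule finite_PiE) auto
  obtain g where g: "bij_betw g {0..<K^D} I" using ex_bij_betw_nat_finite[OF fI] cI by auto
  define U where "U i = (if i < K^D then cube (g i) else {})" for i
  have dc: "dist X Y \<le> a / K" if "X \<in> cube c" "Y \<in> cube c" for X Y c
  proof -
    have "\<bar>X$i$j - Y$i$j\<bar> \<le> 2*p/K" for i j
    proof -
      have "-p + 2*p/K * c (i,j) \<le> X$i$j" "X$i$j \<le> -p + 2*p/K * (c (i,j) + 1)"
        "-p + 2*p/K * c (i,j) \<le> Y$i$j" "Y$i$j \<le> -p + 2*p/K * (c (i,j) + 1)"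
        using that unfolding cube_def by auto
      then show ?thesis by (simp add: distrib_left abs_le_iff)
    qed
    from dist_mat_le[of X Y, OF this] show ?thesis by (simp add: a_def D_def)
  qed
  have aK: "a / K \<ge> 0" using a by simp
  have bd: "bounded (cube c)" for c
  proof (cases "cube c = {}")
    case False
    then obtain X where "X \<in> cube c" by auto
    then show ?thesis using dc unfolding bounded_def by blast
  qed auto
  have dia: "diameter (cube c) \<le> a / K" for c
    by (rule diameter_le) (use dc aK in \<open>auto simp: dist_norm\<close>)
  have "X \<in> (\<Union>i. U i)" if X: "\<And>i j. \<bar>X$i$j\<bar> \<le> p" for X
  proof -
    \<comment> \<open>Rounding up and subtracting 1 puts the right end \<open>y = K\<close> into the
      last cube; at \<open>y = 0\<close> the truncated subtraction yields 0.\<close>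
    define c where "c = (\<lambda>(i,j). nat \<lceil>(X$i$j + p) * K / (2*p)\<rceil> - 1)"
    have cb: "c (i,j) < K \<and> -p + 2*p/K * c (i,j) \<le> X$i$j \<and> X$i$j \<le> -p + 2*p/K * (c (i,j) + 1)" for i j
    proof -
      define y where "y = (X$i$j + p) * K / (2*p)"
      have "X$i$j + p \<ge> 0" "X$i$j + p \<le> 2*p" using X[of i j] by auto
      then have "0 \<le> y" unfolding y_def using p K(1) by simp
      have "(X$i$j + p) * K \<le> 2*p * K" using \<open>X$i$j + p \<le> 2*p\<close> by (intro mult_right_mono) auto
      then have "y \<le> K" unfolding y_def using p by (simp add: divide_le_eq mult.commute)
      note y = \<open>0 \<le> y\<close> \<open>y \<le> K\<close>
      have Xy: "X$i$j = -p + 2*p/K * y" using p K(1) by (simp add: y_def)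
      have c: "c (i,j) = nat \<lceil>y\<rceil> - 1" by (simp add: c_def y_def)
      have "nat \<lceil>y\<rceil> \<le> K" using y by (simp add: ceiling_le_iff nat_le_iff)
      then have 1: "c (i,j) < K" using K(1) c by linarith
      have 2: "real (c (i,j)) \<le> y \<and> y \<le> c (i,j) + 1" using y c
        by (cases "y = 0") (auto simp: of_nat_diff, linarith+)
      show ?thesis using 1 2 p K(1) unfolding Xy
        by (auto intro!: mult_left_mono divide_right_mono)
    qed
    have "c \<in> I" using cb unfolding I_def by auto
    then obtain i where "i < K^D" "g i = c" using g unfolding bij_betw_def by auto
    moreover have "X \<in> cube c" using cb unfolding cube_def by auto
    ultimately show ?thesis by (auto simp: U_def intro!: exI[of _ i])
  qed
  then have cov: "{X. \<forall>i j. \<bar>X$i$j\<bar> \<le> p} \<subseteq> (\<Union>i. U i)" by auto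
  have s0: "s > 0" using s by (meson le_less_trans of_nat_0_le_iff)
  have dp: "diam_pow s (U i) \<le> ennreal ((a / K) powr s)" for i
    unfolding diam_pow_def U_def using s0 dia diameter_ge_0[OF bd]
    by (auto intro!: ennreal_leI powr_mono2)
  have "(\<Sum>i. diam_pow s (U i)) = (\<Sum>i<K^D. diam_pow s (U i))"
    by (rule suminf_finite) (auto simp: U_def diam_pow_def)
  also have "\<dots> \<le> (\<Sum>i<K^D. ennreal ((a / K) powr s))" by (intro sum_mono dp)
  also have "\<dots> = ennreal (real (K^D) * (a / K) powr s)"
    by (simp add: ennreal_mult' ennreal_of_nat_eq_real_of_nat)
  also have "real (K^D) * (a / K) powr s = a powr s * real K powr (real D - s)"
    using a K(1) by (simp add: powr_divide powr_diff powr_realpow)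
  also have "ennreal \<dots> \<le> ennreal e" using K(3) by (intro ennreal_leI) auto
  finally have sm: "(\<Sum>i. diam_pow s (U i)) \<le> ennreal e" .
  have "bounded (U i) \<and> diameter (U i) \<le> \<delta>" for i
    using bd dia[of "g i"] K(2) \<delta> by (auto simp: U_def)
  then show ?thesis using cov sm by blast
qed

text \<open>Countable subadditivity by hand: the cube of half side \<open>real p + 1\<close> gets
  the budget \<open>e * (1/2)^Suc p\<close>, and \<open>prod_decode\<close> merges the covers into
  one sequence.\<close>

lemma hausdorff_measure_eq_0:
  fixes E :: "(real^'n^'m) set"
  assumes s: "s > real (CARD('m) * CARD('n))"
  shows "hausdorff_measure s E = 0"
proof -
  have "(INF U\<in>delta_covers \<delta> E. \<Sum>i. diam_pow s (U i)) = 0" if \<delta>: "\<delta> > 0" for \<delta>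
  proof -
    have "(INF U\<in>delta_covers \<delta> E. \<Sum>i. diam_pow s (U i)) \<le> 0 + ennreal e" if e: "e > 0" for e
    proof -
      have "\<forall>p. \<exists>U::nat \<Rightarrow> (real^'n^'m) set. {X. \<forall>i j. \<bar>X$i$j\<bar> \<le> real p + 1} \<subseteq> (\<Union>i. U i) \<and>
         (\<forall>i. bounded (U i) \<and> diameter (U i) \<le> \<delta>) \<and> (\<Sum>i. diam_pow s (U i)) \<le> ennreal (e * (1/2)^Suc p)"
        by (intro allI cube_cover) (use \<delta> e s in auto)
      from choice[OF this] obtain U :: "nat \<Rightarrow> nat \<Rightarrow> (real^'n^'m) set" where
        U0: "\<forall>p. {X. \<forall>i j. \<bar>X$i$j\<bar> \<le> real p + 1} \<subseteq> (\<Union>i. U p i) \<and>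
         (\<forall>i. bounded (U p i) \<and> diameter (U p i) \<le> \<delta>) \<and>
         (\<Sum>i. diam_pow s (U p i)) \<le> ennreal (e * (1/2)^Suc p)" ..
      note U = U0[rule_format, THEN conjunct1] U0[rule_format, THEN conjunct2, THEN conjunct1, rule_format]
        U0[rule_format, THEN conjunct2, THEN conjunct2]
      define V where "V n = (case prod_decode n of (p, i) \<Rightarrow> U p i)" for n
      have "X \<in> (\<Union>n. V n)" for X
      proof -
        obtain p :: nat where p: "norm X \<le> p" using real_arch_simple by blast
        have "\<bar>X$i$j\<bar> \<le> real p + 1" for i j using component_le_norm_mat[of X i j] p by simp
        then obtain i where "X \<in> U p i" using U(1)[of p] by blast
        then have "X \<in> V (prod_encode (p, i))" by (simp add: V_def)
        then show ?thesis by blast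
      qed
      then have "V \<in> delta_covers \<delta> E"
        unfolding delta_covers_def using U(2) by (auto simp: V_def split: prod.splits)
      then have "(INF U\<in>delta_covers \<delta> E. \<Sum>i. diam_pow s (U i)) \<le> (\<Sum>n. diam_pow s (V n))"
        by (rule INF_lower)
      also have "\<dots> = (\<Sum>n. (\<lambda>(p,i). diam_pow s (U p i)) (prod_decode n))"
        by (simp add: V_def case_prod_unfold)
      also have "\<dots> = (\<Sum>p. \<Sum>i. diam_pow s (U p i))"
        using suminf_ennreal_2dimen[of "\<lambda>p. \<Sum>i. diam_pow s (U p i)" "\<lambda>(p,i). diam_pow s (U p i)"]
        by (simp add: comp_def)
      also have "\<dots> \<le> (\<Sum>p. ennreal (e * (1/2)^Suc p))"
        by (intro suminf_le U(3)) auto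
      also have "\<dots> = ennreal (\<Sum>p. e * (1/2)^Suc p)"
        by (rule suminf_ennreal2) (use e in \<open>auto intro!: summable_mult summable_geometric\<close>)
      also have "(\<Sum>p. e * (1/2)^Suc p) = e"
        using sums_mult[OF power_half_series, of e] by (simp add: sums_iff)
      finally show ?thesis by simp
    qed
    then have "(INF U\<in>delta_covers \<delta> E. \<Sum>i. diam_pow s (U i)) \<le> 0"
      by (rule ennreal_le_epsilon)
    then show ?thesis by simp
  qed
  then have "hausdorff_measure s E \<le> 0" unfolding hausdorff_measure_def
    by (intro SUP_least) simp
  then show ?thesis by simp
qed

text \<open>The dimension never exceeds the number of entries, by
  \<open>hausdorff_measure_eq_0\<close>, so thickness is only a matter of the lower bound: no
  measure of smaller exponent may vanish.\<close>

lemma thickI: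
  fixes S :: "(real^'n^'m) set"
  assumes "\<And>U s. open U \<Longrightarrow> U \<noteq> {} \<Longrightarrow> 0 \<le> s \<Longrightarrow> s < real (CARD('m) * CARD('n)) \<Longrightarrow>
     hausdorff_measure s (S \<inter> U) \<noteq> 0"
  shows "thick S"
  unfolding thick_def
proof (intro allI impI, elim conjE)
  fix U :: "(real^'n^'m) set" assume U: "open U" "U \<noteq> {}"
  define D where "D = real (CARD('m) * CARD('n))"
  have "hausdorff_dim (S \<inter> U) = ennreal D"
  proof (rule antisym)
    show "hausdorff_dim (S \<inter> U) \<le> ennreal D"
    proof (rule ennreal_le_epsilon)
      fix e :: real assume e: "e > 0"
      have "hausdorff_dim (S \<inter> U) \<le> ennreal (D + e)" unfolding hausdorff_dim_def
        by (rule Inf_lower, rule CollectI, rule exI[of _ "D + e"])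
          (use e hausdorff_measure_eq_0[of "D + e" "S \<inter> U"] in \<open>simp add: D_def\<close>)
      also have "\<dots> = ennreal D + ennreal e" using e by (simp add: D_def ennreal_plus)
      finally show "hausdorff_dim (S \<inter> U) \<le> ennreal D + ennreal e" .
    qed
    show "ennreal D \<le> hausdorff_dim (S \<inter> U)" unfolding hausdorff_dim_def
    proof (rule Inf_greatest, clarify)
      fix s :: real assume "0 \<le> s" "hausdorff_measure s (S \<inter> U) = 0"
      then have "D \<le> s" using assms[OF U, of s] unfolding D_def by (meson not_le)
      then show "ennreal D \<le> ennreal s" by (rule ennreal_leI)
    qed
  qed
  then show "hausdorff_dim (S \<inter> U) = of_nat (CARD('m) * CARD('n))"
    unfolding D_def by (simp only: ennreal_of_nat_eq_real_of_nat)
qed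

section \<open>Trees of boxes\<close>

text \<open>A box at time \<open>t\<close> consists of matrices that the flow has not yet separated from the corner
  \<open>A\<close>; \<open>cells w T\<close> labels the sub-boxes at time \<open>t + T\<close>.\<close>

definition wbox :: "('m \<times> 'n \<Rightarrow> real) \<Rightarrow> real \<Rightarrow> real^'n^'m \<Rightarrow> (real^'n^'m) set" where
  "wbox w t A = {X. \<forall>i j. A$i$j \<le> X$i$j \<and> X$i$j \<le> A$i$j + exp (- t * w (i,j))}"

definition child :: "('m \<times> 'n \<Rightarrow> real) \<Rightarrow> real \<Rightarrow> real^'n^'m \<Rightarrow> ('m \<times> 'n \<Rightarrow> nat) \<Rightarrow> real^'n^'m" where
  "child w t A c = (\<chi> i j. A$i$j + real (c (i,j)) * exp (- t * w (i,j)))"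

definition cells :: "('m \<times> 'n \<Rightarrow> real) \<Rightarrow> real \<Rightarrow> ('m \<times> 'n \<Rightarrow> nat) set" where
  "cells w T = PiE UNIV (\<lambda>l. {..<nat \<lfloor>exp (T * w l)\<rfloor>})"

lemma cells_iff: "c \<in> cells w T \<longleftrightarrow> (\<forall>l. c l < nat \<lfloor>exp (T * w l)\<rfloor>)"
  unfolding cells_def by auto

lemma finite_cells [simp]: "finite (cells (w::'m::finite \<times> 'n::finite \<Rightarrow> real) T)"
  unfolding cells_def by (rule finite_PiE) auto

lemma card_cells: "card (cells (w::'m::finite \<times> 'n::finite \<Rightarrow> real) T) = (\<Prod>l\<in>UNIV. nat \<lfloor>exp (T * w l)\<rfloor>)"
  unfolding cells_def by (subst card_PiE) auto

text \<open>Rounding the number of sub-intervals down to an integer costs at most a factor 2 per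
  matrix entry. The factor does not depend on \<open>T\<close>, so it costs no dimension in the
  limit.\<close>

lemma floor_exp_ge_half: "real (nat \<lfloor>exp x\<rfloor>) \<ge> exp x / 2" if "x \<ge> 0"
proof -
  have "exp x \<ge> 1" using that by simp
  then have 1: "\<lfloor>exp x\<rfloor> \<ge> 1" by linarith
  have "exp x < of_int \<lfloor>exp x\<rfloor> + 1" by linarith
  moreover have "real (nat \<lfloor>exp x\<rfloor>) = of_int \<lfloor>exp x\<rfloor>" using 1 by simp
  ultimately show ?thesis using 1 by linarith
qed

lemma corner_in_wbox: "A \<in> wbox w t A"
  unfolding wbox_def by auto

lemma cells_step:
  assumes "c \<in> cells w T"
  shows "(real (c l) + 1) * exp (- (t + T) * w l) \<le> exp (- t * w l)"
proof -
  have "c l < nat \<lfloor>exp (T * w l)\<rfloor>" using assms unfolding cells_iff by blast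
  then have "real (c l) + 1 \<le> exp (T * w l)" by linarith
  then have "(real (c l) + 1) * exp (- (t + T) * w l) \<le> exp (T * w l) * exp (- (t + T) * w l)"
    by (rule mult_right_mono) simp
  also have "\<dots> = exp (- t * w l)" by (simp add: exp_add[symmetric] algebra_simps)
  finally show ?thesis .
qed

lemma wbox_child_subset:
  assumes "c \<in> cells w T"
  shows "wbox w (t + T) (child w (t + T) A c) \<subseteq> wbox w t A"
proof
  fix X assume X: "X \<in> wbox w (t + T) (child w (t + T) A c)"
  have "A$i$j \<le> X$i$j \<and> X$i$j \<le> A$i$j + exp (- t * w (i,j))" for i j
  proof -
    have "A$i$j + real (c (i,j)) * exp (- (t+T) * w (i,j)) \<le> X$i$j"
      "X$i$j \<le> A$i$j + real (c (i,j)) * exp (- (t+T) * w (i,j)) + exp (- (t+T) * w (i,j))"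
      using X unfolding wbox_def child_def by auto
    moreover have "real (c (i,j)) * exp (- (t+T) * w (i,j)) \<ge> 0" by simp
    moreover note cells_step[OF assms, of "(i,j)" t]
    ultimately show ?thesis by (simp only: distrib_right mult_1 conj_imp_eq_imp_imp) argo
  qed
  then show "X \<in> wbox w t A" unfolding wbox_def by auto
qed

lemma closed_wbox: "closed (wbox w t A)"
proof -
  have "wbox w t A = (\<Inter>i. \<Inter>j. {X. A$i$j \<le> X$i$j} \<inter> {X. X$i$j \<le> A$i$j + exp (- t * w (i,j))})"
    unfolding wbox_def by auto
  then show ?thesis
    by (auto intro!: closed_INT closed_Int closed_Collect_le continuous_intros)
qed

lemma bounded_wbox: "bounded (wbox (w::'m::finite \<times> 'n::finite \<Rightarrow> real) t A)"
proof -
  define K where "K = (\<Sum>i\<in>UNIV. \<Sum>j\<in>UNIV. \<bar>A$i$j\<bar> + exp (- t * w (i,j)))"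
  have "norm X \<le> K" if "X \<in> wbox w t A" for X
  proof -
    have "norm X \<le> (\<Sum>i\<in>UNIV. norm (X$i))"
      unfolding norm_vec_def by (rule L2_set_le_sum) auto
    also have "\<dots> \<le> (\<Sum>i\<in>UNIV. \<Sum>j\<in>UNIV. \<bar>X$i$j\<bar>)"
      by (intro sum_mono norm_le_l1_cart)
    also have "\<dots> \<le> K" unfolding K_def
    proof (intro sum_mono)
      fix i j
      have "A$i$j \<le> X$i$j \<and> X$i$j \<le> A$i$j + exp (- t * w (i,j))" using that unfolding wbox_def by auto
      then show "\<bar>X$i$j\<bar> \<le> \<bar>A$i$j\<bar> + exp (- t * w (i,j))" using exp_gt_zero[of "- t * w (i,j)"] by linarith
    qed
    finally show ?thesis .
  qed
  then show ?thesis unfolding bounded_iff by blast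
qed

lemma compact_wbox: "compact (wbox (w::'m::finite \<times> 'n::finite \<Rightarrow> real) t A)"
  using closed_wbox bounded_wbox compact_eq_bounded_closed by blast

text \<open>Exactly \<open>P\<close> children are prescribed at every level and for every matrix,
  whether or not it occurs in the tree: the counts at a level are then powers of \<open>P\<close>,
  and counting boxes replaces the construction of a measure.\<close>

locale box_tree =
  fixes w :: "'m::finite \<times> 'n::finite \<Rightarrow> real" and T s0 :: real
    and ch :: "nat \<Rightarrow> real^'n^'m \<Rightarrow> ('m \<times> 'n \<Rightarrow> nat) set" and A0 :: "real^'n^'m" and P :: nat
  assumes T: "T > 0" and s0: "s0 \<ge> 0" and P: "P > 0"
    and ch_sub: "ch k A \<subseteq> cells w T" and ch_card: "card (ch k A) = P"
begin

definition lev :: "nat \<Rightarrow> real" where "lev k = s0 + real k * T"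

lemma lev_Suc: "lev (Suc k) = lev k + T" unfolding lev_def by (simp add: algebra_simps)

fun des :: "nat \<Rightarrow> real^'n^'m \<Rightarrow> nat \<Rightarrow> (real^'n^'m) set" where
  "des k A 0 = {A}"
| "des k A (Suc j) = (\<Union>B\<in>des k A j. child w (lev (Suc (k + j))) B ` ch (k + j) B)"

lemma finite_ch: "finite (ch k A)"
  using ch_sub finite_cells finite_subset by blast

lemma finite_des: "finite (des k A j)"
  by (induction j) (auto simp: finite_ch)

lemma card_des_le: "card (des k A j) \<le> P ^ j"
proof (induction j)
  case (Suc j)
  have "card (des k A (Suc j)) \<le> (\<Sum>B\<in>des k A j. card (child w (lev (Suc (k + j))) B ` ch (k + j) B))"
    by (simp add: card_UN_le finite_des)
  also have "\<dots> \<le> (\<Sum>B\<in>des k A j. P)"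
    by (intro sum_mono) (metis card_image_le ch_card finite_ch)
  also have "\<dots> = card (des k A j) * P" by simp
  also have "\<dots> \<le> P ^ j * P" using Suc.IH by (rule mult_le_mono1)
  finally show ?case by (simp add: mult.commute)
qed simp

lemma des_add: "des k A (i + j) = (\<Union>B\<in>des k A i. des (k + i) B j)"
  by (induction j) (auto simp: add.assoc)

lemma des_box: "B \<in> des k A j \<Longrightarrow> wbox w (lev (k + j)) B \<subseteq> wbox w (lev k) A"
proof (induction j arbitrary: B)
  case (Suc j)
  then obtain C c where C: "C \<in> des k A j" "c \<in> ch (k + j) C" "B = child w (lev (Suc (k + j))) C c" by auto
  have "wbox w (lev (k + Suc j)) B \<subseteq> wbox w (lev (k + j)) C"
    unfolding C(3) using wbox_child_subset[of c w T "lev (k+j)" C] C(2) ch_sub lev_Suc[of "k+j"] by auto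
  then show ?case using Suc.IH[OF C(1)] by simp
qed simp

abbreviation "node \<equiv> des 0 A0"

lemma node_Suc: "node (Suc k) = (\<lambda>(B,c). child w (lev (Suc k)) B c) ` (SIGMA B:node k. ch k B)"
  by auto

text \<open>Boxes of one level do not overlap. If the parents differ, their corners are at least a
  parent side apart in some entry; both offsets lie between 0 and that side minus one child side
  (\<open>cells_step\<close>), so one child side of the distance remains.\<close>

lemma node_sep:
  assumes "A \<in> node k" "B \<in> node k" "A \<noteq> B"
  shows "\<exists>i j. exp (- lev k * w (i,j)) \<le> \<bar>A$i$j - B$i$j\<bar>"
  using assms
proof (induction k arbitrary: A B)
  case (Suc k)
  obtain A' c where A: "A' \<in> node k" "c \<in> ch k A'" "A = child w (lev (Suc k)) A' c" using Suc.prems(1) by auto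
  obtain B' d where B: "B' \<in> node k" "d \<in> ch k B'" "B = child w (lev (Suc k)) B' d" using Suc.prems(2) by auto
  define q where "q l = exp (- lev (Suc k) * w l)" for l
  have q: "q l > 0" for l by (simp add: q_def)
  have Aij: "A$i$j = A'$i$j + real (c (i,j)) * q (i,j)" for i j by (simp add: A(3) child_def q_def)
  have Bij: "B$i$j = B'$i$j + real (d (i,j)) * q (i,j)" for i j by (simp add: B(3) child_def q_def)
  show ?case
  proof (cases "A' = B'")
    case True
    then obtain i j where ij: "c (i,j) \<noteq> d (i,j)" using Suc.prems(3) A(3) B(3)
      by (metis ext surj_pair)
    then have "\<bar>real (c (i,j)) - real (d (i,j))\<bar> \<ge> 1" by linarith
    then have "\<bar>real (c (i,j)) - real (d (i,j))\<bar> * q (i,j) \<ge> 1 * q (i,j)"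
      by (rule mult_right_mono) (use q[of "(i,j)"] in auto)
    also have "\<bar>real (c (i,j)) - real (d (i,j))\<bar> * q (i,j) = \<bar>(real (c (i,j)) - real (d (i,j))) * q (i,j)\<bar>"
      using q[of "(i,j)"] by (simp add: abs_mult)
    also have "\<dots> = \<bar>A$i$j - B$i$j\<bar>" using True by (simp add: Aij Bij left_diff_distrib)
    finally show ?thesis unfolding q_def by auto
  next
    case False
    from Suc.IH[OF A(1) B(1) False] obtain i j where
      ij: "exp (- lev k * w (i,j)) \<le> \<bar>A'$i$j - B'$i$j\<bar>" by auto
    have "(real (c (i,j)) + 1) * q (i,j) \<le> exp (- lev k * w (i,j))"
      using cells_step[of c w T "(i,j)" "lev k"] A(2) ch_sub unfolding q_def lev_Suc by auto
    moreover have "(real (d (i,j)) + 1) * q (i,j) \<le> exp (- lev k * w (i,j))"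
      using cells_step[of d w T "(i,j)" "lev k"] B(2) ch_sub unfolding q_def lev_Suc by auto
    moreover have "real (c (i,j)) * q (i,j) \<ge> 0" "real (d (i,j)) * q (i,j) \<ge> 0"
      using q[of "(i,j)"] by auto
    ultimately have "q (i,j) \<le> \<bar>A$i$j - B$i$j\<bar>"
      using ij unfolding Aij Bij distrib_right by linarith
    then show ?thesis unfolding q_def by auto
  qed
qed simp

text \<open>Injectivity is the point: equal children of distinct parents would have offsets that
  differ by a full parent side, which \<open>cells_step\<close> excludes.\<close>

lemma card_node: "card (node k) = P ^ k"
proof (induction k)
  case (Suc k)
  have "inj_on (\<lambda>(B,c). child w (lev (Suc k)) B c) (SIGMA B:node k. ch k B)"
  proof (rule inj_onI, clarify)
    fix A c B d assume A: "A \<in> node k" "c \<in> ch k A" and B: "B \<in> node k" "d \<in> ch k B"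
      and eq: "child w (lev (Suc k)) A c = child w (lev (Suc k)) B d"
    define q where "q l = exp (- lev (Suc k) * w l)" for l
    have q: "q l > 0" for l by (simp add: q_def)
    have e: "A$i$j + real (c (i,j)) * q (i,j) = B$i$j + real (d (i,j)) * q (i,j)" for i j
      using arg_cong[OF eq, of "\<lambda>X. X$i$j"] by (simp add: child_def q_def)
    have AB: "A = B"
    proof (rule ccontr)
      assume "A \<noteq> B"
      from node_sep[OF A(1) B(1) this] obtain i j where
        ij: "exp (- lev k * w (i,j)) \<le> \<bar>A$i$j - B$i$j\<bar>" by auto
      have "(real (c (i,j)) + 1) * q (i,j) \<le> exp (- lev k * w (i,j))"
        using cells_step[of c w T "(i,j)" "lev k"] A(2) ch_sub unfolding q_def lev_Suc by auto
      moreover have "(real (d (i,j)) + 1) * q (i,j) \<le> exp (- lev k * w (i,j))"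
        using cells_step[of d w T "(i,j)" "lev k"] B(2) ch_sub unfolding q_def lev_Suc by auto
      moreover have "real (c (i,j)) * q (i,j) \<ge> 0" "real (d (i,j)) * q (i,j) \<ge> 0"
        using q[of "(i,j)"] by auto
      ultimately show False using ij e[of i j] q[of "(i,j)"] unfolding distrib_right by linarith
    qed
    have "c l = d l" for l
    proof (cases l)
      case (Pair i j)
      then show ?thesis using e[of i j] q[of "(i,j)"] AB by auto
    qed
    then show "A = B \<and> c = d" using AB by auto
  qed
  then have "card (node (Suc k)) = card (SIGMA B:node k. ch k B)"
    unfolding node_Suc by (rule card_image)
  also have "\<dots> = (\<Sum>B\<in>node k. P)" by (subst card_SigmaI) (auto simp: finite_des finite_ch ch_card)
  also have "\<dots> = P ^ Suc k" using Suc.IH by simp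
  finally show ?case .
qed simp

text \<open>Measured in units of the side, the integer part of the corner determines the node, by
  \<open>node_sep\<close>. A node that meets the ball has its corner in an interval of length
  \<open>3 * \<rho>\<close> per entry, hence at most
  \<open>3 * \<rho> * exp (lev k * w l) + 2\<close> values; the 2 is absorbed because a side is at
  most \<open>\<rho>\<close>.\<close>

lemma card_node_meet:
  assumes \<rho>: "\<And>l. exp (- lev k * w l) \<le> \<rho>"
  shows "real (card {A\<in>node k. wbox w (lev k) A \<inter> ball x \<rho> \<noteq> {}}) \<le>
     (\<Prod>l\<in>UNIV. 5 * \<rho> * exp (lev k * w l))"
proof -
  let ?S = "{A\<in>node k. wbox w (lev k) A \<inter> ball x \<rho> \<noteq> {}}"
  define e where "e l = exp (lev k * w l)" for l
  have e: "e l > 0" for l by (simp add: e_def)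
  have e1: "exp (- lev k * w l) * e l = 1" for l by (simp add: e_def exp_minus)
  define y where "y l = x $ fst l $ snd l" for l
  define f where "f A = (\<lambda>l. \<lfloor>A $ fst l $ snd l * e l\<rfloor>)" for A :: "real^'n^'m"
  define R where "R = PiE UNIV (\<lambda>l. {\<lfloor>(y l - 2 * \<rho>) * e l\<rfloor> .. \<lfloor>(y l + \<rho>) * e l\<rfloor>})"
  have "inj_on f ?S"
  proof (rule inj_onI)
    fix A B assume A: "A \<in> ?S" and B: "B \<in> ?S" and eq: "f A = f B"
    show "A = B"
    proof (rule ccontr)
      assume "A \<noteq> B"
      then obtain i j where ij: "exp (- lev k * w (i,j)) \<le> \<bar>A$i$j - B$i$j\<bar>"
        using node_sep[of A k B] A B by auto
      then have "exp (- lev k * w (i,j)) * e (i,j) \<le> \<bar>A$i$j - B$i$j\<bar> * e (i,j)"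
        by (rule mult_right_mono) (use e[of "(i,j)"] in auto)
      then have "1 \<le> \<bar>A$i$j - B$i$j\<bar> * e (i,j)" unfolding e1 .
      also have "\<dots> = \<bar>A$i$j * e (i,j) - B$i$j * e (i,j)\<bar>"
        unfolding left_diff_distrib[symmetric] using e[of "(i,j)"] by (simp add: abs_mult)
      finally have "1 \<le> \<bar>A$i$j * e (i,j) - B$i$j * e (i,j)\<bar>" .
      moreover have "\<lfloor>A$i$j * e (i,j)\<rfloor> = \<lfloor>B$i$j * e (i,j)\<rfloor>"
        using fun_cong[OF eq, of "(i,j)"] by (simp add: f_def)
      ultimately show False by linarith
    qed
  qed
  moreover have "f ` ?S \<subseteq> R"
  proof (rule image_subsetI)
    fix A assume "A \<in> ?S"
    then obtain X where X: "X \<in> wbox w (lev k) A" "dist x X < \<rho>" by auto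
    have "f A l \<in> {\<lfloor>(y l - 2 * \<rho>) * e l\<rfloor> .. \<lfloor>(y l + \<rho>) * e l\<rfloor>}" for l
    proof (cases l)
      case (Pair i j)
      have "\<bar>x$i$j - X$i$j\<bar> \<le> dist x X"
        using dist_vec_nth_le[of "x$i" j "X$i"] dist_vec_nth_le[of x i X] by (simp add: dist_real_def)
      then have 1: "\<bar>x$i$j - X$i$j\<bar> < \<rho>" using X(2) by linarith
      have 2: "A$i$j \<le> X$i$j" "X$i$j \<le> A$i$j + exp (- lev k * w (i,j))" using X(1) unfolding wbox_def by auto
      have "y l - 2 * \<rho> \<le> A$i$j" "A$i$j \<le> y l + \<rho>" using 1 2 \<rho>[of "(i,j)"] by (auto simp: y_def Pair)
      then show ?thesis using e[of l] by (auto simp: f_def Pair intro!: floor_mono mult_right_mono)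
    qed
    then show "f A \<in> R" unfolding R_def by auto
  qed
  moreover have fR: "finite R" unfolding R_def by (rule finite_PiE) auto
  ultimately have "card ?S \<le> card R" by (rule card_inj_on_le)
  also have "card R = (\<Prod>l\<in>UNIV. card {\<lfloor>(y l - 2 * \<rho>) * e l\<rfloor> .. \<lfloor>(y l + \<rho>) * e l\<rfloor>})"
    unfolding R_def by (subst card_PiE) auto
  finally have "real (card ?S) \<le> (\<Prod>l\<in>UNIV. real (card {\<lfloor>(y l - 2 * \<rho>) * e l\<rfloor> .. \<lfloor>(y l + \<rho>) * e l\<rfloor>}))"
    using of_nat_mono by fastforce
  also have "\<dots> \<le> (\<Prod>l\<in>UNIV. 5 * \<rho> * e l)"
  proof (rule prod_mono, safe)
    fix l
    have "exp (- lev k * w l) * e l \<le> \<rho> * e l" by (rule mult_right_mono[OF \<rho>]) (use e[of l] in simp)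
    then have "1 \<le> \<rho> * e l" unfolding e1 .
    moreover have "(y l + \<rho>) * e l = (y l - 2*\<rho>) * e l + 3 * (\<rho> * e l)" by (simp add: algebra_simps)
    ultimately show "real (card {\<lfloor>(y l - 2 * \<rho>) * e l\<rfloor> .. \<lfloor>(y l + \<rho>) * e l\<rfloor>}) \<le> 5 * \<rho> * e l"
      by simp linarith
  qed simp
  finally show ?thesis unfolding e_def .
qed

definition limset :: "(real^'n^'m) set" where
  "limset = {X. \<forall>k. \<exists>A\<in>node k. X \<in> wbox w (lev k) A}"

text \<open>Mass distribution principle, with masses replaced by counts of boxes at a deep level, which is
  possible because a countable cover can be reduced to a finite one.\<close>

lemma limset_measure:
  fixes \<Theta> s w0 :: real
  assumes \<Theta>: "exp (T * (\<Sum>l\<in>UNIV. w l)) \<le> \<Theta> * P" "\<Theta> \<ge> 1"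
    and w0: "w0 > 0" "\<And>l. w0 \<le> w l"
    and s: "0 \<le> s" "s < real (CARD('m) * CARD('n)) - ln \<Theta> / (T * w0)"
  shows "hausdorff_measure s limset \<noteq> 0"
proof
  assume H0: "hausdorff_measure s limset = 0"
  define D where "D = CARD('m) * CARD('n)"
  \<comment> \<open>The loss of dimension: per generation the count falls short of a full
    subdivision by \<open>\<Theta>\<close>, while the bound on the sides shrinks by
    \<open>exp (T * w0)\<close>.\<close>
  define \<kappa> where "\<kappa> = ln \<Theta> / (T * w0)"
  define q where "q = real D - \<kappa>"
  have q: "q > 0" "s < q" using s by (auto simp: q_def \<kappa>_def D_def)
  define W where "W = (\<Sum>l\<in>UNIV. w l)"
  define C where "C = 5 ^ D * exp (s0 * W) * \<Theta>"
  have C: "C > 0" using \<Theta> by (simp add: C_def)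
  define \<rho>0 where "\<rho>0 = min 1 (exp (- s0 * w0))"
  have \<rho>0: "\<rho>0 > 0" "\<rho>0 \<le> 1" "\<rho>0 \<le> exp (- s0 * w0)" by (auto simp: \<rho>0_def)
  \<comment> \<open>The first bound makes the final total at most \<open>C * (c + c)\<close>, which
    is at most 1/2; the second keeps every enlarged radius \<open>\<rho> i\<close> below
    \<open>\<rho>0\<close>, hence below 1.\<close>
  define c where "c = min (1 / (4 * C)) (\<rho>0 powr q - (\<rho>0 / 2) powr q)"
  have c: "c > 0" "c \<le> 1 / (4 * C)" "(\<rho>0 / 2) powr q + c \<le> \<rho>0 powr q"
    using C \<rho>0 q by (auto simp: c_def powr_less_mono2)
  have "(INF U\<in>delta_covers (\<rho>0/2) limset. \<Sum>i. diam_pow s (U i)) \<le> hausdorff_measure s limset"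
    unfolding hausdorff_measure_def by (rule SUP_upper) (use \<rho>0 in auto)
  then have "(INF U\<in>delta_covers (\<rho>0/2) limset. \<Sum>i. diam_pow s (U i)) < ennreal c"
    using H0 c by simp
  then obtain U where U: "U \<in> delta_covers (\<rho>0/2) limset" "(\<Sum>i. diam_pow s (U i)) < ennreal c"
    unfolding INF_less_iff by auto
  have Uc: "limset \<subseteq> (\<Union>i. U i)" "\<And>i. bounded (U i)" "\<And>i. diameter (U i) \<le> \<rho>0/2"
    using U(1) unfolding delta_covers_def by auto
  define J where "J = {i. U i \<noteq> {}}"
  define d where "d i = diameter (U i)" for i
  have d: "0 \<le> d i" "d i \<le> \<rho>0/2" for i using Uc diameter_ge_0 by (auto simp: d_def)
  \<comment> \<open>Summable slack, so that a covering set of diameter 0 still gets a ball of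
    positive radius.\<close>
  define \<eta> where "\<eta> i = c * (1/2) ^ Suc i" for i
  have \<eta>: "\<eta> i > 0" "\<eta> i \<le> c" for i
  proof -
    show "\<eta> i > 0" using c by (simp add: \<eta>_def)
    have "(1/2::real) ^ Suc i \<le> 1" by (rule power_le_one) auto
    then have "c * (1/2) ^ Suc i \<le> c * 1" by (rule mult_left_mono) (use c in auto)
    then show "\<eta> i \<le> c" by (simp add: \<eta>_def)
  qed
  define \<rho> where "\<rho> i = (d i powr q + \<eta> i) powr (1/q)" for i
  have \<rho>q: "\<rho> i powr q = d i powr q + \<eta> i" for i
    unfolding \<rho>_def powr_powr using q \<eta>[of i] by (simp add: add_nonneg_nonneg less_imp_le)
  have \<rho>pos: "\<rho> i > 0" for i
    unfolding \<rho>_def using \<eta>[of i] by (metis add_nonneg_pos less_irrefl powr_ge_zero powr_gt_zero)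
  have \<rho>d: "d i < \<rho> i" for i
  proof (rule ccontr)
    assume "\<not> d i < \<rho> i"
    then have "\<rho> i powr q \<le> d i powr q" using \<rho>pos[of i] q by (intro powr_mono2) auto
    then show False using \<rho>q[of i] \<eta>[of i] by simp
  qed
  have \<rho>le: "\<rho> i \<le> \<rho>0" for i
  proof (rule ccontr)
    assume "\<not> \<rho> i \<le> \<rho>0"
    then have "\<rho>0 powr q < \<rho> i powr q" using \<rho>0 q by (intro powr_less_mono2) auto
    moreover have "d i powr q \<le> (\<rho>0/2) powr q" using d[of i] q by (intro powr_mono2) auto
    ultimately show False using \<rho>q[of i] \<eta>[of i] c by linarith
  qed
  have "\<exists>k. exp (- lev k * w0) \<le> \<rho> i" for i
  proof -
    obtain k :: nat where k: "- ln (\<rho> i) / (T * w0) \<le> real k" using real_arch_simple by blast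
    have "T * w0 > 0" using T w0 by simp
    then have "- ln (\<rho> i) \<le> real k * T * w0" using k by (simp only: divide_le_eq mult.assoc if_True)
    also have "\<dots> \<le> lev k * w0" using s0 w0 by (simp add: lev_def)
    finally have "exp (- lev k * w0) \<le> exp (ln (\<rho> i))" by simp
    then show ?thesis using \<rho>pos[of i] by auto
  qed
  \<comment> \<open>The first level whose boxes have sides at most \<open>\<rho> i\<close>.
    Minimality bounds the number of generations, and thereby \<open>\<Theta> ^ k\<close> by a power
    of the radius.\<close>
  define kk where "kk i = (LEAST k. exp (- lev k * w0) \<le> \<rho> i)" for i
  have kk: "exp (- lev (kk i) * w0) \<le> \<rho> i" for i
    unfolding kk_def using LeastI_ex[OF \<open>\<exists>k. exp (- lev k * w0) \<le> \<rho> i\<close>] .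
  have kkm: "\<rho> i < exp (- lev k * w0)" if "k < kk i" for i k
    using not_less_Least[of k "\<lambda>k. exp (- lev k * w0) \<le> \<rho> i"] that unfolding kk_def by auto
  have "lev k \<ge> 0" for k using s0 T by (simp add: lev_def)
  then have lw: "exp (- lev k * w l) \<le> exp (- lev k * w0)" for k l
    using w0 by (simp add: mult_left_mono)
  define x where "x i = (SOME x. x \<in> U i)" for i
  have x: "x i \<in> U i" if "i \<in> J" for i using that unfolding J_def x_def by (simp add: some_in_eq)
  have Ub: "U i \<subseteq> ball (x i) (\<rho> i)" if "i \<in> J" for i
  proof
    fix y assume "y \<in> U i"
    then have "dist (x i) y \<le> d i" unfolding d_def using x[OF that] Uc(2)[of i]
      by (simp add: diameter_bounded_bound)
    then show "y \<in> ball (x i) (\<rho> i)" using \<rho>d[of i] by simp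
  qed
  define cnt where "cnt i = {A\<in>node (kk i). wbox w (lev (kk i)) A \<inter> ball (x i) (\<rho> i) \<noteq> {}}" for i
  have fcnt: "finite (cnt i)" for i unfolding cnt_def using finite_des by auto
  have cnt: "real (card (cnt i)) / P ^ kk i \<le> C * \<rho> i powr q" for i
  proof -
    define k where "k = kk i"
    have "real (card (cnt i)) \<le> (\<Prod>l\<in>UNIV. 5 * \<rho> i * exp (lev k * w l))"
      unfolding cnt_def k_def by (rule card_node_meet) (use lw kk order_trans in blast)
    also have "\<dots> = 5 ^ D * \<rho> i ^ D * exp (lev k * W)"
      by (simp add: prod.distrib D_def card_cartesian_product power_mult_distrib exp_sum[symmetric] sum_distrib_left[symmetric] W_def
        flip: UNIV_Times_UNIV)
    finally have 1: "real (card (cnt i)) \<le> 5 ^ D * \<rho> i ^ D * exp (lev k * W)" .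
    have "exp (lev k * W) = exp (s0 * W) * exp (T * W) ^ k"
      by (simp add: lev_def exp_add[symmetric] exp_of_nat_mult[symmetric] algebra_simps)
    also have "\<dots> \<le> exp (s0 * W) * (\<Theta> * P) ^ k"
      using \<Theta>(1) by (intro mult_left_mono power_mono) (auto simp: W_def)
    finally have 2: "exp (lev k * W) \<le> exp (s0 * W) * \<Theta> ^ k * P ^ k" by (simp add: power_mult_distrib mult.assoc)
    have 3: "\<Theta> ^ k \<le> \<Theta> * \<rho> i powr (- \<kappa>)"
    proof (cases k)
      case 0
      have "\<rho> i powr (- \<kappa>) \<ge> 1 powr (- \<kappa>)"
        using \<rho>pos[of i] \<rho>le[of i] \<rho>0 \<Theta> T w0 by (intro powr_mono2') (auto simp: \<kappa>_def)
      then have "\<rho> i powr (- \<kappa>) \<ge> 1" by simp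
      then show ?thesis using 0 \<Theta>(2) by (simp add: mult_ge1_I)
    next
      case (Suc k')
      then have "\<rho> i < exp (- lev k' * w0)" using kkm[of k' i] k_def by auto
      then have "ln (\<rho> i) \<le> - lev k' * w0" using \<rho>pos[of i] by (metis ln_exp ln_mono less_imp_le)
      also have "\<dots> \<le> - (real k' * T * w0)" using s0 w0 by (simp add: lev_def algebra_simps)
      finally have "ln (\<rho> i) \<le> - (real k' * T * w0)" .
      moreover have "T * w0 > 0" using T w0 by simp
      ultimately have "real k' \<le> - ln (\<rho> i) / (T * w0)"
        by (simp only: le_divide_eq mult.assoc if_True)
      then have "real k' * ln \<Theta> \<le> - ln (\<rho> i) / (T * w0) * ln \<Theta>" using \<Theta>(2) by (intro mult_right_mono) auto
      also have "\<dots> = - \<kappa> * ln (\<rho> i)" by (simp add: \<kappa>_def)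
      finally have "exp (real k' * ln \<Theta>) \<le> \<rho> i powr (- \<kappa>)" using \<rho>pos[of i] by (simp add: powr_def)
      moreover have "exp (real k' * ln \<Theta>) = \<Theta> ^ k'" using \<Theta>(2) by (simp add: exp_of_nat_mult)
      ultimately show ?thesis using Suc \<Theta>(2) by simp
    qed
    have "real (card (cnt i)) \<le> 5 ^ D * \<rho> i ^ D * (exp (s0 * W) * \<Theta> ^ k * P ^ k)"
      by (rule order_trans[OF 1 mult_left_mono[OF 2]]) (use \<rho>pos[of i] in simp)
    also have "\<dots> = 5 ^ D * \<rho> i ^ D * exp (s0 * W) * P ^ k * \<Theta> ^ k" by simp
    also have "\<dots> \<le> 5 ^ D * \<rho> i ^ D * exp (s0 * W) * P ^ k * (\<Theta> * \<rho> i powr (- \<kappa>))"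
      using \<rho>pos[of i] by (intro mult_left_mono 3) auto
    also have "\<dots> = C * (\<rho> i powr D * \<rho> i powr (- \<kappa>)) * P ^ k"
      using \<rho>pos[of i] by (simp add: C_def powr_realpow)
    also have "\<rho> i powr D * \<rho> i powr (- \<kappa>) = \<rho> i powr q" by (simp add: q_def powr_add[symmetric])
    finally show ?thesis using P unfolding k_def by (simp add: divide_le_eq)
  qed
  define FF where "FF k = (\<Union>A\<in>node k. wbox w (lev k) A)" for k
  have cFF: "compact (FF k)" for k unfolding FF_def
    by (intro compact_UN finite_des compact_wbox) 
  have FFdec: "FF (k + j) \<subseteq> FF k" for k j
    unfolding FF_def des_add using des_box by fastforce
  define G where "G = (\<Union>i\<in>J. ball (x i) (\<rho> i))"
  have oG: "open G" unfolding G_def by auto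
  \<comment> \<open>Decreasing compact sets whose intersection lies in \<open>limset\<close>, which
    the open set \<open>G\<close> covers.\<close>
  have "\<exists>K. FF K \<subseteq> G"
  proof (rule ccontr)
    assume "\<nexists>K. FF K \<subseteq> G"
    then have "FF K - G \<noteq> {}" for K by auto
    moreover have "compact (FF K - G)" for K using cFF oG by (rule compact_diff)
    moreover have "FF n - G \<subseteq> FF m - G" if "m \<le> n" for m n
      using FFdec[of m "n - m"] that by auto
    ultimately have "\<Inter> (range (\<lambda>K. FF K - G)) \<noteq> {}" by (intro compact_nest) auto
    then obtain y where y: "\<And>K. y \<in> FF K - G" by auto
    then have "y \<in> limset" unfolding limset_def FF_def by auto
    then obtain i where "y \<in> U i" using Uc(1) by auto
    then have "i \<in> J" by (auto simp: J_def)
    with \<open>y \<in> U i\<close> have "y \<in> G" unfolding G_def using Ub[of i] by blast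
    then show False using y by auto
  qed
  then obtain K where K: "FF K \<subseteq> G" by auto
  obtain I where I: "I \<subseteq> J" "finite I" "FF K \<subseteq> (\<Union>i\<in>I. ball (x i) (\<rho> i))"
    by (rule compactE_image[OF cFF[of K], of J "\<lambda>i. ball (x i) (\<rho> i)"]) (use K in \<open>auto simp: G_def\<close>)
  \<comment> \<open>Deeper than all levels in play, so that every box in \<open>cnt i\<close> can be
    replaced by its at most \<open>P ^ (K' - kk i)\<close> descendants at one common level.\<close>
  define K' where "K' = K + (\<Sum>i\<in>I. kk i)"
  have kK': "kk i \<le> K'" if "i \<in> I" for i
    unfolding K'_def using member_le_sum[OF that, of kk] I(2) by simp
  have "node K' \<subseteq> (\<Union>i\<in>I. \<Union>A\<in>cnt i. des (kk i) A (K' - kk i))"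
  proof
    fix B assume B: "B \<in> node K'"
    then have "B \<in> FF K'" unfolding FF_def using corner_in_wbox by auto
    then have "B \<in> FF K" using FFdec[of K "\<Sum>i\<in>I. kk i"] unfolding K'_def by auto
    then obtain i where i: "i \<in> I" "B \<in> ball (x i) (\<rho> i)" using I(3) by auto
    have "node K' = (\<Union>A\<in>node (kk i). des (kk i) A (K' - kk i))"
      using des_add[of 0 A0 "kk i" "K' - kk i"] kK'[OF i(1)] by simp
    then obtain A where A: "A \<in> node (kk i)" "B \<in> des (kk i) A (K' - kk i)" using B by auto
    have "B \<in> wbox w (lev (kk i)) A"
      using des_box[OF A(2)] corner_in_wbox by auto
    then have "A \<in> cnt i" unfolding cnt_def using A(1) i(2) by auto
    then show "B \<in> (\<Union>i\<in>I. \<Union>A\<in>cnt i. des (kk i) A (K' - kk i))" using i(1) A(2) by auto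
  qed
  then have "card (node K') \<le> card (\<Union>i\<in>I. \<Union>A\<in>cnt i. des (kk i) A (K' - kk i))"
    by (intro card_mono finite_UN_I I(2) fcnt finite_des)
  also have "\<dots> \<le> (\<Sum>i\<in>I. card (\<Union>A\<in>cnt i. des (kk i) A (K' - kk i)))" by (rule card_UN_le[OF I(2)])
  also have "\<dots> \<le> (\<Sum>i\<in>I. card (cnt i) * P ^ (K' - kk i))"
  proof (rule sum_mono)
    fix i
    have "card (\<Union>A\<in>cnt i. des (kk i) A (K' - kk i)) \<le> (\<Sum>A\<in>cnt i. card (des (kk i) A (K' - kk i)))"
      by (rule card_UN_le[OF fcnt])
    also have "\<dots> \<le> (\<Sum>A\<in>cnt i. P ^ (K' - kk i))" by (intro sum_mono card_des_le)
    finally show "card (\<Union>A\<in>cnt i. des (kk i) A (K' - kk i)) \<le> card (cnt i) * P ^ (K' - kk i)" by simp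
  qed
  finally have "P ^ K' \<le> (\<Sum>i\<in>I. card (cnt i) * P ^ (K' - kk i))" unfolding card_node .
  then have "real (P ^ K') \<le> (\<Sum>i\<in>I. real (card (cnt i)) * real P ^ (K' - kk i))"
    using of_nat_mono[where 'a = real] by fastforce
  also have "\<dots> = (\<Sum>i\<in>I. real (card (cnt i)) / P ^ kk i) * P ^ K'"
    unfolding sum_distrib_right
  proof (rule sum.cong[OF refl])
    fix i assume "i \<in> I"
    then have "real P ^ K' = real P ^ (K' - kk i) * real P ^ kk i" using kK'[of i] by (simp flip: power_add)
    then show "real (card (cnt i)) * real P ^ (K' - kk i) = real (card (cnt i)) / P ^ kk i * P ^ K'" using P by simp
  qed
  finally have "1 \<le> (\<Sum>i\<in>I. real (card (cnt i)) / P ^ kk i)" using P by simp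
  also have "\<dots> \<le> (\<Sum>i\<in>I. C * \<rho> i powr q)" by (intro sum_mono cnt)
  also have "\<dots> = C * ((\<Sum>i\<in>I. d i powr q) + (\<Sum>i\<in>I. \<eta> i))"
    by (simp only: \<rho>q sum.distrib flip: sum_distrib_left)
  also have "\<dots> \<le> C * (c + c)"
  proof (intro mult_left_mono add_mono)
    have dd: "ennreal (d i powr q) \<le> diam_pow s (U i)" if "i \<in> I" for i
    proof -
      have ne: "U i \<noteq> {}" using that I(1) unfolding J_def by auto
      have d1: "d i \<le> 1" using d(2)[of i] \<rho>0 by linarith
      show ?thesis
      proof (cases "s = 0")
        case True
        have "d i powr q \<le> 1" using d(1)[of i] d1 q by (simp add: powr_le1)
        then show ?thesis using True ne by (simp add: diam_pow_def)
      next
        case False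
        have "d i powr q \<le> d i powr s" using d(1)[of i] d1 q
          by (cases "d i = 0") (auto intro!: powr_mono')
        then show ?thesis using False ne by (simp add: diam_pow_def d_def ennreal_leI)
      qed
    qed
    have "ennreal (\<Sum>i\<in>I. d i powr q) = (\<Sum>i\<in>I. ennreal (d i powr q))" by simp
    also have "\<dots> \<le> (\<Sum>i\<in>I. diam_pow s (U i))" by (intro sum_mono dd)
    also have "\<dots> \<le> (\<Sum>i. diam_pow s (U i))" by (rule sum_le_suminf) (use I in auto)
    also have "\<dots> \<le> ennreal c" using U(2) by simp
    finally show "(\<Sum>i\<in>I. d i powr q) \<le> c" using c by (simp add: ennreal_le_iff)
    have sm: "\<eta> sums c" using sums_mult[OF power_half_series, of c] by (simp add: \<eta>_def[abs_def])
    have "(\<Sum>i\<in>I. \<eta> i) \<le> suminf \<eta>"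
      by (rule sum_le_suminf) (use sm I(2) \<eta>(1)[THEN less_imp_le] in \<open>auto simp: sums_iff\<close>)
    then show "(\<Sum>i\<in>I. \<eta> i) \<le> c" using sm by (simp add: sums_iff)
  qed (use C in auto)
  also have "\<dots> \<le> C * (1 / (4*C) + 1 / (4*C))" using c C by (intro mult_left_mono add_mono) auto
  also have "\<dots> < 1" using C by (simp add: field_simps)
  finally show False by simp
qed

end

section \<open>Volumes and integer vectors\<close>

text \<open>The library states the following only for well-ordered index types, which excludes \<open>'m + 'n\<close>.\<close>

lemma measure_matrix_image:
  fixes A :: "real^'n^'n"
  shows "S \<in> lmeasurable \<Longrightarrow>
    (*v) A ` S \<in> lmeasurable \<and> measure lebesgue ((*v) A ` S) = \<bar>det A\<bar> * measure lebesgue S"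
proof (induction A arbitrary: S rule: induct_matrix_elementary_alt)
  case (1 A B)
  have "(*v) (A ** B) ` S = (*v) A ` ((*v) B ` S)"
    by (simp add: image_image matrix_vector_mul_assoc)
  then show ?case using 1 by (simp add: det_mul abs_mult)
next
  case (2 A i)
  have d: "det A = 0" using 2(1) by (rule det_zero_row)
  have "(*v) A ` S \<subseteq> {y. y $ i = 0}"
    using 2(1) by (auto simp: matrix_vector_mult_def row_def vec_eq_iff)
  then have "negligible ((*v) A ` S)"
    using negligible_standard_hyperplane_cart negligible_subset by blast
  then show ?case using d by (simp add: negligible_iff_measure)
next
  case (3 A)
  have "(*v) A = (\<lambda>x. \<chi> k. A$k$k * x$k)"
  proof (intro ext iffD2[OF vec_eq_iff] allI)
    fix x k
    have "(\<Sum>j\<in>UNIV. A$k$j * x$j) = (\<Sum>j\<in>UNIV. if j = k then A$k$k * x$k else 0)"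
      by (rule sum.cong) (use 3(1) in auto)
    then show "(A *v x) $ k = (\<chi> k. A$k$k * x$k) $ k" by (simp add: matrix_vector_mult_def)
  qed
  moreover have "det A = prod (\<lambda>k. A$k$k) UNIV" using 3(1) by (rule det_diagonal)
  ultimately show ?case using measurable_stretch[OF 3(2)] measure_stretch[OF 3(2)] by simp
next
  case (4 m n)
  define \<tau> where "\<tau> = Transposition.transpose m n"
  define A :: "real^'n^'n" where "A = (\<chi> i j. mat 1 $ i $ \<tau> j)"
  have inv: "\<tau> (\<tau> i) = i" for i by (simp add: \<tau>_def)
  have "\<tau> permutes UNIV" unfolding \<tau>_def by (rule permutes_swap_id) auto
  have Av: "(A *v x) $ i = x $ \<tau> i" for x i
  proof -
    have "(A *v x) $ i = (\<Sum>j\<in>UNIV. (if i = \<tau> j then 1 else 0) * x$j)"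
      by (simp add: A_def matrix_vector_mult_def mat_def)
    also have "\<dots> = (\<Sum>j\<in>UNIV. if j = \<tau> i then x$j else 0)"
      by (rule sum.cong) (use inv in auto)
    finally show ?thesis by simp
  qed
  have detA: "\<bar>det A\<bar> = 1" unfolding A_def
    using det_permute_columns[OF \<open>\<tau> permutes UNIV\<close>, of "mat 1 :: real^'n^'n"]
    by (cases \<tau> rule: sign_cases) auto
  have img: "(*v) A ` cbox a b = cbox (A *v a) (A *v b)" for a b
  proof
    show "(*v) A ` cbox a b \<subseteq> cbox (A *v a) (A *v b)" by (auto simp: mem_box_cart Av)
    show "cbox (A *v a) (A *v b) \<subseteq> (*v) A ` cbox a b"
    proof
      fix y assume y: "y \<in> cbox (A *v a) (A *v b)"
      have "A *v (A *v y) = y" by (simp add: vec_eq_iff Av inv)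
      moreover have "A *v y \<in> cbox a b"
      proof -
        have "a $ i \<le> y $ \<tau> i \<and> y $ \<tau> i \<le> b $ i" for i
          using y inv unfolding mem_box_cart Av by metis
        then show ?thesis by (simp add: mem_box_cart Av)
      qed
      ultimately show "y \<in> (*v) A ` cbox a b" by (metis image_eqI)
    qed
  qed
  have "measure lebesgue ((*v) A ` cbox a b) = 1 * measure lebesgue (cbox a b)" for a b
  proof (cases "cbox a b = {}")
    case False
    then have "cbox (A *v a) (A *v b) \<noteq> {}" using img by blast
    then show ?thesis using False prod.permute[OF \<open>\<tau> permutes UNIV\<close>, of "\<lambda>i. b$i - a$i"]
      by (simp add: img content_cbox_cart Av comp_def)
  qed simp
  from measure_linear_sufficient[OF matrix_vector_mul_linear 4(2) this]
  show ?case using detA unfolding A_def \<tau>_def by simp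
next
  case (5 m n)
  define A :: "real^'n^'n" where "A = (\<chi> i j. of_bool (i = m \<and> j = n \<or> i = j))"
  have Av: "(*v) A = (\<lambda>x. \<chi> i. if i = m then x$m + x$n else x$i)"
  proof (intro ext iffD2[OF vec_eq_iff] allI)
    fix x i
    have "(A *v x) $ i = (\<Sum>j\<in>UNIV. (if j = i then x$j else 0) + (if j = n then if i = m then x$n else 0 else 0))"
      unfolding A_def matrix_vector_mult_def using 5(1) by (auto intro!: sum.cong)
    also have "\<dots> = (\<chi> i. if i = m then x$m + x$n else x$i) $ i" by (simp add: sum.distrib)
    finally show "(A *v x) $ i = (\<chi> i. if i = m then x$m + x$n else x$i) $ i" .
  qed
  have "A = (\<chi> k. if k = m then row m (mat 1) + 1 *s row n (mat 1) else row k (mat 1))"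
    using 5(1) by (auto simp: A_def vec_eq_iff row_def mat_def)
  then have detA: "det A = 1" using det_row_operation[OF 5(1), of "mat 1" 1] by simp
  have "measure lebesgue ((*v) A ` cbox a b) = 1 * measure lebesgue (cbox a b)" for a b
  proof (cases "cbox a b = {}")
    case False
    \<comment> \<open>Translation to the corner 0 puts the box into the position that
      \<open>measure_shear_interval\<close> asks for and preserves the volume.\<close>
    have cb: "cbox a b = (+) a ` cbox 0 (b - a)" using cbox_translation[of a 0 "b - a"] by simp
    have "(*v) A ` cbox a b = (+) (A *v a) ` (*v) A ` cbox 0 (b - a)"
      unfolding cb by (simp add: image_image matrix_vector_right_distrib)
    then have "measure lebesgue ((*v) A ` cbox a b) = measure lebesgue ((*v) A ` cbox 0 (b - a))"
      by (simp add: measure_translation)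
    also have "\<dots> = measure lebesgue (cbox 0 (b - a))"
      unfolding Av by (rule measure_shear_interval[OF 5(1)]) (use False cb in auto)
    also have "\<dots> = measure lebesgue (cbox a b)"
      unfolding cb by (rule measure_translation[symmetric])
    finally show ?thesis by simp
  qed simp
  from measure_linear_sufficient[OF matrix_vector_mul_linear 5(2) this]
  show ?case using detA unfolding A_def by simp
qed

section \<open>Integer vectors and the packing bound for unimodular lattices\<close>

lemma int_vectors_0 [simp]: "0 \<in> int_vectors" by (simp add: int_vectors_def)
lemma int_vectors_add: "x \<in> int_vectors \<Longrightarrow> y \<in> int_vectors \<Longrightarrow> x + y \<in> int_vectors"
  by (simp add: int_vectors_def)
lemma int_vectors_diff: "x \<in> int_vectors \<Longrightarrow> y \<in> int_vectors \<Longrightarrow> x - y \<in> int_vectors"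
  by (simp add: int_vectors_def)
lemma int_vectors_axis: "axis i 1 \<in> int_vectors"
  by (auto simp: int_vectors_def axis_def)

lemma countable_int_vectors: "countable (int_vectors :: (real^'d) set)"
proof -
  have "countable (PiE UNIV (\<lambda>_. UNIV) :: ('d \<Rightarrow> int) set)" by (rule countable_PiE) auto
  moreover have "int_vectors = (\<lambda>f. \<chi> i. of_int (f i)) ` (PiE UNIV (\<lambda>_. UNIV) :: ('d \<Rightarrow> int) set)"
  proof (intro equalityI subsetI)
    fix x :: "real^'d" assume "x \<in> int_vectors"
    then have "\<forall>i. x $ i = of_int \<lfloor>x $ i\<rfloor>" by (auto simp: int_vectors_def)
    then have "x = (\<chi> i. of_int ((\<lambda>i. \<lfloor>x $ i\<rfloor>) i))" by (simp add: vec_eq_iff)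
    then show "x \<in> (\<lambda>f. \<chi> i. of_int (f i)) ` (PiE UNIV (\<lambda>_. UNIV) :: ('d \<Rightarrow> int) set)"
      by (intro image_eqI[of _ _ "\<lambda>i. \<lfloor>x $ i\<rfloor>"]) auto
  qed (auto simp: int_vectors_def)
  ultimately show ?thesis by (metis countable_image)
qed

lemma finite_int_vectors_norm_le: "finite {z \<in> int_vectors. norm (z::real^'d) \<le> R}"
proof -
  define K where "K = \<lceil>R\<rceil>"
  have "finite (PiE UNIV (\<lambda>_. {-K..K}) :: ('d \<Rightarrow> int) set)" by (rule finite_PiE) auto
  moreover have "{z \<in> int_vectors. norm z \<le> R} \<subseteq> (\<lambda>f. \<chi> i. of_int (f i)) ` (PiE UNIV (\<lambda>_. {-K..K}) :: ('d \<Rightarrow> int) set)"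
  proof safe
    fix x :: "real^'d" assume x: "x \<in> int_vectors" "norm x \<le> R"
    then have "\<forall>i. x $ i = of_int \<lfloor>x $ i\<rfloor>" by (auto simp: int_vectors_def)
    then have "x = (\<chi> i. of_int ((\<lambda>i. \<lfloor>x $ i\<rfloor>) i))" by (simp add: vec_eq_iff)
    moreover have "\<lfloor>x $ i\<rfloor> \<in> {-K..K}" for i
    proof -
      have "\<bar>x $ i\<bar> \<le> R" using component_le_norm_cart[of x i] x(2) by linarith
      then have "x $ i \<le> of_int K" "- of_int K \<le> x $ i" unfolding K_def by linarith+
      then show ?thesis by (auto simp: le_floor_iff floor_le_iff)
    qed
    ultimately show "x \<in> (\<lambda>f. \<chi> i. of_int (f i)) ` (PiE UNIV (\<lambda>_. {-K..K}))"
      by (intro image_eqI[of _ _ "\<lambda>i. \<lfloor>x $ i\<rfloor>"]) auto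
  qed
  ultimately show ?thesis using finite_subset by blast
qed

text \<open>Blichfeldt's principle: cut \<open>S\<close> along the integer translates of the
  half-open unit cube \<open>Q\<close> and move all pieces into \<open>Q\<close>. The moved pieces
  are disjoint, since two points of \<open>S\<close> that land together differ by an integer
  vector.\<close>

lemma measure_le_1_of_disjoint_translates:
  fixes S :: "(real^'d) set"
  assumes S: "S \<in> sets borel" and inj: "\<And>x y. x \<in> S \<Longrightarrow> y \<in> S \<Longrightarrow> x - y \<in> int_vectors \<Longrightarrow> x = y"
  shows "emeasure lborel S \<le> 1"
proof -
  define Q where "Q = {x::real^'d. \<forall>i. 0 \<le> x $ i \<and> x $ i < 1}"
  have Qb: "Q \<in> sets borel"
  proof -
    have "Q = (\<Inter>i. {x. 0 \<le> x $ i} \<inter> {x. x $ i < 1})" unfolding Q_def by auto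
    moreover have "{x::real^'d. 0 \<le> x $ i} \<inter> {x. x $ i < 1} \<in> sets borel" for i
      by (intro sets.Int borel_closed borel_open closed_Collect_le open_Collect_less continuous_intros)
    ultimately show ?thesis by auto
  qed
  define Z where "Z = (int_vectors :: (real^'d) set)"
  have cZ: "countable Z" unfolding Z_def by (rule countable_int_vectors)
  define fl :: "real^'d \<Rightarrow> real^'d" where "fl x = (\<chi> i. of_int \<lfloor>x $ i\<rfloor>)" for x
  have fl: "fl x \<in> Z" "x - fl x \<in> Q" for x
    by (auto simp: fl_def Z_def Q_def int_vectors_def) linarith
  have Quniq: "z = z'" if "x - z \<in> Q" "x - z' \<in> Q" "z \<in> Z" "z' \<in> Z" for x z z'
  proof (rule iffD2[OF vec_eq_iff], rule allI)
    fix i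
    have "z $ i \<in> \<int>" "z' $ i \<in> \<int>" using that by (auto simp: Z_def int_vectors_def)
    then obtain a b where ab: "z $ i = of_int a" "z' $ i = of_int b" by (auto elim!: Ints_cases)
    have "0 \<le> x$i - z$i" "x$i - z$i < 1" "0 \<le> x$i - z'$i" "x$i - z'$i < 1" using that by (auto simp: Q_def)
    then have "a = b" unfolding ab by linarith
    then show "z $ i = z' $ i" unfolding ab by simp
  qed
  define X where "X z = S \<inter> {x. x - z \<in> Q}" for z
  define Y where "Y z = {x. x + z \<in> S} \<inter> Q" for z
  have tr: "(\<lambda>x::real^'d. x + z) \<in> borel \<rightarrow>\<^sub>M borel" "(\<lambda>x::real^'d. x - z) \<in> borel \<rightarrow>\<^sub>M borel" for z by auto
  have pre: "{x. x + z \<in> S} \<in> sets borel" "{x. x - z \<in> Q} \<in> sets borel" for z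
    using measurable_sets[OF tr(1) S, of z] measurable_sets[OF tr(2) Qb, of z] by (auto simp: vimage_def)
  have Xb: "X z \<in> sets borel" and Yb: "Y z \<in> sets borel" for z
    unfolding X_def Y_def using S Qb pre by auto
  have XY: "emeasure lborel (X z) = emeasure lborel (Y z)" for z
  proof -
    have "emeasure lborel (X z) = emeasure (distr lborel borel ((+) z)) (X z)" by (simp add: lborel_distr_plus)
    also have "\<dots> = emeasure lborel ((+) z -` X z \<inter> space lborel)"
      by (rule emeasure_distr) (use Xb in auto)
    also have "(+) z -` X z \<inter> space lborel = Y z" by (auto simp: X_def Y_def add.commute)
    finally show ?thesis .
  qed
  have SU: "S = (\<Union>z\<in>Z. X z)" unfolding X_def using fl by blast
  have "emeasure lborel S = (\<integral>\<^sup>+z. emeasure lborel (X z) \<partial>count_space Z)"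
    by (subst SU, rule emeasure_UN_countable)
       (use Xb cZ Quniq in \<open>auto simp: disjoint_family_on_def X_def\<close>)
  also have "\<dots> = (\<integral>\<^sup>+z. emeasure lborel (Y z) \<partial>count_space Z)" unfolding XY ..
  also have "\<dots> = emeasure lborel (\<Union>z\<in>Z. Y z)"
  proof (rule emeasure_UN_countable[symmetric])
    show "disjoint_family_on Y Z" unfolding disjoint_family_on_def
    proof (intro ballI impI)
      fix z z' assume z: "z \<in> Z" "z' \<in> Z" "z \<noteq> z'"
      show "Y z \<inter> Y z' = {}"
      proof (rule equals0I)
        fix x assume "x \<in> Y z \<inter> Y z'"
        then have "x + z = x + z'" using z(1,2)
          by (intro inj) (auto simp: Y_def Z_def intro: int_vectors_diff)
        then show False using z(3) by simp
      qed
    qed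
  qed (use Yb cZ in auto)
  also have "\<dots> \<le> emeasure lborel (cbox 0 (1::real^'d))"
    by (rule emeasure_mono) (auto simp: Y_def Q_def mem_box_cart less_imp_le)
  also have "\<dots> = 1"
  proof -
    have "(1::real^'d) \<bullet> b = 1" if "b \<in> Basis" for b
      using that by (auto simp: Basis_vec_def inner_axis)
    then show ?thesis by (subst emeasure_lborel_cbox) auto
  qed
  finally show ?thesis .
qed

text \<open>The map \<open>y\<close> preserves volume and carries the integer vectors to the
  lattice, so the bound for integer translates holds for every unimodular lattice.\<close>

lemma measure_le_1_of_lattice_separated:
  fixes y :: "real^'d^'d"
  assumes det: "\<bar>det y\<bar> = 1" and S: "open S" "bounded S"
    and inj: "\<And>a b z. a \<in> S \<Longrightarrow> b \<in> S \<Longrightarrow> z \<in> int_vectors \<Longrightarrow> a - b = y *v z \<Longrightarrow> z = 0"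
  shows "measure lebesgue S \<le> 1"
proof -
  have "invertible y" using det by (auto simp: invertible_det_nz)
  then obtain y' where y': "y ** y' = mat 1" "y' ** y = mat 1" unfolding invertible_def by blast
  have yy: "y *v (y' *v x) = x" "y' *v (y *v x) = x" for x by (auto simp: matrix_vector_mul_assoc y')
  define S' where "S' = (*v) y -` S"
  have S'img: "(*v) y ` S' = S" unfolding S'_def using yy by (auto simp: image_iff) metis
  have "open S'" unfolding S'_def
    by (rule open_vimage[OF S(1)]) (simp add: matrix_vector_mult_linear_continuous_on)
  have "S' = (*v) y' ` S" unfolding S'_def using yy by (auto simp: image_iff) metis
  then have "bounded S'" using bounded_linear_image[OF S(2) matrix_vector_mul_bounded_linear] by simp
  then have S'l: "S' \<in> lmeasurable" using \<open>open S'\<close> by (rule lmeasurable_open)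
  have "emeasure lborel S' \<le> 1"
  proof (rule measure_le_1_of_disjoint_translates)
    show "S' \<in> sets borel" using \<open>open S'\<close> by simp
    fix a b assume ab: "a \<in> S'" "b \<in> S'" "a - b \<in> int_vectors"
    then have "a - b = 0" by (intro inj[of "y *v a" "y *v b"]) (auto simp: S'_def matrix_vector_mult_diff_distrib)
    then show "a = b" by simp
  qed
  then have "measure lborel S' \<le> 1" unfolding measure_def by (simp add: enn2real_leI)
  moreover have "measure lebesgue S' = measure lborel S'" using \<open>open S'\<close> by (simp add: measure_completion)
  moreover have "measure lebesgue S = measure lebesgue S'"
    using measure_matrix_image[OF S'l, of y] det S'img by simp
  ultimately show ?thesis by simp
qed

section \<open>Admissible radii\<close>

text \<open>Stated for a basis matrix instead of a lattice, so that limits can be taken among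
  matrices; \<open>adm_unim\<close> shows that the choice of the basis does not matter.\<close>

definition adm :: "(real^'d \<Rightarrow> real) \<Rightarrow> real^'d^'d \<Rightarrow> real \<Rightarrow> bool" where
  "adm \<nu> y \<rho> \<longleftrightarrow> (\<forall>z\<in>int_vectors. z \<noteq> 0 \<longrightarrow> \<rho> \<le> \<nu> (y *v z))"

section \<open>Norms on Euclidean spaces\<close>

lemma is_norm_norm: "is_norm norm"
  unfolding is_norm_def by (auto intro: norm_triangle_ineq)

lemma is_normD:
  assumes "is_norm \<nu>"
  shows "0 \<le> \<nu> x" "\<nu> x = 0 \<longleftrightarrow> x = 0" "\<nu> (c *\<^sub>R x) = \<bar>c\<bar> * \<nu> x" "\<nu> (x + y) \<le> \<nu> x + \<nu> y"
  using assms unfolding is_norm_def by auto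

lemma is_norm_minus: "is_norm \<nu> \<Longrightarrow> \<nu> (- x) = \<nu> x"
  using is_normD(3)[of \<nu> "-1" x] by simp

lemma is_norm_zero: "is_norm \<nu> \<Longrightarrow> \<nu> 0 = 0"
  using is_normD(2)[of \<nu> 0] by simp

lemma is_norm_diff: "is_norm \<nu> \<Longrightarrow> \<nu> x \<le> \<nu> y + \<nu> (x - y)"
  using is_normD(4)[of \<nu> y "x - y"] by simp

lemma is_norm_sum:
  assumes "is_norm \<nu>" "finite I"
  shows "\<nu> (sum f I) \<le> (\<Sum>i\<in>I. \<nu> (f i))"
  using assms(2)
proof (induction I rule: finite_induct)
  case (insert i I)
  then show ?case using is_normD(4)[OF assms(1), of "f i" "sum f I"] by simp
qed (simp add: is_norm_zero[OF assms(1)])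

lemma is_norm_upper:
  fixes \<nu> :: "'a::euclidean_space \<Rightarrow> real"
  assumes "is_norm \<nu>"
  obtains C where "C > 0" "\<And>x. \<nu> x \<le> C * norm x"
proof -
  define C where "C = (\<Sum>b\<in>Basis. \<nu> (b::'a)) + 1"
  have C: "C > 0" unfolding C_def using is_normD(1)[OF assms] by (simp add: sum_nonneg add_nonneg_pos)
  have "\<nu> x \<le> C * norm x" for x
  proof -
    have "\<nu> x = \<nu> (\<Sum>b\<in>Basis. (x \<bullet> b) *\<^sub>R b)" by (simp add: euclidean_representation)
    also have "\<dots> \<le> (\<Sum>b\<in>Basis. \<nu> ((x \<bullet> b) *\<^sub>R b))" by (rule is_norm_sum[OF assms]) auto
    also have "\<dots> \<le> (\<Sum>b\<in>Basis. norm x * \<nu> b)"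
      by (intro sum_mono) (auto simp: is_normD(3)[OF assms] intro!: mult_right_mono Basis_le_norm is_normD(1)[OF assms])
    also have "\<dots> = (C - 1) * norm x" by (simp add: C_def sum_distrib_left[symmetric] mult.commute)
    also have "\<dots> \<le> C * norm x" by (intro mult_right_mono) auto
    finally show ?thesis .
  qed
  with C show ?thesis by (rule that)
qed

lemma is_norm_continuous:
  fixes \<nu> :: "'a::euclidean_space \<Rightarrow> real"
  assumes "is_norm \<nu>"
  shows "continuous_on S \<nu>"
proof -
  obtain C where C: "C > 0" "\<And>x. \<nu> x \<le> C * norm x" using is_norm_upper[OF assms] by blast
  have "dist (\<nu> x) (\<nu> y) \<le> C * dist x y" for x y
  proof -
    have "\<nu> x - \<nu> y \<le> \<nu> (x - y)" "\<nu> y - \<nu> x \<le> \<nu> (x - y)"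
      using is_norm_diff[OF assms, of x y] is_norm_diff[OF assms, of y x] is_norm_minus[OF assms, of "x - y"] by auto
    then show ?thesis using C(2)[of "x - y"] by (simp add: dist_real_def dist_norm abs_le_iff)
  qed
  then have "C-lipschitz_on S \<nu>" using C(1) by (intro lipschitz_onI) auto
  then show ?thesis by (rule lipschitz_on_continuous_on)
qed

lemma is_norm_lower:
  fixes \<nu> :: "'a::euclidean_space \<Rightarrow> real"
  assumes "is_norm \<nu>"
  obtains c where "c > 0" "\<And>x. c * norm x \<le> \<nu> x"
proof -
  have "compact (sphere (0::'a) 1)" by simp
  moreover have "sphere (0::'a) 1 \<noteq> {}" by simp
  ultimately obtain u where u: "u \<in> sphere 0 1" "\<And>x. x \<in> sphere 0 1 \<Longrightarrow> \<nu> u \<le> \<nu> x"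
    using continuous_attains_inf[OF _ _ is_norm_continuous[OF assms]] by metis
  have "u \<noteq> 0" using u(1) by auto
  then have p: "\<nu> u > 0" using is_normD(1,2)[OF assms, of u] by linarith
  have "\<nu> u * norm x \<le> \<nu> x" for x
  proof (cases "x = 0")
    case False
    then have "\<nu> u \<le> \<nu> ((1 / norm x) *\<^sub>R x)" by (intro u(2)) auto
    also have "\<dots> = \<nu> x / norm x" by (simp add: is_normD(3)[OF assms])
    finally show ?thesis using False by (simp add: field_simps)
  qed (simp add: is_norm_zero[OF assms])
  with p show ?thesis by (rule that)
qed

text \<open>Minkowski: balls of half the admissible radius are disjoint modulo the lattice, so their
  volume is at most 1. It makes the set in \<open>critical_radius\<close> bounded above.\<close>

lemma adm_radius_bounded:
  fixes \<nu> :: "real^'d \<Rightarrow> real"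
  assumes "is_norm \<nu>"
  obtains R where "\<And>y \<rho>. \<bar>det y\<bar> = 1 \<Longrightarrow> adm \<nu> y \<rho> \<Longrightarrow> \<rho> \<le> R"
proof -
  obtain C where C: "C > 0" "\<And>x. \<nu> x \<le> C * norm x" using is_norm_upper[OF assms] by blast
  define V where "V = unit_ball_vol (real DIM(real^'d))"
  have V: "V > 0" unfolding V_def by simp
  have "\<rho> \<le> 2 * C * max 1 (1 / V)" if y: "\<bar>det y\<bar> = 1" "adm \<nu> y \<rho>" for y \<rho>
  proof (cases "\<rho> > 0")
    case True
    define r where "r = \<rho> / (2 * C)"
    have r: "r > 0" using True C by (simp add: r_def)
    have "measure lebesgue (ball (0::real^'d) r) \<le> 1"
    proof (rule measure_le_1_of_lattice_separated[OF y(1)])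
      fix a b z :: "real^'d" assume ab: "a \<in> ball 0 r" "b \<in> ball 0 r" "z \<in> int_vectors" "a - b = y *v z"
      have "norm (a - b) < 2 * r" using ab(1,2) norm_triangle_ineq4[of a b] by simp
      have "\<nu> (y *v z) \<le> C * norm (a - b)" using C(2)[of "a - b"] ab(4) by simp
      also have "\<dots> < C * (2 * r)" by (rule mult_strict_left_mono) fact+
      also have "\<dots> = \<rho>" using C by (simp add: r_def)
      finally show "z = 0" using y(2) ab(3) unfolding adm_def by fastforce
    qed auto
    moreover have "measure lebesgue (ball (0::real^'d) r) = V * r ^ DIM(real^'d)"
      using r by (simp add: measure_completion content_ball V_def)
    ultimately have Vr: "V * r ^ DIM(real^'d) \<le> 1" by simp
    have "r \<le> max 1 (1 / V)"
    proof (cases "r \<le> 1")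
      case False
      then have "r \<le> r ^ DIM(real^'d)" by (intro self_le_power) auto
      also have "\<dots> \<le> 1 / V" using Vr V by (simp add: field_simps)
      finally show ?thesis by simp
    qed simp
    then show ?thesis using C by (simp add: r_def field_simps)
  next
    case False
    have "0 \<le> 2 * C * max 1 (1 / V)" using C by (simp add: le_max_iff_disj)
    then show ?thesis using False by linarith
  qed
  then show ?thesis by (rule that)
qed

lemma lattice_ball_iff_adm:
  assumes "is_norm \<nu>" "\<rho> > 0" "\<bar>det y\<bar> = 1"
  shows "(\<lambda>x. y *v x) ` int_vectors \<inter> norm_ball \<nu> \<rho> = {0} \<longleftrightarrow> adm \<nu> y \<rho>"
proof -
  have "invertible y" using assms(3) by (auto simp: invertible_det_nz)
  then have y0: "y *v z = 0 \<longleftrightarrow> z = 0" for z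
    by (metis invertible_def matrix_left_invertible_ker matrix_vector_mult_0_right)
  have z: "0 \<in> (\<lambda>x. y *v x) ` int_vectors \<inter> norm_ball \<nu> \<rho>"
    using assms(1,2) by (auto simp: norm_ball_def is_norm_zero image_iff intro!: bexI[of _ 0])
  show ?thesis
  proof
    assume L: "(\<lambda>x. y *v x) ` int_vectors \<inter> norm_ball \<nu> \<rho> = {0}"
    show "adm \<nu> y \<rho>" unfolding adm_def
    proof (intro ballI impI)
      fix z assume z: "z \<in> int_vectors" "z \<noteq> (0::real^'a)"
      show "\<rho> \<le> \<nu> (y *v z)"
      proof (rule ccontr)
        assume "\<not> \<rho> \<le> \<nu> (y *v z)"
        then have "y *v z \<in> (\<lambda>x. y *v x) ` int_vectors \<inter> norm_ball \<nu> \<rho>" using z by (auto simp: norm_ball_def)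
        then show False using L y0 z by auto
      qed
    qed
  next
    assume A: "adm \<nu> y \<rho>"
    have "x = 0" if "x \<in> (\<lambda>x. y *v x) ` int_vectors \<inter> norm_ball \<nu> \<rho>" for x
      using that A unfolding adm_def norm_ball_def by (force simp: not_less[symmetric])
    then show "(\<lambda>x. y *v x) ` int_vectors \<inter> norm_ball \<nu> \<rho> = {0}" using z by blast
  qed
qed

lemma adm_le_critical_radius:
  fixes \<nu> :: "real^'d \<Rightarrow> real"
  assumes "is_norm \<nu>" "\<bar>det y\<bar> = 1" "adm \<nu> y \<rho>" "\<rho> > 0"
  shows "\<rho> \<le> critical_radius \<nu>"
proof -
  obtain R where R: "\<And>y \<rho>. \<bar>det y\<bar> = 1 \<Longrightarrow> adm \<nu> y \<rho> \<Longrightarrow> \<rho> \<le> R" using adm_radius_bounded[OF assms(1)] by blast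
  show ?thesis unfolding critical_radius_def
  proof (rule cSup_upper)
    show "\<rho> \<in> {r. \<exists>\<Lambda>\<in>unimodular_lattices. \<Lambda> \<inter> norm_ball \<nu> r = {0}}"
      using lattice_ball_iff_adm[OF assms(1,4,2)] assms unfolding unimodular_lattices_def by blast
    show "bdd_above {r. \<exists>\<Lambda>\<in>unimodular_lattices. \<Lambda> \<inter> norm_ball \<nu> r = {0}}"
    proof (rule bdd_aboveI[of _ "max R 0"])
      fix r assume "r \<in> {r. \<exists>\<Lambda>\<in>unimodular_lattices. \<Lambda> \<inter> norm_ball \<nu> r = {0}}"
      then obtain g :: "real^'d^'d" where g: "\<bar>det g\<bar> = 1" "(\<lambda>v. g *v v) ` int_vectors \<inter> norm_ball \<nu> r = {0}"
        unfolding unimodular_lattices_def by blast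
      show "r \<le> max R 0"
      proof (cases "r > 0")
        case True
        then show ?thesis using lattice_ball_iff_adm[OF assms(1) True g(1)] g R[of g r] by auto
      qed auto
    qed
  qed
qed

lemma critical_radius_pos:
  fixes \<nu> :: "real^'d \<Rightarrow> real"
  assumes "is_norm \<nu>"
  shows "critical_radius \<nu> > 0"
proof -
  obtain c where c: "c > 0" "\<And>x. c * norm x \<le> \<nu> x" using is_norm_lower[OF assms] by blast
  have "adm \<nu> (mat 1) c" unfolding adm_def
  proof (intro ballI impI)
    fix z assume z: "z \<in> int_vectors" "z \<noteq> (0::real^'d)"
    then obtain i where i: "z $ i \<noteq> 0" by (auto simp: vec_eq_iff)
    have "z $ i \<in> \<int>" using z by (auto simp: int_vectors_def)
    then have "1 \<le> \<bar>z $ i\<bar>" using i by (auto elim!: Ints_cases)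
    also have "\<dots> \<le> norm z" by (rule component_le_norm_cart)
    finally have "c * 1 \<le> c * norm z" using c by (intro mult_left_mono) auto
    then show "c \<le> \<nu> (mat 1 *v z)" using c(2)[of z] by simp
  qed
  then have "c \<le> critical_radius \<nu>" by (intro adm_le_critical_radius[OF assms, of "mat 1"]) (use c in auto)
  then show ?thesis using c by simp
qed

text \<open>If the lattice vectors of length at most \<open>R\<close> lay in a hyperplane,
  \<open>K\<close> balls in a row along its normal would be disjoint modulo the lattice: short
  lattice vectors are orthogonal to the row and bring no two centres closer, and long ones exceed
  the row. The total volume \<open>K * V > 1\<close> contradicts unimodularity.\<close>

lemma short_vectors_span:
  fixes \<rho> :: real
  assumes \<rho>: "\<rho> > 0"
  obtains R where "R > 0" "\<And>y::real^'d^'d. \<bar>det y\<bar> = 1 \<Longrightarrow> adm norm y \<rho> \<Longrightarrow>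
     span {y *v z |z. z \<in> int_vectors \<and> norm (y *v z) \<le> R} = UNIV"
proof -
  define V where "V = measure lebesgue (ball (0::real^'d) (\<rho>/2))"
  have V: "V > 0" unfolding V_def using \<rho> by (simp add: measure_completion)
  obtain K :: nat where K: "1 / V < real K" using reals_Archimedean2 by blast
  have KV: "real K * V > 1" using K V by (simp add: field_simps)
  \<comment> \<open>A lattice vector longer than \<open>R\<close> is still at least
    \<open>\<rho>\<close> long after subtracting a difference of two centres, which is at most
    \<open>K * \<rho>\<close>.\<close>
  define R where "R = (real K + 1) * \<rho>"
  have R: "R > 0" using \<rho> by (simp add: R_def)
  have "span {y *v z |z. z \<in> int_vectors \<and> norm (y *v z) \<le> R} = UNIV"
    if y: "\<bar>det y\<bar> = 1" "adm norm y \<rho>" for y :: "real^'d^'d"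
  proof (rule ccontr)
    define L where "L = {y *v z |z. z \<in> int_vectors \<and> norm (y *v z) \<le> R}"
    assume "span {y *v z |z. z \<in> int_vectors \<and> norm (y *v z) \<le> R} \<noteq> UNIV"
    then obtain a where a: "a \<noteq> 0" "span L \<subseteq> {x. a \<bullet> x = 0}"
      using span_not_univ_subset_hyperplane unfolding L_def by blast
    define w where "w = (\<rho> / norm a) *\<^sub>R a"
    have w: "norm w = \<rho>" using a \<rho> by (simp add: w_def)
    have wL: "w \<bullet> x = 0" if "x \<in> L" for x using a that span_base[of x L] by (auto simp: w_def)
    define p where "p i = real i *\<^sub>R w" for i :: nat
    have sep: "\<rho> \<le> norm (p i - p j - y *v z)" if ij: "i < K" "j < K" and z: "z \<in> int_vectors" "i = j \<longrightarrow> z \<noteq> 0" for i j z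
    proof (cases "i = j")
      case True
      then show ?thesis using z y(2) unfolding adm_def by (auto simp: p_def)
    next
      case False
      have pij: "p i - p j = (real i - real j) *\<^sub>R w" by (simp add: p_def scaleR_left_diff_distrib)
      have npij: "norm (p i - p j) = \<bar>real i - real j\<bar> * \<rho>" by (simp add: pij w)
      show ?thesis
      proof (cases "norm (y *v z) \<le> R")
        case True
        then have "y *v z \<in> L" using z(1) unfolding L_def by blast
        then have "orthogonal (p i - p j) (y *v z)" using wL by (simp add: pij orthogonal_def)
        then have "(norm (p i - p j - y *v z))\<^sup>2 = (norm (p i - p j))\<^sup>2 + (norm (y *v z))\<^sup>2"
          using norm_add_Pythagorean[of "p i - p j" "- (y *v z)"] by (simp add: orthogonal_def)
        then have "norm (p i - p j) \<le> norm (p i - p j - y *v z)"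
          by (auto intro: power2_le_imp_le)
        moreover have "\<bar>real i - real j\<bar> \<ge> 1" using False by linarith
        then have "1 * \<rho> \<le> \<bar>real i - real j\<bar> * \<rho>" by (rule mult_right_mono) (use \<rho> in auto)
        ultimately show ?thesis using npij by simp
      next
        case False
        have "norm (y *v z) \<le> norm (p i - p j) + norm (p i - p j - y *v z)"
          using norm_triangle_ineq4[of "p i - p j" "p i - p j - y *v z"] by simp
        moreover have "\<bar>real i - real j\<bar> \<le> real K" using ij by linarith
        then have "\<bar>real i - real j\<bar> * \<rho> \<le> real K * \<rho>" by (rule mult_right_mono) (use \<rho> in auto)
        ultimately show ?thesis using False npij unfolding R_def by (simp add: distrib_right)
      qed
    qed
    define S where "S = (\<Union>i<K. ball (p i) (\<rho>/2))"
    have near: "i = j \<and> z = 0" if "i < K" "j < K" "z \<in> int_vectors" "u \<in> ball (p i) (\<rho>/2)" "v \<in> ball (p j) (\<rho>/2)" "u - v = y *v z" for i j z u v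
    proof (rule ccontr)
      assume "\<not> (i = j \<and> z = 0)"
      then have "\<rho> \<le> norm (p i - p j - y *v z)" using sep[of i j z] that by auto
      also have "p i - p j - y *v z = (p i - u) - (p j - v)" unfolding that(6)[symmetric] by simp
      also have "norm \<dots> \<le> norm (p i - u) + norm (p j - v)" by (rule norm_triangle_ineq4)
      also have "\<dots> < \<rho>" using that(4,5) by (simp add: dist_norm)
      finally show False by simp
    qed
    have "measure lebesgue S \<le> 1"
    proof (rule measure_le_1_of_lattice_separated[OF y(1)])
      show "open S" "bounded S" unfolding S_def by auto
      fix u v z assume "u \<in> S" "v \<in> S" "z \<in> int_vectors" "u - v = y *v z"
      then show "z = 0" using near unfolding S_def by blast
    qed
    moreover have "measure lebesgue S = (\<Sum>i<K. measure lebesgue (ball (p i) (\<rho>/2)))"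
      unfolding S_def
    proof (rule measure_finite_Union)
      show "disjoint_family_on (\<lambda>i. ball (p i) (\<rho>/2)) {..<K}" unfolding disjoint_family_on_def
      proof (intro ballI impI equals0I)
        fix i j x assume "i \<in> {..<K}" "j \<in> {..<K}" "i \<noteq> j" "x \<in> ball (p i) (\<rho>/2) \<inter> ball (p j) (\<rho>/2)"
        then show False using near[of i j 0 x x] by auto
      qed
      show "emeasure lebesgue (ball (p i) (\<rho>/2)) \<noteq> \<infinity>" for i
        using emeasure_lborel_ball_finite[of "p i" "\<rho>/2"] by (simp add: less_top emeasure_completion)
    qed auto
    moreover have "measure lebesgue (ball (p i) (\<rho>/2)) = V" for i
      using \<rho> by (simp add: V_def measure_completion content_ball)
    ultimately show False using KV by simp
  qed
  with R show ?thesis by (rule that)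
qed

section \<open>Mahler's compactness criterion\<close>

text \<open>The group GL_d(Z) of changes of basis of the integer lattice.\<close>

definition unim :: "real^'d^'d \<Rightarrow> bool" where
  "unim g \<longleftrightarrow> (\<forall>z\<in>int_vectors. g *v z \<in> int_vectors) \<and>
     (\<exists>g'. g ** g' = mat 1 \<and> g' ** g = mat 1 \<and> (\<forall>z\<in>int_vectors. g' *v z \<in> int_vectors))"

lemma int_matrix_entries:
  fixes M :: "real^'d^'d"
  shows "(\<forall>z\<in>int_vectors. M *v z \<in> int_vectors) \<longleftrightarrow> (\<forall>i j. M$i$j \<in> \<int>)"
proof
  assume M: "\<forall>z\<in>int_vectors. M *v z \<in> int_vectors"
  show "\<forall>i j. M$i$j \<in> \<int>"
  proof (intro allI)
    fix i j
    have "M *v axis j 1 \<in> int_vectors" using M int_vectors_axis by blast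
    then have "(M *v axis j 1) $ i \<in> \<int>" unfolding int_vectors_def by blast
    then show "M$i$j \<in> \<int>" by (simp add: matrix_vector_mult_basis column_def)
  qed
qed (auto simp: int_vectors_def matrix_vector_mult_def intro!: Ints_sum Ints_mult)

lemma det_int:
  fixes M :: "real^'d^'d"
  assumes "\<And>i j. M$i$j \<in> \<int>"
  shows "det M \<in> \<int>"
  unfolding det_def by (intro Ints_sum Ints_mult Ints_of_int Ints_prod) (use assms in auto)

text \<open>Cramer's rule: the determinant times a coordinate of the solution is itself the
  determinant of an integral matrix.\<close>

lemma det_mult_inverse_int:
  fixes M :: "real^'d^'d"
  assumes M: "\<And>i j. M$i$j \<in> \<int>" and d: "det M \<noteq> 0" and b: "M *v x \<in> int_vectors"
  shows "det M *\<^sub>R x \<in> int_vectors"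
  unfolding int_vectors_def
proof (intro CollectI allI)
  fix k
  have "det (\<chi> i j. if j = k then (M *v x)$i else M$i$j) = x$k * det M" by (rule cramer_lemma)
  moreover have "det (\<chi> i j. if j = k then (M *v x)$i else M$i$j) \<in> \<int>"
    by (rule det_int) (use M b in \<open>auto simp: int_vectors_def\<close>)
  ultimately show "(det M *\<^sub>R x) $ k \<in> \<int>" by (simp add: mult.commute)
qed

lemma det_unim: "unim g \<Longrightarrow> \<bar>det g\<bar> = 1"
proof -
  assume "unim g"
  then obtain g' where g: "\<forall>z\<in>int_vectors. g *v z \<in> int_vectors" "g ** g' = mat 1"
    "\<forall>z\<in>int_vectors. g' *v z \<in> int_vectors" unfolding unim_def by blast
  have "det g \<in> \<int>" "det g' \<in> \<int>" using g int_matrix_entries det_int by metis+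
  then obtain a b where ab: "det g = of_int a" "det g' = of_int b" by (auto elim!: Ints_cases)
  have "det g * det g' = 1" using g(2) by (metis det_mul det_I)
  then have "a * b = 1" unfolding ab by (metis of_int_mult of_int_eq_1_iff)
  then have "\<bar>a\<bar> = 1" by (metis abs_zmult_eq_1 abs_1)
  then show ?thesis unfolding ab by linarith
qed

lemma unim_nonzero: "unim g \<Longrightarrow> z \<noteq> 0 \<Longrightarrow> g *v z \<noteq> 0"
  unfolding unim_def by (metis matrix_vector_mul_assoc matrix_vector_mul_lid matrix_vector_mult_0_right)

lemma unim_image: "unim g \<Longrightarrow> (*v) g ` int_vectors = int_vectors"
  unfolding unim_def by (auto simp: image_iff) (metis matrix_vector_mul_assoc matrix_vector_mul_lid)

lemma adm_unim:
  assumes "unim g"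
  shows "adm \<nu> (y ** g) \<rho> \<longleftrightarrow> adm \<nu> y \<rho>"
proof
  assume A: "adm \<nu> (y ** g) \<rho>"
  show "adm \<nu> y \<rho>" unfolding adm_def
  proof (intro ballI impI)
    fix z assume z: "z \<in> int_vectors" "z \<noteq> (0::real^'a)"
    obtain u where u: "u \<in> int_vectors" "z = g *v u" using unim_image[OF assms] z by blast
    then have "u \<noteq> 0" using z by auto
    then have "\<rho> \<le> \<nu> ((y ** g) *v u)" using A u unfolding adm_def by blast
    then show "\<rho> \<le> \<nu> (y *v z)" by (simp add: u(2) matrix_vector_mul_assoc)
  qed
next
  assume A: "adm \<nu> y \<rho>"
  show "adm \<nu> (y ** g) \<rho>" unfolding adm_def
    using A assms unim_nonzero[OF assms] unim_image[OF assms] unfolding adm_def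
    by (auto simp flip: matrix_vector_mul_assoc)
qed

text \<open>\<open>M (M')\<inverse> = 1 + (M - M') (M')\<inverse>\<close>, and \<open>det M' \<cdot> (M')\<inverse>\<close> is integral.\<close>

lemma unim_of_congruent:
  fixes M M' N :: "real^'d^'d"
  assumes M: "\<And>i j. M$i$j \<in> \<int>" and M': "\<And>i j. M'$i$j \<in> \<int>"
    and d: "det M = det M'" "det M' \<noteq> 0"
    and c: "\<And>i j. (M$i$j - M'$i$j) / det M' \<in> \<int>"
    and N: "M' ** N = mat 1"
  shows "unim (M ** N)"
proof -
  have one: "(A ** B) *v z \<in> int_vectors"
    if A: "\<And>i j. A$i$j \<in> \<int>" and A': "\<And>i j. A'$i$j \<in> \<int>" and d: "det A' \<noteq> 0"
      and c: "\<And>i j. (A$i$j - A'$i$j) / det A' \<in> \<int>" and B: "A' ** B = mat 1" and z: "z \<in> int_vectors"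
    for A A' B :: "real^'d^'d" and z
  proof -
    define E where "E = (\<chi> i j. (A$i$j - A'$i$j) / det A')"
    have AE: "A = A' + det A' *\<^sub>R E" using d by (simp add: vec_eq_iff E_def)
    have Bz: "A' *v (B *v z) = z" using B by (simp add: matrix_vector_mul_assoc)
    have "(A ** B) *v z = A *v (B *v z)" by (simp add: matrix_vector_mul_assoc)
    also have "\<dots> = A' *v (B *v z) + (det A' *\<^sub>R E) *v (B *v z)"
      by (subst AE) (rule matrix_vector_mult_add_rdistrib)
    also have "(det A' *\<^sub>R E) *v (B *v z) = E *v (det A' *\<^sub>R (B *v z))"
      by (simp add: vec_eq_iff matrix_vector_mult_def mult_ac)
    finally have eq: "(A ** B) *v z = z + E *v (det A' *\<^sub>R (B *v z))" unfolding Bz .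
    have "E *v (det A' *\<^sub>R (B *v z)) \<in> int_vectors"
    proof -
      have "det A' *\<^sub>R (B *v z) \<in> int_vectors"
        by (rule det_mult_inverse_int[OF A' d]) (simp add: Bz z)
      moreover have "\<forall>i j. E$i$j \<in> \<int>" using c by (simp add: E_def)
      ultimately show ?thesis using int_matrix_entries[of E] by blast
    qed
    then show ?thesis unfolding eq using z int_vectors_add by blast
  qed
  have "invertible M" using d by (simp add: invertible_det_nz)
  then obtain K where K: "M ** K = mat 1" "K ** M = mat 1" unfolding invertible_def by blast
  have N2: "N ** M' = mat 1" using N matrix_left_right_inverse by blast
  have i1: "(M ** N) ** (M' ** K) = mat 1"
    by (metis K(1) N2 matrix_mul_assoc matrix_mul_rid)
  have i2: "(M' ** K) ** (M ** N) = mat 1"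
    by (metis K(2) N matrix_mul_assoc matrix_mul_rid)
  have c': "(M'$i$j - M$i$j) / det M \<in> \<int>" for i j
    using Ints_minus[OF c[of i j]] by (simp only: d(1) minus_divide_left minus_diff_eq)
  show ?thesis unfolding unim_def
    using one[OF M M' d(2) c N] one[OF M' M _ c' K(1)] d i1 i2 by auto
qed

lemma det_abs_le:
  fixes A :: "real^'d^'d"
  assumes "\<And>i j. \<bar>A$i$j\<bar> \<le> R"
  shows "\<bar>det A\<bar> \<le> real (card {p. p permutes (UNIV::'d set)}) * R ^ CARD('d)"
proof -
  have "\<bar>det A\<bar> \<le> (\<Sum>p\<in>{p. p permutes (UNIV::'d set)}. \<bar>of_int (sign p) * (\<Prod>i\<in>UNIV. A$i$p i)\<bar>)"
    unfolding det_def by (rule sum_abs)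
  also have "\<dots> \<le> (\<Sum>p\<in>{p. p permutes (UNIV::'d set)}. R ^ CARD('d))"
  proof (rule sum_mono)
    fix p :: "'d \<Rightarrow> 'd"
    have "\<bar>of_int (sign p) * (\<Prod>i\<in>UNIV. A$i$p i)\<bar> = (\<Prod>i\<in>UNIV. \<bar>A$i$p i\<bar>)"
      by (simp add: abs_mult abs_prod flip: of_int_abs)
    also have "\<dots> \<le> (\<Prod>i\<in>(UNIV::'d set). R)" by (rule prod_mono) (use assms in auto)
    finally show "\<bar>of_int (sign p) * (\<Prod>i\<in>UNIV. A$i$p i)\<bar> \<le> R ^ CARD('d)" by simp
  qed
  finally show ?thesis by simp
qed

text \<open>Short lattice vectors give a basis of the space, but in general only of a sublattice of
  finite index: \<open>M\<close> is integral with nonzero determinant. Removing the index is left to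
  the congruence argument.\<close>

lemma short_basis:
  fixes y :: "real^'d^'d"
  assumes "span {y *v z |z. z \<in> int_vectors \<and> norm (y *v z) \<le> R} = UNIV"
  obtains M :: "real^'d^'d" where "\<And>i j. M$i$j \<in> \<int>" "det (y ** M) \<noteq> 0" "\<And>i j. \<bar>(y ** M)$i$j\<bar> \<le> R"
proof -
  define L where "L = {y *v z |z. z \<in> int_vectors \<and> norm (y *v z) \<le> R}"
  obtain B where B: "B \<subseteq> L" "independent B" "L \<subseteq> span B" "card B = dim L" using basis_exists by blast
  have spB: "span B = UNIV" using B(3) assms unfolding L_def[symmetric]
    by (metis span_mono span_span top.extremum_uniqueI)
  have "dim L = CARD('d)" using assms unfolding L_def[symmetric] by (metis dim_span dim_UNIV DIM_cart DIM_real mult.right_neutral)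
  then have cB: "card B = CARD('d)" using B by simp
  then have "finite B" by (metis card.infinite zero_less_card_finite less_irrefl)
  then obtain f where f: "bij_betw f (UNIV::'d set) B"
    using cB finite_same_card_bij[of "UNIV::'d set" B] by auto
  have "\<forall>j. \<exists>z. f j = y *v z \<and> z \<in> int_vectors \<and> norm (y *v z) \<le> R"
  proof
    fix j
    have "f j \<in> L" using f B(1) bij_betwE by blast
    then show "\<exists>z. f j = y *v z \<and> z \<in> int_vectors \<and> norm (y *v z) \<le> R" unfolding L_def by blast
  qed
  then obtain z where z: "\<And>j. f j = y *v z j" "\<And>j. z j \<in> int_vectors" "\<And>j. norm (y *v z j) \<le> R" by metis
  define M :: "real^'d^'d" where "M = (\<chi> i j. z j $ i)"
  have ent: "(y ** M)$i$j = f j $ i" for i j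
    by (simp add: matrix_matrix_mult_def M_def z(1) matrix_vector_mult_def)
  have col: "columns (y ** M) = B"
  proof -
    have "column j (y ** M) = f j" for j by (simp add: column_def ent vec_eq_iff)
    then have "columns (y ** M) = range f" unfolding columns_def by auto
    then show ?thesis using f by (simp add: bij_betw_def)
  qed
  have "\<exists>K. (y ** M) ** K = mat 1"
    unfolding matrix_right_invertible_span_columns col span_vec_eq spB ..
  then have "det (y ** M) \<noteq> 0" by (metis invertible_det_nz matrix_right_invertible invertible_right_inverse)
  moreover have "\<bar>(y ** M)$i$j\<bar> \<le> R" for i j
    using component_le_norm_cart[of "f j" i] z(3)[of j] by (simp add: ent z(1))
  moreover have "M$i$j \<in> \<int>" for i j using z(2)[of j] by (simp add: M_def int_vectors_def)
  ultimately show ?thesis using that by blast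
qed

text \<open>Finiteness comes from integral matrices of bounded determinant falling into finitely many
  classes modulo right multiplication by \<open>unim\<close> matrices.\<close>

lemma mahler_bounded_representative:
  fixes \<rho> :: real
  assumes \<rho>: "\<rho> > 0"
  obtains B where "\<And>y::real^'d^'d. \<bar>det y\<bar> = 1 \<Longrightarrow> adm norm y \<rho> \<Longrightarrow> \<exists>g. unim g \<and> norm (y ** g) \<le> B"
proof -
  obtain R where R: "R > 0" "\<And>y::real^'d^'d. \<bar>det y\<bar> = 1 \<Longrightarrow> adm norm y \<rho> \<Longrightarrow>
     span {y *v z |z. z \<in> int_vectors \<and> norm (y *v z) \<le> R} = UNIV"
    using short_vectors_span[OF \<rho>] by blast
  define C where "C = \<lceil>real (card {p. p permutes (UNIV::'d set)}) * R ^ CARD('d)\<rceil>"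
  define \<M> where "\<M> = {M::real^'d^'d. (\<forall>i j. M$i$j \<in> \<int>) \<and> det M \<noteq> 0 \<and> \<bar>det M\<bar> \<le> of_int C}"
  \<comment> \<open>The class used in \<open>unim_of_congruent\<close>: equal keys mean equal
    determinants and congruence of all entries modulo the determinant.\<close>
  define key where "key M = (\<lfloor>det M\<rfloor>, \<lambda>(i,j). \<lfloor>M$i$j\<rfloor> mod \<lfloor>det M\<rfloor>)" for M :: "real^'d^'d"
  have "finite (key ` \<M>)"
  proof (rule finite_subset)
    show "finite ({-C..C} \<times> (PiE UNIV (\<lambda>_. {-C..C}) :: ('d \<times> 'd \<Rightarrow> int) set))"
      by (intro finite_cartesian_product finite_PiE) auto
    show "key ` \<M> \<subseteq> {-C..C} \<times> PiE UNIV (\<lambda>_. {-C..C})"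
    proof (rule image_subsetI)
      fix M assume M: "M \<in> \<M>"
      then have "det M \<in> \<int>" by (auto simp: \<M>_def intro: det_int)
      then obtain N where N: "det M = of_int N" by (auto elim: Ints_cases)
      have "\<bar>det M\<bar> \<le> of_int C" "det M \<noteq> 0" using M unfolding \<M>_def by blast+
      then have "\<bar>N\<bar> \<le> C" "N \<noteq> 0" unfolding N by linarith+
      moreover have "\<bar>a mod N\<bar> \<le> \<bar>N\<bar>" for a using abs_mod_less[of N a] \<open>N \<noteq> 0\<close> by simp
      ultimately have "a mod N \<in> {-C..C}" for a using order_trans[of "\<bar>a mod N\<bar>" "\<bar>N\<bar>" C] by (auto simp: abs_le_iff)
      then show "key M \<in> {-C..C} \<times> PiE UNIV (\<lambda>_. {-C..C})" using \<open>\<bar>N\<bar> \<le> C\<close> by (auto simp: key_def N)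
    qed
  qed
  define rep where "rep \<kappa> = (SOME M. M \<in> \<M> \<and> key M = \<kappa>)" for \<kappa>
  have rep: "rep (key M) \<in> \<M>" "key (rep (key M)) = key M" if "M \<in> \<M>" for M
    using someI[of "\<lambda>X. X \<in> \<M> \<and> key X = key M" M] that unfolding rep_def by auto
  define Q where "Q \<kappa> = (SOME N. rep \<kappa> ** N = mat 1)" for \<kappa>
  have Q: "rep (key M) ** Q (key M) = mat 1" if "M \<in> \<M>" for M
  proof -
    have "det (rep (key M)) \<noteq> 0" using rep(1)[OF that] by (simp add: \<M>_def)
    then have "\<exists>N. rep (key M) ** N = mat 1" by (metis invertible_det_nz invertible_def)
    then show ?thesis unfolding Q_def by (rule someI_ex)
  qed
  have "\<exists>K. \<forall>X::real^'d^'d. norm (X ** Q \<kappa>) \<le> K * norm X" for \<kappa>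
    by (rule linear_bounded)
      (auto intro!: linearI simp: vec_eq_iff matrix_matrix_mult_def distrib_right sum.distrib sum_distrib_left mult.assoc)
  then obtain K where K: "\<And>\<kappa> X. norm (X ** Q \<kappa>) \<le> K \<kappa> * norm (X::real^'d^'d)" by metis
  define X0 where "X0 = (real CARD('d) * (real CARD('d) * R))"
  define B where "B = (\<Sum>\<kappa>\<in>key ` \<M>. \<bar>K \<kappa>\<bar> * X0)"
  have "\<exists>g. unim g \<and> norm (y ** g) \<le> B" if y: "\<bar>det y\<bar> = 1" "adm norm y \<rho>" for y :: "real^'d^'d"
  proof -
    obtain M :: "real^'d^'d" where M: "\<And>i j. M$i$j \<in> \<int>" "det (y ** M) \<noteq> 0" "\<And>i j. \<bar>(y ** M)$i$j\<bar> \<le> R"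
      using short_basis[OF R(2)[OF y]] by blast
    have dM: "\<bar>det M\<bar> = \<bar>det (y ** M)\<bar>" using y(1) by (simp add: det_mul abs_mult)
    also have "\<dots> \<le> of_int C" using det_abs_le[OF M(3)] unfolding C_def by linarith
    finally have MM: "M \<in> \<M>" using M(1,2) unfolding \<M>_def by (auto simp: det_mul)
    \<comment> \<open>\<open>M ** N\<close> is the wanted \<open>g\<close>: the entries of
      \<open>y ** M\<close> are bounded by \<open>R\<close>, and \<open>N\<close> is one of finitely
      many matrices.\<close>
    define M' where "M' = rep (key M)"
    define N where "N = Q (key M)"
    have M': "M' \<in> \<M>" "key M' = key M" "M' ** N = mat 1" using rep[OF MM] Q[OF MM] by (auto simp: M'_def N_def)
    have M'i: "M'$i$j \<in> \<int>" for i j using M'(1) by (simp add: \<M>_def)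
    have d0: "det M' \<noteq> 0" using M'(1) by (simp add: \<M>_def)
    have di: "det M \<in> \<int>" "det M' \<in> \<int>" using M(1) M'i det_int by blast+
    have fl: "\<lfloor>det M\<rfloor> = \<lfloor>det M'\<rfloor>" using M'(2) by (simp add: key_def)
    then have d: "det M = det M'" using di by (metis floor_of_int Ints_cases)
    obtain n where n: "det M' = of_int n" using di by (auto elim: Ints_cases)
    have "unim (M ** N)"
    proof (rule unim_of_congruent[OF M(1) M'i d d0 _ M'(3)])
      fix i j
      obtain a b where ab: "M$i$j = of_int a" "M'$i$j = of_int b" using M(1)[of i j] M'i[of i j] by (auto elim!: Ints_cases)
      have "\<lfloor>M$i$j\<rfloor> mod \<lfloor>det M\<rfloor> = \<lfloor>M'$i$j\<rfloor> mod \<lfloor>det M'\<rfloor>"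
        using fun_cong[OF arg_cong[OF M'(2), of snd], of "(i,j)"] by (simp add: key_def)
      then have "a mod n = b mod n" by (simp add: ab d n)
      then have "n dvd a - b" by (simp add: mod_eq_dvd_iff)
      then obtain k where "a - b = n * k" by (auto elim: dvdE)
      then have "(M$i$j - M'$i$j) / det M' = of_int k" using d0 unfolding ab n
        by (simp flip: of_int_diff)
      then show "(M$i$j - M'$i$j) / det M' \<in> \<int>" by simp
    qed
    moreover have "norm (y ** (M ** N)) \<le> B"
    proof -
      have "norm (y ** M) \<le> (\<Sum>i\<in>UNIV. norm ((y ** M)$i))"
        unfolding norm_vec_def by (rule L2_set_le_sum) auto
      also have "\<dots> \<le> (\<Sum>i\<in>UNIV. \<Sum>j\<in>UNIV. \<bar>(y ** M)$i$j\<bar>)" by (intro sum_mono norm_le_l1_cart)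
      also have "\<dots> \<le> (\<Sum>i\<in>(UNIV::'d set). \<Sum>j\<in>(UNIV::'d set). R)" by (intro sum_mono M(3))
      finally have X: "norm (y ** M) \<le> X0" by (simp add: X0_def)
      have X0: "X0 \<ge> 0" using R by (simp add: X0_def)
      have "norm (y ** (M ** N)) = norm ((y ** M) ** N)" by (simp add: matrix_mul_assoc)
      also have "\<dots> \<le> K (key M) * norm (y ** M)" unfolding N_def by (rule K)
      also have "\<dots> \<le> \<bar>K (key M)\<bar> * X0" using X by (intro mult_mono) auto
      also have "\<dots> \<le> B" unfolding B_def
        by (rule member_le_sum) (use MM X0 \<open>finite (key ` \<M>)\<close> in auto)
      finally show ?thesis .
    qed
    ultimately show ?thesis by blast
  qed
  then show ?thesis by (rule that)
qed

lemma continuous_on_det [continuous_intros]: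
  fixes f :: "'a::topological_space \<Rightarrow> real^'d^'d"
  assumes "continuous_on S f"
  shows "continuous_on S (\<lambda>x. det (f x))"
  unfolding det_def by (intro continuous_intros assms)

lemma compact_unit_det: "compact {h::real^'d^'d. \<bar>det h\<bar> = 1 \<and> norm h \<le> B}"
proof -
  have "{h::real^'d^'d. \<bar>det h\<bar> = 1 \<and> norm h \<le> B} = {h. \<bar>det h\<bar> = 1} \<inter> cball 0 B" by auto
  moreover have "closed {h::real^'d^'d. \<bar>det h\<bar> = 1}"
    by (intro closed_Collect_eq continuous_intros)
  ultimately show ?thesis by (simp add: closed_Int_compact)
qed

lemma continuous_on_matrix_vector_mult [continuous_intros]:
  fixes f :: "'a::topological_space \<Rightarrow> real^'n^'m"
  assumes "continuous_on S f" "continuous_on S g"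
  shows "continuous_on S (\<lambda>x. f x *v g x)"
  unfolding matrix_vector_mult_def by (intro continuous_intros assms)

text \<open>Compactness: over the bounded matrices of determinant 1 or -1 and the unit vectors, the
  length of \<open>h *v v\<close> has a positive minimum, because no such matrix kills a unit
  vector.\<close>

lemma norm_le_norm_image:
  obtains c where "c > 0" "\<And>(h::real^'d^'d) v. \<bar>det h\<bar> = 1 \<Longrightarrow> norm h \<le> B \<Longrightarrow> c * norm v \<le> norm (h *v v)"
proof -
  define S where "S = {h::real^'d^'d. \<bar>det h\<bar> = 1 \<and> norm h \<le> B} \<times> sphere (0::real^'d) 1"
  show ?thesis
  proof (cases "{h::real^'d^'d. \<bar>det h\<bar> = 1 \<and> norm h \<le> B} = {}")
    case True
    then show ?thesis using that[of 1] by auto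
  next
    case False
    have "compact S" unfolding S_def by (intro compact_Times compact_unit_det compact_sphere)
    moreover have "S \<noteq> {}" using False unfolding S_def by simp
    moreover have "continuous_on S (\<lambda>(h,v). norm (h *v v))" unfolding case_prod_unfold
      by (intro continuous_intros)
    ultimately obtain p where p: "p \<in> S" "\<And>q. q \<in> S \<Longrightarrow> (\<lambda>(h,v). norm (h *v v)) p \<le> (\<lambda>(h,v). norm (h *v v)) q"
      using continuous_attains_inf by metis
    obtain h0 v0 where hv: "p = (h0, v0)" by (cases p)
    define c where "c = norm (h0 *v v0)"
    have "det h0 \<noteq> 0" "v0 \<noteq> 0" using p(1) unfolding S_def hv by auto
    then have "h0 *v v0 \<noteq> 0"
      by (metis invertible_det_nz invertible_def matrix_left_invertible_ker)
    then have c: "c > 0" by (simp add: c_def)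
    have "c * norm v \<le> norm (h *v v)" if h: "\<bar>det h\<bar> = 1" "norm h \<le> B" for h :: "real^'d^'d" and v
    proof (cases "v = 0")
      case False
      then have "(h, (1 / norm v) *\<^sub>R v) \<in> S" using h unfolding S_def by auto
      from p(2)[OF this] have "c \<le> norm (h *v ((1 / norm v) *\<^sub>R v))" by (simp add: hv c_def)
      also have "\<dots> = norm (h *v v) / norm v"
        by (simp add: matrix_vector_mult_scaleR)
      finally show ?thesis using False by (simp add: field_simps)
    qed simp
    with c show ?thesis by (rule that)
  qed
qed

section \<open>The renormalisation flow\<close>

lemma sum_UNIV_Plus:
  fixes f :: "('m::finite + 'n::finite) \<Rightarrow> 'a::comm_monoid_add"
  shows "(\<Sum>k\<in>UNIV. f k) = (\<Sum>i\<in>UNIV. f (Inl i)) + (\<Sum>j\<in>UNIV. f (Inr j))"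
  unfolding UNIV_Plus_UNIV[symmetric] by (subst sum.Plus) (auto simp: comp_def)

text \<open>The columns of \<open>flow \<alpha> \<beta> s A\<close> span \<open>\<Lambda>\<^sub>A\<close> renormalised at \<open>t = exp s\<close>.\<close>

definition flow :: "real^'m \<Rightarrow> real^'n \<Rightarrow> real \<Rightarrow> real^'n^'m \<Rightarrow> real^('m + 'n)^('m + 'n)" where
  "flow \<alpha> \<beta> s A = (\<chi> k l. case k of
       Inl i \<Rightarrow> exp (s * \<alpha>$i) * (case l of Inl i' \<Rightarrow> if i' = i then 1 else 0 | Inr j \<Rightarrow> A$i$j)
     | Inr j \<Rightarrow> exp (- s * \<beta>$j) * (case l of Inl i' \<Rightarrow> 0 | Inr j' \<Rightarrow> if j' = j then 1 else 0))"

definition rate :: "real^'m \<Rightarrow> real^'n \<Rightarrow> 'm \<times> 'n \<Rightarrow> real" where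
  "rate \<alpha> \<beta> = (\<lambda>(i,j). \<alpha>$i + \<beta>$j)"

text \<open>Undoes the expansion of the matrix entries by the flow: for \<open>b\<close> in the unit
  box, \<open>A + shrink \<alpha> \<beta> s b\<close> runs through the box of \<open>A\<close> at
  time \<open>s\<close>.\<close>

definition shrink :: "real^'m \<Rightarrow> real^'n \<Rightarrow> real \<Rightarrow> real^'n^'m \<Rightarrow> real^'n^'m" where
  "shrink \<alpha> \<beta> s b = (\<chi> i j. exp (- s * (\<alpha>$i + \<beta>$j)) * b$i$j)"

lemma flow_Inl: "(flow \<alpha> \<beta> s A *v v) $ Inl i = exp (s * \<alpha>$i) * (v $ Inl i + (\<Sum>j\<in>UNIV. A$i$j * v $ Inr j))"
proof -
  have "(flow \<alpha> \<beta> s A *v v) $ Inl i = (\<Sum>i'\<in>UNIV. exp (s * \<alpha>$i) * (if i' = i then 1 else 0) * v $ Inl i') +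
      (\<Sum>j\<in>UNIV. exp (s * \<alpha>$i) * A$i$j * v $ Inr j)"
    by (simp add: matrix_vector_mult_def flow_def sum_UNIV_Plus)
  also have "(\<Sum>i'\<in>UNIV. exp (s * \<alpha>$i) * (if i' = i then 1 else 0) * v $ Inl i') = exp (s * \<alpha>$i) * v $ Inl i"
    by (subst sum.remove[of _ i]) (auto intro!: sum.neutral)
  finally show ?thesis by (simp add: distrib_left sum_distrib_left mult.assoc)
qed

lemma flow_Inr: "(flow \<alpha> \<beta> s A *v v) $ Inr j = exp (- s * \<beta>$j) * v $ Inr j"
proof -
  have "(flow \<alpha> \<beta> s A *v v) $ Inr j = (\<Sum>j'\<in>UNIV. exp (- s * \<beta>$j) * (if j' = j then 1 else 0) * v $ Inr j')"
    by (simp add: matrix_vector_mult_def flow_def sum_UNIV_Plus)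
  also have "\<dots> = exp (- s * \<beta>$j) * v $ Inr j"
    by (subst sum.remove[of _ j]) (auto intro!: sum.neutral)
  finally show ?thesis .
qed

lemma vec_eq_Plus_iff: "x = y \<longleftrightarrow> (\<forall>i. x $ Inl i = y $ Inl i) \<and> (\<forall>j. x $ Inr j = (y::'a^('m::finite + 'n::finite)) $ Inr j)"
  unfolding vec_eq_iff by (metis sum.exhaust)

text \<open>The unipotent part of \<open>b\<close> is moved past the diagonal flow of time
  \<open>s\<close>, which contracts the entry (i, j) by
  \<open>exp (- s * (\<alpha>$i + \<beta>$j))\<close>. So the orbits of all matrices in a box at
  time \<open>s\<close> come from the one lattice of its corner, moved by a parameter in the unit
  box.\<close>

lemma flow_mult: "flow \<alpha> \<beta> s' b ** flow \<alpha> \<beta> s A = flow \<alpha> \<beta> (s + s') (A + shrink \<alpha> \<beta> s b)"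
proof -
  have "(flow \<alpha> \<beta> s' b ** flow \<alpha> \<beta> s A) *v v = flow \<alpha> \<beta> (s + s') (A + shrink \<alpha> \<beta> s b) *v v" for v
    unfolding vec_eq_Plus_iff
  proof (intro conjI allI)
    fix i
    have e: "exp (s' * \<alpha>$i) * (b$i$j * (exp (- s * \<beta>$j) * v $ Inr j)) =
        exp ((s + s') * \<alpha>$i) * (shrink \<alpha> \<beta> s b $i$j * v $ Inr j)" for j
    proof -
      have "exp (s' * \<alpha>$i) * exp (- s * \<beta>$j) = exp ((s + s') * \<alpha>$i) * exp (- s * (\<alpha>$i + \<beta>$j))"
        unfolding exp_add[symmetric] by (simp add: algebra_simps)
      then have "(exp (s' * \<alpha>$i) * exp (- s * \<beta>$j)) * (b$i$j * v $ Inr j) =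
          (exp ((s + s') * \<alpha>$i) * exp (- s * (\<alpha>$i + \<beta>$j))) * (b$i$j * v $ Inr j)" by simp
      then show ?thesis by (simp only: shrink_def vec_lambda_beta mult_ac)
    qed
    have e2: "exp (s' * \<alpha>$i) * (exp (s * \<alpha>$i) * u) = exp ((s + s') * \<alpha>$i) * u" for u
      unfolding mult.assoc[symmetric] exp_add[symmetric] by (simp add: algebra_simps)
    show "((flow \<alpha> \<beta> s' b ** flow \<alpha> \<beta> s A) *v v) $ Inl i =
        (flow \<alpha> \<beta> (s + s') (A + shrink \<alpha> \<beta> s b) *v v) $ Inl i"
      unfolding matrix_vector_mul_assoc[symmetric] flow_Inl flow_Inr distrib_left sum_distrib_left e e2
      by (simp add: distrib_right distrib_left sum.distrib)
  next
    fix j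
    show "((flow \<alpha> \<beta> s' b ** flow \<alpha> \<beta> s A) *v v) $ Inr j =
        (flow \<alpha> \<beta> (s + s') (A + shrink \<alpha> \<beta> s b) *v v) $ Inr j"
      unfolding matrix_vector_mul_assoc[symmetric] flow_Inr
      by (simp add: algebra_simps flip: exp_add)
  qed
  then show ?thesis by (simp add: matrix_eq)
qed

lemma flow_0_0: "flow \<alpha> \<beta> 0 0 = mat 1"
proof -
  have "flow \<alpha> \<beta> 0 0 *v v = v" for v by (simp add: vec_eq_Plus_iff flow_Inl flow_Inr)
  then show ?thesis by (simp add: matrix_eq)
qed

lemma weight_vectorD:
  assumes "weight_vector \<alpha> \<beta>"
  shows "0 < \<alpha>$i" "0 < \<beta>$j" "\<alpha>$i \<le> 1" "\<beta>$j \<le> 1"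
    "(\<Sum>i\<in>UNIV. \<alpha>$i) = 1" "(\<Sum>j\<in>UNIV. \<beta>$j) = 1" "0 < rate \<alpha> \<beta> l"
proof -
  show p: "0 < \<alpha>$i" "0 < \<beta>$j" for i j using assms unfolding weight_vector_def by auto
  show s: "(\<Sum>i\<in>UNIV. \<alpha>$i) = 1" "(\<Sum>j\<in>UNIV. \<beta>$j) = 1" using assms unfolding weight_vector_def by auto
  show "\<alpha>$i \<le> 1" using member_le_sum[of i UNIV "\<lambda>i. \<alpha>$i"] p s by (auto simp: less_imp_le)
  show "\<beta>$j \<le> 1" using member_le_sum[of j UNIV "\<lambda>i. \<beta>$i"] p s by (auto simp: less_imp_le)
  show "0 < rate \<alpha> \<beta> l" using p by (auto simp: rate_def add_pos_pos split: prod.split)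
qed

lemma prod_UNIV_Plus:
  fixes f :: "('m::finite + 'n::finite) \<Rightarrow> 'a::comm_monoid_mult"
  shows "(\<Prod>k\<in>UNIV. f k) = (\<Prod>i\<in>UNIV. f (Inl i)) * (\<Prod>j\<in>UNIV. f (Inr j))"
  unfolding UNIV_Plus_UNIV[symmetric] by (subst prod.Plus) (auto simp: comp_def)

text \<open>Conjugation by \<open>diag (2, 1)\<close> squares a unipotent block matrix, so its determinant is a fixed
  point of squaring.\<close>

lemma det_flow:
  fixes \<alpha> :: "real^'m" and \<beta> :: "real^'n"
  assumes "weight_vector \<alpha> \<beta>"
  shows "det (flow \<alpha> \<beta> s A) = 1"
proof -
  define E :: "real^('m + 'n)^('m + 'n)" where
    "E = (\<chi> k l. if k = l then (case k of Inl i \<Rightarrow> 2 | Inr j \<Rightarrow> 1) else 0)"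
  have Ev: "(E *v v) $ k = (case k of Inl i \<Rightarrow> 2 | Inr j \<Rightarrow> 1) * v $ k" for v k
  proof -
    have "(E *v v) $ k = (\<Sum>l\<in>UNIV. if l = k then (case k of Inl i \<Rightarrow> 2 | Inr j \<Rightarrow> 1) * v $ k else 0)"
      unfolding E_def matrix_vector_mult_def vec_lambda_beta
      by (rule sum.cong) auto
    then show ?thesis by simp
  qed
  have detE: "det E \<noteq> 0"
    by (subst det_diagonal) (auto simp: E_def prod_UNIV_Plus)
  define u where "u = det (flow \<alpha> \<beta> 0 A)"
  have "E ** flow \<alpha> \<beta> 0 A = flow \<alpha> \<beta> 0 (A + A) ** E"
    unfolding matrix_eq vec_eq_Plus_iff matrix_vector_mul_assoc[symmetric] flow_Inl flow_Inr Ev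
    by (simp add: distrib_left distrib_right sum.distrib sum_distrib_left mult.assoc)
  then have "det E * u = det (flow \<alpha> \<beta> 0 (A + A)) * det E" unfolding u_def by (metis det_mul)
  then have "u = det (flow \<alpha> \<beta> 0 (A + A))" using detE by simp
  also have "flow \<alpha> \<beta> 0 (A + A) = flow \<alpha> \<beta> 0 A ** flow \<alpha> \<beta> 0 A"
    unfolding flow_mult by (simp add: shrink_def)
  finally have "u = u * u" by (simp add: det_mul u_def)
  moreover have "u \<noteq> 0"
  proof -
    have "A + shrink \<alpha> \<beta> 0 (- A) = 0" by (simp add: vec_eq_iff shrink_def)
    then have "flow \<alpha> \<beta> 0 (- A) ** flow \<alpha> \<beta> 0 A = mat 1" by (simp add: flow_mult flow_0_0)
    then have "det (flow \<alpha> \<beta> 0 (- A)) * u = 1" unfolding u_def by (metis det_mul det_I)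
    then show ?thesis by auto
  qed
  ultimately have u: "u = 1" by simp
  have "det (flow \<alpha> \<beta> s 0) = (\<Prod>i\<in>UNIV. exp (s * \<alpha>$i)) * (\<Prod>j\<in>UNIV. exp (- s * \<beta>$j))"
    by (subst det_diagonal) (auto simp: flow_def prod_UNIV_Plus split: sum.splits)
  also have "\<dots> = exp (s * (\<Sum>i\<in>UNIV. \<alpha>$i)) * exp (- s * (\<Sum>j\<in>UNIV. \<beta>$j))"
    unfolding exp_sum[OF finite, symmetric] sum_distrib_left ..
  also have "\<dots> = 1" using weight_vectorD(5,6)[OF assms] by (simp flip: exp_add)
  finally have "det (flow \<alpha> \<beta> s 0) = 1" .
  moreover have "shrink \<alpha> \<beta> 0 0 = 0" by (simp add: shrink_def vec_eq_iff)
  then have "flow \<alpha> \<beta> s A = flow \<alpha> \<beta> s 0 ** flow \<alpha> \<beta> 0 A"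
    by (simp add: flow_mult)
  ultimately show ?thesis using u by (simp add: det_mul u_def)
qed

text \<open>The constant counts coefficients of size at most \<open>exp T\<close>: 1 + n in each of
  the m upper rows, one in each of the n lower rows.\<close>

lemma norm_flow_le:
  fixes \<alpha> :: "real^'m" and \<beta> :: "real^'n"
  assumes "weight_vector \<alpha> \<beta>" "\<bar>s\<bar> \<le> T" and b: "\<And>i j. \<bar>b$i$j\<bar> \<le> 1"
  shows "norm (flow \<alpha> \<beta> s b *v v) \<le> (real CARD('m) * (1 + real CARD('n)) + real CARD('n)) * exp T * norm v"
proof -
  let ?x = "flow \<alpha> \<beta> s b *v v"
  have ex: "exp (s * a) \<le> exp T" "exp (- s * a) \<le> exp T" if "0 < a" "a \<le> 1" for a
  proof -
    have "\<bar>s * a\<bar> \<le> T * 1" unfolding abs_mult using assms(2) that by (intro mult_mono) auto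
    then show "exp (s * a) \<le> exp T" "exp (- s * a) \<le> exp T" by auto
  qed
  have v: "\<bar>v $ k\<bar> \<le> norm v" for k by (rule component_le_norm_cart)
  have 1: "\<bar>?x $ Inl i\<bar> \<le> exp T * ((1 + real CARD('n)) * norm v)" for i
  proof -
    have "\<bar>\<Sum>j\<in>UNIV. b$i$j * v $ Inr j\<bar> \<le> (\<Sum>j\<in>UNIV. \<bar>b$i$j * v $ Inr j\<bar>)" by (rule sum_abs)
    also have "\<dots> \<le> (\<Sum>j\<in>(UNIV::'n set). 1 * norm v)"
      unfolding abs_mult by (intro sum_mono mult_mono b v) auto
    finally have "\<bar>v $ Inl i + (\<Sum>j\<in>UNIV. b$i$j * v $ Inr j)\<bar> \<le> (1 + real CARD('n)) * norm v"
      using v[of "Inl i"] by (simp add: distrib_right)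
    then show ?thesis unfolding flow_Inl abs_mult
      using ex(1)[OF weight_vectorD(1,3)[OF assms(1), of i]] by (intro mult_mono) auto
  qed
  have 2: "\<bar>?x $ Inr j\<bar> \<le> exp T * norm v" for j
    unfolding flow_Inr abs_mult using ex(2)[OF weight_vectorD(2,4)[OF assms(1), of j]] v by (intro mult_mono) auto
  have "norm ?x \<le> (\<Sum>k\<in>UNIV. \<bar>?x $ k\<bar>)" by (rule norm_le_l1_cart)
  also have "\<dots> \<le> (\<Sum>i\<in>(UNIV::'m set). exp T * ((1 + real CARD('n)) * norm v)) + (\<Sum>j\<in>(UNIV::'n set). exp T * norm v)"
    unfolding sum_UNIV_Plus by (intro add_mono sum_mono 1 2)
  finally show ?thesis by (simp add: algebra_simps)
qed

lemma tendsto_flow: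
  fixes \<alpha> :: "real^'m" and \<beta> :: "real^'n"
  assumes "(f \<longlongrightarrow> s) F" "(g \<longlongrightarrow> b) F" "(h \<longlongrightarrow> H) F"
  shows "((\<lambda>k. flow \<alpha> \<beta> (f k) (g k) *v (h k *v z)) \<longlongrightarrow> flow \<alpha> \<beta> s b *v (H *v z)) F"
proof (rule vec_tendstoI)
  fix k :: "'m + 'n"
  have H: "((\<lambda>k. (h k *v z) $ i) \<longlongrightarrow> (H *v z) $ i) F" for i
    unfolding matrix_vector_mult_def using assms(3) by (auto intro!: tendsto_intros)
  show "((\<lambda>x. (flow \<alpha> \<beta> (f x) (g x) *v (h x *v z)) $ k) \<longlongrightarrow> (flow \<alpha> \<beta> s b *v (H *v z)) $ k) F"
  proof (cases k)
    case (Inl i)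
    have g: "((\<lambda>k. g k $ i $ j) \<longlongrightarrow> b $ i $ j) F" for j
      by (intro tendsto_vec_nth assms(2))
    show ?thesis unfolding Inl flow_Inl
      by (intro tendsto_mult tendsto_add tendsto_exp tendsto_sum assms(1) H g tendsto_const)
  next
    case (Inr j)
    show ?thesis unfolding Inr flow_Inr
      by (intro tendsto_mult tendsto_minus tendsto_exp assms(1) H tendsto_const)
  qed
qed

lemma flow_conj:
  assumes "X = A + shrink \<alpha> \<beta> s b"
  shows "flow \<alpha> \<beta> s' X = flow \<alpha> \<beta> (s' - s) b ** flow \<alpha> \<beta> s A"
  unfolding flow_mult assms by simp

text \<open>With \<open>t = exp s\<close>, improvement by \<open>c\<close> means stretching the
  first m coordinates by \<open>c powr (- \<alpha>$i)\<close>. A vector whose norm is below the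
  critical radius by \<open>\<epsilon>\<close> survives the stretch by
  \<open>(1 + e) powr (\<alpha>$i)\<close> for small \<open>e\<close>, and
  \<open>c = 1 / (1 + e)\<close>.\<close>

lemma in_DI:
  fixes \<alpha> :: "real^'m" and \<beta> :: "real^'n" and \<nu> :: "real^('m + 'n) \<Rightarrow> real"
  assumes w: "weight_vector \<alpha> \<beta>" and \<nu>: "is_norm \<nu>" and \<epsilon>: "\<epsilon> > 0"
    and ev: "\<forall>\<^sub>F s in at_top. \<exists>z\<in>int_vectors. z \<noteq> 0 \<and> \<nu> (flow \<alpha> \<beta> s A *v z) \<le> critical_radius \<nu> - \<epsilon>"
  shows "A \<in> DI \<nu> \<alpha> \<beta>"
proof -
  define r where "r = critical_radius \<nu>"
  have r: "r > 0" unfolding r_def by (rule critical_radius_pos[OF \<nu>])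
  obtain C where C: "C > 0" "\<And>x. \<nu> x \<le> C * norm x" using is_norm_upper[OF \<nu>] by blast
  obtain c0 where c0: "c0 > 0" "\<And>x. c0 * norm x \<le> \<nu> x" using is_norm_lower[OF \<nu>] by blast
  \<comment> \<open>Makes the bound \<open>C * (e * (r / c0))\<close> for the displacement by the
    stretch equal to \<open>\<epsilon> / 2\<close>.\<close>
  define e where "e = \<epsilon> * c0 / (2 * C * r)"
  have e: "e > 0" using \<epsilon> C c0 r by (simp add: e_def)
  define c where "c = 1 / (1 + e)"
  have c: "0 < c" "c < 1" using e by (auto simp: c_def)
  define D :: "real^('m + 'n) \<Rightarrow> real^('m + 'n)" where
    "D x = (\<chi> k. case k of Inl i \<Rightarrow> (1 + e) powr (\<alpha>$i) * x $ k | Inr j \<Rightarrow> x $ k)" for x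
  have Dx: "\<nu> (D x) < r" if "\<nu> x \<le> r - \<epsilon>" for x
  proof -
    have "norm (D x - x) \<le> norm (e *\<^sub>R x)"
    proof (rule norm_le_componentwise_cart)
      fix k
      show "norm ((D x - x) $ k) \<le> norm ((e *\<^sub>R x) $ k)"
      proof (cases k)
        case (Inl i)
        have a: "0 < \<alpha>$i" "\<alpha>$i \<le> 1" using weight_vectorD(1,3)[OF w] by auto
        have "1 \<le> (1 + e) powr (\<alpha>$i)" using e a by (intro ge_one_powr_ge_zero) auto
        moreover have "(1 + e) powr (\<alpha>$i) \<le> (1 + e) powr 1" using e a by (intro powr_mono) auto
        ultimately have "\<bar>(1 + e) powr (\<alpha>$i) - 1\<bar> \<le> e" using e by simp
        then have "\<bar>(1 + e) powr (\<alpha>$i) - 1\<bar> * \<bar>x $ k\<bar> \<le> e * \<bar>x $ k\<bar>" by (rule mult_right_mono) simp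
        then show ?thesis using e by (simp add: D_def Inl left_diff_distrib flip: abs_mult)
      qed (simp add: D_def)
    qed
    also have "\<dots> = e * norm x" using e by simp
    finally have "\<nu> (D x - x) \<le> C * (e * norm x)" using C by (meson mult_left_mono order_trans less_imp_le)
    also have "\<dots> \<le> C * (e * (r / c0))"
    proof (intro mult_left_mono)
      have "c0 * norm x \<le> r" using c0(2)[of x] that \<epsilon> by linarith
      then show "norm x \<le> r / c0" using c0 by (simp add: field_simps)
    qed (use C e in auto)
    also have "\<dots> = \<epsilon> / 2" using C c0 r by (simp add: e_def)
    finally have "\<nu> (D x) \<le> \<nu> x + \<epsilon> / 2" using is_norm_diff[OF \<nu>, of "D x" x] by linarith
    then show ?thesis using that \<epsilon> by linarith
  qed
  have "\<forall>\<^sub>F t in at_top. \<exists>z\<in>int_vectors. z \<noteq> 0 \<and> \<nu> (flow \<alpha> \<beta> (ln t) A *v z) \<le> r - \<epsilon>"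
    using eventually_compose_filterlim[OF ev ln_at_top] unfolding r_def .
  then have "\<forall>\<^sub>F t in at_top. matrix_lattice A \<inter>
     (\<lambda>x. block_matrix (diag_powr (c * (1 / t)) \<alpha>) 0 0 (diag_powr t \<beta>) *v x) ` norm_ball \<nu> r \<noteq> {0}"
    using eventually_gt_at_top[of 0]
  proof eventually_elim
    case (elim t)
    obtain z where z: "z \<in> int_vectors" "z \<noteq> 0" "\<nu> (flow \<alpha> \<beta> (ln t) A *v z) \<le> r - \<epsilon>" using elim(1) by blast
    define y where "y = block_matrix (mat 1) A 0 (mat 1) *v z"
    have yl: "y $ Inl i = z $ Inl i + (\<Sum>j\<in>UNIV. A$i$j * z $ Inr j)" for i
    proof -
      have "(\<Sum>b\<in>UNIV. mat 1 $ i $ b * z $ Inl b) = (mat 1 *v (\<chi> b. z $ Inl b)) $ i"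
        by (simp add: matrix_vector_mult_def)
      also have "\<dots> = z $ Inl i" by simp
      finally show ?thesis by (simp add: y_def matrix_vector_mult_def block_matrix_def sum_UNIV_Plus)
    qed
    have yr: "y $ Inr j = z $ Inr j" for j
    proof -
      have "(\<Sum>b\<in>UNIV. mat 1 $ j $ b * z $ Inr b) = (mat 1 *v (\<chi> b. z $ Inr b)) $ j"
        by (simp add: matrix_vector_mult_def)
      also have "\<dots> = z $ Inr j" by simp
      finally show ?thesis by (simp add: y_def matrix_vector_mult_def block_matrix_def sum_UNIV_Plus)
    qed
    define x where "x = D (flow \<alpha> \<beta> (ln t) A *v z)"
    have "y = block_matrix (diag_powr (c * (1 / t)) \<alpha>) 0 0 (diag_powr t \<beta>) *v x"
      unfolding vec_eq_Plus_iff
    proof (intro conjI allI)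
      fix i
      have "(block_matrix (diag_powr (c * (1 / t)) \<alpha>) 0 0 (diag_powr t \<beta>) *v x) $ Inl i =
          (\<Sum>b\<in>UNIV. (if i = b then (c * (1/t)) powr (\<alpha>$i) else 0) * x $ Inl b)"
        by (simp add: matrix_vector_mult_def block_matrix_def sum_UNIV_Plus diag_powr_def del: times_divide_eq_right)
      also have "\<dots> = (\<Sum>b\<in>UNIV. if b = i then (c * (1/t)) powr (\<alpha>$i) * x $ Inl i else 0)"
        by (rule sum.cong) auto
      also have "\<dots> = (c * (1/t)) powr (\<alpha>$i) * ((1 + e) powr (\<alpha>$i) * (exp (ln t * \<alpha>$i) * y $ Inl i))"
        by (simp add: x_def D_def flow_Inl yl)
      also have "exp (ln t * \<alpha>$i) = t powr (\<alpha>$i)" using elim(2) by (simp add: powr_def mult.commute)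
      also have "(c * (1/t)) powr (\<alpha>$i) * ((1 + e) powr (\<alpha>$i) * (t powr (\<alpha>$i) * y $ Inl i)) =
          ((c * (1/t)) * (1 + e) * t) powr (\<alpha>$i) * y $ Inl i"
        using elim(2) c e powr_mult[of "c * (1/t) * (1 + e)" t "\<alpha>$i"] powr_mult[of "c * (1/t)" "1 + e" "\<alpha>$i"]
        by (simp del: times_divide_eq_right)
      also have "(c * (1/t)) * (1 + e) * t = 1" using elim(2) e by (simp add: c_def)
      finally show "y $ Inl i = (block_matrix (diag_powr (c * (1 / t)) \<alpha>) 0 0 (diag_powr t \<beta>) *v x) $ Inl i" by simp
    next
      fix j
      have "(block_matrix (diag_powr (c * (1 / t)) \<alpha>) 0 0 (diag_powr t \<beta>) *v x) $ Inr j =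
          (\<Sum>b\<in>UNIV. (if j = b then t powr (\<beta>$j) else 0) * x $ Inr b)"
        by (simp add: matrix_vector_mult_def block_matrix_def sum_UNIV_Plus diag_powr_def)
      also have "\<dots> = (\<Sum>b\<in>UNIV. if b = j then t powr (\<beta>$j) * x $ Inr j else 0)"
        by (rule sum.cong) auto
      also have "\<dots> = t powr (\<beta>$j) * (exp (- ln t * \<beta>$j) * y $ Inr j)"
        by (simp add: x_def D_def flow_Inr yr)
      also have "\<dots> = y $ Inr j" using elim(2) by (simp add: powr_def mult.assoc[symmetric] flip: exp_add)
      finally show "y $ Inr j = (block_matrix (diag_powr (c * (1 / t)) \<alpha>) 0 0 (diag_powr t \<beta>) *v x) $ Inr j" by simp
    qed
    moreover have "x \<in> norm_ball \<nu> r" unfolding x_def norm_ball_def using Dx[OF z(3)] by simp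
    moreover have "y \<in> matrix_lattice A" unfolding matrix_lattice_def y_def using z(1) by blast
    moreover have "y \<noteq> 0"
    proof
      assume "y = 0"
      then have "z $ Inr j = 0" "z $ Inl i = 0" for i j using yl[of i] yr[of j] yr by (auto simp: yr[symmetric])
      then show False using z(2) by (simp add: vec_eq_Plus_iff)
    qed
    ultimately show ?case by blast
  qed
  then have "A \<in> dirichlet_set \<nu> \<alpha> \<beta> (\<lambda>t. c * (1 / t))" unfolding dirichlet_set_def r_def by simp
  then show ?thesis unfolding DI_def using c by auto
qed

section \<open>Cells that meet the critical locus\<close>

definition hit_cells :: "(real^('m + 'n) \<Rightarrow> real) \<Rightarrow> real^'m \<Rightarrow> real^'n \<Rightarrow> real \<Rightarrow> real^('m + 'n)^('m + 'n) \<Rightarrow> ('m \<times> 'n \<Rightarrow> nat) set" where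
  "hit_cells \<nu> \<alpha> \<beta> T h = {c\<in>cells (rate \<alpha> \<beta>) T. \<exists>b\<in>wbox (rate \<alpha> \<beta>) T (child (rate \<alpha> \<beta>) T 0 c). \<exists>s\<in>{-T..0}.
     adm \<nu> (flow \<alpha> \<beta> s b ** h) (critical_radius \<nu>)}"

lemma unit_cell:
  assumes c: "c \<in> cells w T" and b: "b \<in> wbox w T (child w T 0 c)"
  shows "0 \<le> b$i$j" "b$i$j \<le> 1"
proof -
  have 1: "real (c (i,j)) * exp (- T * w (i,j)) \<le> b$i$j"
    "b$i$j \<le> real (c (i,j)) * exp (- T * w (i,j)) + exp (- T * w (i,j))"
    using b unfolding wbox_def child_def by auto
  show "0 \<le> b$i$j" using 1(1) by (rule order_trans[rotated]) simp
  have "(real (c (i,j)) + 1) * exp (- T * w (i,j)) \<le> 1"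
    using cells_step[OF c, of "(i,j)" 0] by simp
  then show "b$i$j \<le> 1" using 1(2) by (simp add: distrib_right)
qed

text \<open>A cell of the box of \<open>A\<close> at time \<open>s\<close> becomes a cell of the
  unit box in the parameter \<open>b\<close>, so counting cells becomes a question about the lattice
  \<open>flow \<alpha> \<beta> s A\<close> alone.\<close>

lemma rescale_cell:
  assumes "X \<in> wbox (rate \<alpha> \<beta>) (s + T) (child (rate \<alpha> \<beta>) (s + T) A c)"
  obtains b where "X = A + shrink \<alpha> \<beta> s b" "b \<in> wbox (rate \<alpha> \<beta>) T (child (rate \<alpha> \<beta>) T 0 c)"
proof -
  define b where "b = (\<chi> i j. exp (s * (\<alpha>$i + \<beta>$j)) * (X$i$j - A$i$j))"
  have "X = A + shrink \<alpha> \<beta> s b"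
    by (simp add: vec_eq_iff b_def shrink_def mult.assoc[symmetric] flip: exp_add)
  moreover have "b \<in> wbox (rate \<alpha> \<beta>) T (child (rate \<alpha> \<beta>) T 0 c)"
  proof -
    have "real (c (i,j)) * exp (- T * (\<alpha>$i + \<beta>$j)) \<le> b$i$j \<and>
        b$i$j \<le> real (c (i,j)) * exp (- T * (\<alpha>$i + \<beta>$j)) + exp (- T * (\<alpha>$i + \<beta>$j))" for i j
    proof -
      define W where "W = \<alpha>$i + \<beta>$j"
      define q where "q = exp (- (s + T) * W)"
      have X: "real (c (i,j)) * q \<le> X$i$j - A$i$j" "X$i$j - A$i$j \<le> real (c (i,j)) * q + q"
        using assms by (auto simp: wbox_def child_def rate_def W_def q_def algebra_simps)
      have eq: "exp (- T * W) = exp (s * W) * q" by (simp add: q_def algebra_simps flip: exp_add)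
      have "exp (s * W) * (real (c (i,j)) * q) \<le> exp (s * W) * (X$i$j - A$i$j)"
        "exp (s * W) * (X$i$j - A$i$j) \<le> exp (s * W) * (real (c (i,j)) * q + q)"
        by (intro mult_left_mono X; simp)+
      then show ?thesis unfolding W_def[symmetric] eq b_def by (simp add: W_def algebra_simps)
    qed
    then show ?thesis by (simp add: wbox_def child_def rate_def)
  qed
  ultimately show ?thesis by (rule that)
qed

text \<open>Flowing for a bounded time with a bounded parameter lengthens vectors by a bounded
  factor. So a lower bound at a nearby point of the orbit becomes one for the starting lattice, in
  the form that Mahler's criterion takes.\<close>

lemma adm_of_adm_flow:
  fixes \<alpha> :: "real^'m" and \<beta> :: "real^'n" and \<nu> :: "real^('m + 'n) \<Rightarrow> real"
  assumes w: "weight_vector \<alpha> \<beta>" and \<nu>: "is_norm \<nu>"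
  obtains \<kappa> where "\<kappa> > 0" "\<And>\<sigma> b x q. \<bar>\<sigma>\<bar> \<le> T \<Longrightarrow> (\<And>i j. \<bar>b$i$j\<bar> \<le> 1) \<Longrightarrow>
    adm \<nu> (flow \<alpha> \<beta> \<sigma> b ** x) q \<Longrightarrow> adm norm x (\<kappa> * q)"
proof -
  obtain C where C: "C > 0" "\<And>x. \<nu> x \<le> C * norm x" using is_norm_upper[OF \<nu>] by blast
  define K where "K = (real CARD('m) * (1 + real CARD('n)) + real CARD('n)) * exp T"
  have K: "K > 0" unfolding K_def by (intro mult_pos_pos add_nonneg_pos) auto
  show ?thesis
  proof (rule that[of "1 / (C * K)"])
    show "1 / (C * K) > 0" using C K by simp
    fix \<sigma> x q and b :: "real^'n^'m"
    assume \<sigma>: "\<bar>\<sigma>\<bar> \<le> T" and b: "\<And>i j. \<bar>b$i$j\<bar> \<le> 1" and a: "adm \<nu> (flow \<alpha> \<beta> \<sigma> b ** x) q"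
    show "adm norm x (1 / (C * K) * q)" unfolding adm_def
    proof (intro ballI impI)
      fix z assume z: "z \<in> int_vectors" "z \<noteq> (0::real^('m + 'n))"
      have "q \<le> \<nu> (flow \<alpha> \<beta> \<sigma> b *v (x *v z))"
        using a z unfolding adm_def by (auto simp: matrix_vector_mul_assoc)
      also have "\<dots> \<le> C * norm (flow \<alpha> \<beta> \<sigma> b *v (x *v z))" by (rule C)
      also have "\<dots> \<le> C * (K * norm (x *v z))" unfolding K_def
        using C by (intro mult_left_mono norm_flow_le[OF w \<sigma> b]) auto
      finally show "1 / (C * K) * q \<le> norm (x *v z)" using C K by (simp add: divide_le_eq mult_ac)
    qed
  qed
qed

text \<open>If no \<open>\<epsilon>\<close> worked, Mahler compactness would produce a limit lattice with more than \<open>n\<close> hit cells.\<close>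

lemma uniform_gap:
  fixes \<alpha> :: "real^'m" and \<beta> :: "real^'n" and \<nu> :: "real^('m + 'n) \<Rightarrow> real"
    and Y :: "((real^'n^'m) \<times> real) set"
  assumes w: "weight_vector \<alpha> \<beta>" and \<nu>: "is_norm \<nu>" and T: "T > 0"
    and count: "\<And>h. h \<in> closure {flow \<alpha> \<beta> s A ** g |A s g. (A, s) \<in> Y \<and> unim g} \<Longrightarrow> \<bar>det h\<bar> = 1 \<Longrightarrow>
       card (hit_cells \<nu> \<alpha> \<beta> T h) \<le> n"
  shows "\<exists>\<epsilon>>0. \<forall>A s. (A, s) \<in> Y \<longrightarrow>
    card {c\<in>cells (rate \<alpha> \<beta>) T. \<exists>X\<in>wbox (rate \<alpha> \<beta>) (s + T) (child (rate \<alpha> \<beta>) (s + T) A c). \<exists>s'\<in>{s - T..s}.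
       adm \<nu> (flow \<alpha> \<beta> s' X) (critical_radius \<nu> - \<epsilon>)} \<le> n"
proof (rule ccontr)
  define W where "W = rate \<alpha> \<beta>"
  define r where "r = critical_radius \<nu>"
  have r: "r > 0" unfolding r_def by (rule critical_radius_pos[OF \<nu>])
  define bad where "bad \<epsilon> A s = {c\<in>cells W T. \<exists>X\<in>wbox W (s + T) (child W (s + T) A c). \<exists>s'\<in>{s - T..s}.
       adm \<nu> (flow \<alpha> \<beta> s' X) (r - \<epsilon>)}" for \<epsilon> A s
  assume "\<not> ?thesis"
  then have neg: "\<And>\<epsilon>. \<epsilon> > 0 \<Longrightarrow> \<exists>A s. (A, s) \<in> Y \<and> n < card (bad \<epsilon> A s)"
    unfolding bad_def W_def r_def not_le[symmetric] by blast
  \<comment> \<open>Tends to 0 but stays at most \<open>r / 2\<close>, so that Mahler's criterion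
    applies with one radius for all \<open>k\<close>.\<close>
  define e where "e k = r / (real k + 2)" for k :: nat
  have e: "e k > 0" "e k \<le> r / 2" for k using r by (auto simp: e_def field_simps)
  have elim: "e \<longlonglongrightarrow> 0"
  proof -
    have "(\<lambda>k. r / real (k + 2)) \<longlonglongrightarrow> 0" by (rule LIMSEQ_ignore_initial_segment[OF lim_const_over_n])
    then show ?thesis by (simp add: e_def[abs_def] add.commute)
  qed
  have "\<forall>k. \<exists>p. (fst p, snd p) \<in> Y \<and> n < card (bad (e k) (fst p) (snd p))" using neg e(1) by simp
  then obtain p where p: "\<And>k. (fst (p k), snd (p k)) \<in> Y" "\<And>k. n < card (bad (e k) (fst (p k)) (snd (p k)))"
    by metis
  define A where "A k = fst (p k)" for k
  define s where "s k = snd (p k)" for k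
  define J where "J k = bad (e k) (A k) (s k)" for k
  have Y: "(A k, s k) \<in> Y" and J: "n < card (J k)" for k using p by (auto simp: A_def s_def J_def)
  define x where "x k = flow \<alpha> \<beta> (s k) (A k)" for k
  have detx: "\<bar>det (x k)\<bar> = 1" for k unfolding x_def det_flow[OF w] by simp
  have Jb: "\<exists>b\<in>wbox W T (child W T 0 c). \<exists>\<sigma>\<in>{-T..0}. adm \<nu> (flow \<alpha> \<beta> \<sigma> b ** x k) (r - e k)" if "c \<in> J k" for c k
  proof -
    obtain X s' where X: "X \<in> wbox W (s k + T) (child W (s k + T) (A k) c)" "s' \<in> {s k - T..s k}"
      "adm \<nu> (flow \<alpha> \<beta> s' X) (r - e k)" using \<open>c \<in> J k\<close> unfolding J_def bad_def by blast
    obtain b where b: "X = A k + shrink \<alpha> \<beta> (s k) b" "b \<in> wbox W T (child W T 0 c)"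
      using rescale_cell X(1) unfolding W_def by blast
    have "adm \<nu> (flow \<alpha> \<beta> (s' - s k) b ** x k) (r - e k)" using X(3) flow_conj[OF b(1)] by (simp add: x_def)
    then show ?thesis using b(2) X(2) by (intro bexI[of _ b] bexI[of _ "s' - s k"]) auto
  qed
  obtain \<kappa> where \<kappa>: "\<kappa> > 0" "\<And>\<sigma> b x q. \<bar>\<sigma>\<bar> \<le> T \<Longrightarrow> (\<And>i j. \<bar>b$i$j\<bar> \<le> 1) \<Longrightarrow>
    adm \<nu> (flow \<alpha> \<beta> \<sigma> b ** x) q \<Longrightarrow> adm norm x (\<kappa> * q)"
    using adm_of_adm_flow[OF w \<nu>] by blast
  define \<rho> where "\<rho> = \<kappa> * (r / 2)"
  have \<rho>: "\<rho> > 0" using r \<kappa> by (simp add: \<rho>_def)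
  have admx: "adm norm (x k) \<rho>" for k
  proof -
    have "J k \<noteq> {}" using J[of k] by auto
    then obtain c where c: "c \<in> J k" by blast
    obtain b \<sigma> where b: "b \<in> wbox W T (child W T 0 c)" "\<sigma> \<in> {-T..0}" "adm \<nu> (flow \<alpha> \<beta> \<sigma> b ** x k) (r - e k)"
      using Jb[OF c] by blast
    have cc: "c \<in> cells W T" using c unfolding J_def bad_def by auto
    have "adm norm (x k) (\<kappa> * (r - e k))"
      by (rule \<kappa>(2)[OF _ _ b(3)]) (use b(2) unit_cell[OF cc b(1)] in \<open>auto simp: abs_le_iff intro: order_trans[of _ 0]\<close>)
    moreover have "\<rho> \<le> \<kappa> * (r - e k)" unfolding \<rho>_def using e(2)[of k] \<kappa>(1) by (intro mult_left_mono) auto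
    ultimately show ?thesis unfolding adm_def by (meson order_trans)
  qed
  obtain B where B: "\<And>y::real^('m + 'n)^('m + 'n). \<bar>det y\<bar> = 1 \<Longrightarrow> adm norm y \<rho> \<Longrightarrow> \<exists>g. unim g \<and> norm (y ** g) \<le> B"
    using mahler_bounded_representative[OF \<rho>] by blast
  have "\<forall>k. \<exists>g. unim g \<and> norm (x k ** g) \<le> B" using B detx admx by blast
  then obtain g where g: "\<And>k. unim (g k)" "\<And>k. norm (x k ** g k) \<le> B" by metis
  define h where "h k = x k ** g k" for k
  have "\<forall>k. h k \<in> {h. \<bar>det h\<bar> = 1 \<and> norm h \<le> B}"
    using detx det_unim[OF g(1)] g(2) by (simp add: h_def det_mul abs_mult)
  then obtain H r1 where H: "H \<in> {h. \<bar>det h\<bar> = 1 \<and> norm h \<le> B}" "strict_mono r1" "(h \<circ> r1) \<longlonglongrightarrow> H"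
    using compact_unit_det[of B] unfolding compact_def by blast
  \<comment> \<open>There are finitely many sets of cells, so \<open>J\<close> is constant along a
    subsequence, and the limit lattice has to hit every cell of this one set.\<close>
  have "finite (range (J \<circ> r1))"
    by (rule finite_subset[of _ "Pow (cells W T)"]) (auto simp: J_def bad_def)
  then obtain k0 where "infinite {k. (J \<circ> r1) k = (J \<circ> r1) k0}"
    using pigeonhole_infinite[of "UNIV::nat set" "J \<circ> r1"] by auto
  then obtain r2 :: "nat \<Rightarrow> nat" where r2: "strict_mono r2" "\<And>k. r2 k \<in> {k. (J \<circ> r1) k = (J \<circ> r1) k0}"
    using infinite_enumerate by blast
  define q where "q = r1 \<circ> r2"
  have q: "strict_mono q" unfolding q_def using H(2) r2(1) by (rule strict_mono_o)
  define J0 where "J0 = J (r1 k0)"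
  have Jq: "J (q k) = J0" for k using r2(2)[of k] by (simp add: q_def J0_def)
  have hq: "(\<lambda>k. h (q k)) \<longlonglongrightarrow> H"
    using LIMSEQ_subseq_LIMSEQ[OF H(3) r2(1)] by (simp add: q_def comp_def)
  have eq: "(\<lambda>k. e (q k)) \<longlonglongrightarrow> 0"
    using LIMSEQ_subseq_LIMSEQ[OF elim q] by (simp add: comp_def)
  have "J0 \<subseteq> hit_cells \<nu> \<alpha> \<beta> T H"
  proof
    fix c assume c: "c \<in> J0"
    have cc: "c \<in> cells W T" using c unfolding J0_def J_def bad_def by auto
    have "\<forall>k. \<exists>p. fst p \<in> wbox W T (child W T 0 c) \<and> snd p \<in> {-T..0} \<and> adm \<nu> (flow \<alpha> \<beta> (snd p) (fst p) ** x (q k)) (r - e (q k))"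
    proof
      fix k
      have "c \<in> J (q k)" using c Jq by simp
      from Jb[OF this] show "\<exists>p. fst p \<in> wbox W T (child W T 0 c) \<and> snd p \<in> {-T..0} \<and>
        adm \<nu> (flow \<alpha> \<beta> (snd p) (fst p) ** x (q k)) (r - e (q k))" by force
    qed
    then obtain P where P: "\<And>k. fst (P k) \<in> wbox W T (child W T 0 c)" "\<And>k. snd (P k) \<in> {-T..0}"
      "\<And>k. adm \<nu> (flow \<alpha> \<beta> (snd (P k)) (fst (P k)) ** x (q k)) (r - e (q k))" by metis
    have "compact (wbox W T (child W T 0 c) \<times> {-T..0})" by (intro compact_Times compact_wbox) auto
    moreover have "\<forall>k. P k \<in> wbox W T (child W T 0 c) \<times> {-T..0}" using P by (auto simp: mem_Times_iff)
    ultimately obtain L r3 where L: "L \<in> wbox W T (child W T 0 c) \<times> {-T..0}" "strict_mono r3" "(P \<circ> r3) \<longlonglongrightarrow> L"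
      unfolding compact_def by blast
    have Lb: "(\<lambda>k. fst (P (r3 k))) \<longlonglongrightarrow> fst L" and Ls: "(\<lambda>k. snd (P (r3 k))) \<longlonglongrightarrow> snd L"
      using tendsto_fst[OF L(3)] tendsto_snd[OF L(3)] by (auto simp: comp_def)
    have hL: "(\<lambda>k. h (q (r3 k))) \<longlonglongrightarrow> H" using LIMSEQ_subseq_LIMSEQ[OF hq L(2)] by (simp add: comp_def)
    have eL: "(\<lambda>k. e (q (r3 k))) \<longlonglongrightarrow> 0" using LIMSEQ_subseq_LIMSEQ[OF eq L(2)] by (simp add: comp_def)
    have "adm \<nu> (flow \<alpha> \<beta> (snd L) (fst L) ** H) r" unfolding adm_def
    proof (intro ballI impI)
      fix z assume z: "z \<in> int_vectors" "z \<noteq> (0::real^('m + 'n))"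
      have "(\<lambda>k. flow \<alpha> \<beta> (snd (P (r3 k))) (fst (P (r3 k))) *v (h (q (r3 k)) *v z)) \<longlonglongrightarrow> flow \<alpha> \<beta> (snd L) (fst L) *v (H *v z)"
        by (rule tendsto_flow[OF Ls Lb hL])
      then have lim: "(\<lambda>k. \<nu> (flow \<alpha> \<beta> (snd (P (r3 k))) (fst (P (r3 k))) *v (h (q (r3 k)) *v z))) \<longlonglongrightarrow> \<nu> (flow \<alpha> \<beta> (snd L) (fst L) *v (H *v z))"
        by (rule continuous_on_tendsto_compose[OF is_norm_continuous[OF \<nu>, of UNIV]]) auto
      have lim2: "(\<lambda>k. r - e (q (r3 k))) \<longlonglongrightarrow> r - 0" by (intro tendsto_diff tendsto_const eL)
      have "r - 0 \<le> \<nu> (flow \<alpha> \<beta> (snd L) (fst L) *v (H *v z))"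
      proof (rule LIMSEQ_le[OF lim2 lim], intro exI[of _ 0] allI impI)
        fix k
        have "adm \<nu> (flow \<alpha> \<beta> (snd (P (r3 k))) (fst (P (r3 k))) ** x (q (r3 k)) ** g (q (r3 k))) (r - e (q (r3 k)))"
          using P(3) adm_unim[OF g(1)] by blast
        then have "r - e (q (r3 k)) \<le> \<nu> ((flow \<alpha> \<beta> (snd (P (r3 k))) (fst (P (r3 k))) ** x (q (r3 k)) ** g (q (r3 k))) *v z)"
          using z unfolding adm_def by blast
        also have "(flow \<alpha> \<beta> (snd (P (r3 k))) (fst (P (r3 k))) ** x (q (r3 k)) ** g (q (r3 k))) *v z =
            flow \<alpha> \<beta> (snd (P (r3 k))) (fst (P (r3 k))) *v (h (q (r3 k)) *v z)"
          by (simp add: h_def matrix_vector_mul_assoc matrix_mul_assoc)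
        finally show "r - e (q (r3 k)) \<le> \<nu> (flow \<alpha> \<beta> (snd (P (r3 k))) (fst (P (r3 k))) *v (h (q (r3 k)) *v z))" .
      qed
      then show "r \<le> \<nu> ((flow \<alpha> \<beta> (snd L) (fst L) ** H) *v z)" by (simp add: matrix_vector_mul_assoc)
    qed
    then show "c \<in> hit_cells \<nu> \<alpha> \<beta> T H" unfolding hit_cells_def W_def[symmetric] r_def[symmetric]
      using cc L(1) by (auto simp: mem_Times_iff intro!: bexI[of _ "fst L"] bexI[of _ "snd L"])
  qed
  moreover have "finite (hit_cells \<nu> \<alpha> \<beta> T H)" unfolding hit_cells_def by simp
  ultimately have "card J0 \<le> card (hit_cells \<nu> \<alpha> \<beta> T H)" by (intro card_mono)
  also have "\<dots> \<le> n"
  proof (rule count)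
    show "H \<in> closure {flow \<alpha> \<beta> s A ** g |A s g. (A, s) \<in> Y \<and> unim g}"
      unfolding closure_sequential
    proof (intro exI conjI allI)
      show "(\<lambda>k. h (q k)) \<longlonglongrightarrow> H" by (rule hq)
      show "h (q k) \<in> {flow \<alpha> \<beta> s A ** g |A s g. (A, s) \<in> Y \<and> unim g}" for k
        unfolding h_def x_def using Y g(1) by blast
    qed
  qed (use H in auto)
  finally show False using J[of "r1 k0"] by (simp add: J0_def)
qed

section \<open>A criterion for thickness\<close>

lemma hausdorff_measure_mono:
  assumes "E \<subseteq> F"
  shows "hausdorff_measure s E \<le> hausdorff_measure s F"
  unfolding hausdorff_measure_def
proof (rule SUP_mono)
  fix \<delta> :: real assume "\<delta> \<in> {0<..}"
  moreover have "delta_covers \<delta> F \<subseteq> delta_covers \<delta> E" using assms unfolding delta_covers_def by auto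
  then have "(INF U\<in>delta_covers \<delta> E. \<Sum>i. diam_pow s (U i)) \<le> (INF U\<in>delta_covers \<delta> F. \<Sum>i. diam_pow s (U i))"
    by (rule INF_superset_mono) auto
  ultimately show "\<exists>m\<in>{0<..}. (INF U\<in>delta_covers \<delta> E. \<Sum>i. diam_pow s (U i)) \<le> (INF U\<in>delta_covers m F. \<Sum>i. diam_pow s (U i))"
    by blast
qed

lemma card_cells_ge:
  fixes w :: "'m::finite \<times> 'n::finite \<Rightarrow> real"
  assumes "T > 0" "\<And>l. 0 \<le> w l"
  shows "exp (T * (\<Sum>l\<in>UNIV. w l)) \<le> 2 ^ (CARD('m) * CARD('n)) * real (card (cells w T))"
proof -
  have "exp (T * (\<Sum>l\<in>UNIV. w l)) = (\<Prod>l\<in>UNIV. exp (T * w l))"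
    by (simp add: exp_sum sum_distrib_left)
  also have "\<dots> \<le> (\<Prod>l\<in>UNIV. 2 * real (nat \<lfloor>exp (T * w l)\<rfloor>))"
  proof (rule prod_mono, safe)
    fix l
    show "exp (T * w l) \<le> 2 * real (nat \<lfloor>exp (T * w l)\<rfloor>)" using floor_exp_ge_half[of "T * w l"] assms by simp
  qed simp
  also have "\<dots> = 2 ^ card (UNIV :: ('m \<times> 'n) set) * real (card (cells w T))"
    by (simp only: prod.distrib prod_constant card_cells of_nat_prod)
  also have "card (UNIV :: ('m \<times> 'n) set) = CARD('m) * CARD('n)" by simp
  finally show ?thesis .
qed

text \<open>If half of the children of a good matrix are good, choosing exactly \<open>P\<close> of
  them gives a \<open>box_tree\<close>. The ratio \<open>\<Theta>\<close> is a power of 2: one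
  factor per entry from rounding, and one for the discarded half.\<close>

lemma good_tree_measure:
  fixes w :: "'m::finite \<times> 'n::finite \<Rightarrow> real" and good :: "nat \<Rightarrow> real^'n^'m \<Rightarrow> bool"
  assumes T: "T > 0" and s0: "s0 \<ge> 0" and w0: "w0 > 0" "\<And>l. w0 \<le> w l" and root: "good 0 A0"
    and step: "\<And>k A. good k A \<Longrightarrow>
      card (cells w T) \<le> 2 * card {c\<in>cells w T. good (Suc k) (child w (s0 + real (Suc k) * T) A c)}"
    and s: "0 \<le> s" "s < real (CARD('m) * CARD('n)) - ln (2 ^ (CARD('m) * CARD('n) + 1)) / (T * w0)"
  shows "hausdorff_measure s {X. \<forall>k. \<exists>A. good k A \<and> X \<in> wbox w (s0 + real k * T) A} \<noteq> 0"
proof -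
  define P where "P = (card (cells w T) + 1) div 2"
  have wp: "0 \<le> w l" for l using w0(1) w0(2)[of l] by linarith
  have "0 < exp (T * (\<Sum>l\<in>UNIV. w l))" by simp
  also note card_cells_ge[of T w, OF T wp]
  finally have "card (cells w T) > 0" by (simp add: zero_less_mult_iff)
  then have P: "P > 0" by (simp add: P_def)
  \<comment> \<open>For matrices that are not good all cells are kept, since \<open>box_tree\<close>
    wants \<open>P\<close> children everywhere.\<close>
  define G where "G k A = (if good k A then {c\<in>cells w T. good (Suc k) (child w (s0 + real (Suc k) * T) A c)} else cells w T)" for k A
  have G: "G k A \<subseteq> cells w T" for k A by (auto simp: G_def)
  have "P \<le> card (G k A)" for k A using step[of k A] by (auto simp: G_def P_def)
  then have "\<exists>C. C \<subseteq> G k A \<and> card C = P" for k A by (meson obtain_subset_with_card_n)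
  then obtain ch where ch: "\<And>k A. ch k A \<subseteq> G k A" "\<And>k A. card (ch k A) = P" by metis
  interpret box_tree w T s0 ch A0 P
    by unfold_locales (use T s0 P ch(2) order_trans[OF ch(1) G] in auto)
  have gn: "good k A" if "A \<in> node k" for k A
    using that
  proof (induction k arbitrary: A)
    case (Suc k)
    then obtain B c where B: "B \<in> node k" "c \<in> ch k B" "A = child w (lev (Suc k)) B c" by auto
    have "c \<in> G k B" using B(2) ch(1) by blast
    then show ?case using Suc.IH[OF B(1)] B(3) by (simp add: G_def lev_def)
  qed (simp add: root)
  have "hausdorff_measure s limset \<noteq> 0"
  proof (rule limset_measure[OF _ _ w0 s])
    have "real (card (cells w T)) \<le> 2 * real P" unfolding P_def by linarith
    then have "2 ^ (CARD('m) * CARD('n)) * real (card (cells w T)) \<le> 2 ^ (CARD('m) * CARD('n)) * (2 * real P)"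
      by (intro mult_left_mono) auto
    then show "exp (T * (\<Sum>l\<in>UNIV. w l)) \<le> 2 ^ (CARD('m) * CARD('n) + 1) * real P"
      using order_trans[OF card_cells_ge[of T w, OF T wp]] by (simp add: mult_ac)
  qed (rule one_le_power, simp)
  moreover have "limset \<subseteq> {X. \<forall>k. \<exists>A. good k A \<and> X \<in> wbox w (s0 + real k * T) A}"
    unfolding limset_def lev_def using gn by blast
  then have "hausdorff_measure s limset \<le> hausdorff_measure s {X. \<forall>k. \<exists>A. good k A \<and> X \<in> wbox w (s0 + real k * T) A}"
    by (rule hausdorff_measure_mono)
  ultimately show ?thesis by auto
qed

lemma dist_wbox_le:
  fixes A X :: "real^'n^'m"
  assumes "X \<in> wbox w s A" "\<And>l. w0 \<le> w l" "s \<ge> 0"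
  shows "dist A X \<le> real (CARD('m) * CARD('n)) * exp (- s * w0)"
proof (rule dist_mat_le)
  fix i j
  have "A$i$j \<le> X$i$j" "X$i$j \<le> A$i$j + exp (- s * w (i,j))" using assms(1) unfolding wbox_def by auto
  moreover have "exp (- s * w (i,j)) \<le> exp (- s * w0)" using assms(2)[of "(i,j)"] assms(3) by (simp add: mult_left_mono)
  ultimately show "\<bar>A$i$j - X$i$j\<bar> \<le> exp (- s * w0)" by linarith
qed

text \<open>\<open>Pr\<close> is a property kept along the tree at the cost of a quarter of the
  children, and \<open>Y\<close> is what its history implies from level \<open>K0\<close> on;
  another quarter may hit the critical locus. The hits are counted for the closure of the lattices
  from \<open>Y\<close> because \<open>uniform_gap\<close> passes to limits. All choices may depend
  on the root and on the lower bound \<open>T0\<close>, which makes the loss of dimension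
  small.\<close>

lemma thick_DI_criterion:
  fixes \<alpha> :: "real^'m" and \<beta> :: "real^'n" and \<nu> :: "real^('m + 'n) \<Rightarrow> real"
  defines "W \<equiv> rate \<alpha> \<beta>"
  assumes w: "weight_vector \<alpha> \<beta>" and \<nu>: "is_norm \<nu>"
    and H: "\<And>A0 s0 T0. s0 \<ge> 0 \<Longrightarrow> \<exists>T Pr Y K0. T \<ge> T0 \<and> T > 0 \<and> Pr A0 s0 \<and>
      (\<forall>k A. K0 \<le> k \<longrightarrow> (\<forall>j\<le>k. \<exists>B. Pr B (s0 + real j * T) \<and> A \<in> wbox W (s0 + real j * T) B) \<longrightarrow> (A, s0 + real k * T) \<in> Y) \<and>
      (\<forall>A s. Pr A s \<longrightarrow> 4 * card {c\<in>cells W T. \<not> Pr (child W (s + T) A c) (s + T)} \<le> card (cells W T)) \<and>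
      (\<forall>h \<in> closure {flow \<alpha> \<beta> s A ** g |A s g. (A, s) \<in> Y \<and> unim g}. \<bar>det h\<bar> = 1 \<longrightarrow>
         4 * card (hit_cells \<nu> \<alpha> \<beta> T h) \<le> card (cells W T))"
  shows "thick (DI \<nu> \<alpha> \<beta>)"
proof (rule thickI)
  fix U :: "(real^'n^'m) set" and s :: real
  assume U: "open U" "U \<noteq> {}" and s: "0 \<le> s" "s < real (CARD('m) * CARD('n))"
  define D where "D = CARD('m) * CARD('n)"
  define w0 where "w0 = Min (range W)"
  have "w0 \<in> range W" unfolding w0_def by (rule Min_in) auto
  then have w0p: "w0 > 0" using weight_vectorD(7)[OF w] unfolding W_def by auto
  have w0: "w0 \<le> W l" for l unfolding w0_def by (rule Min_le) auto
  have wp: "0 \<le> W l" for l using w0[of l] w0p by linarith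
  obtain A0 where "A0 \<in> U" using U(2) by auto
  then obtain e where e: "e > 0" "ball A0 e \<subseteq> U" using U(1) open_contains_ball by blast
  obtain s0 where s0: "s0 \<ge> 0" "real D * exp (- s0 * w0) < e"
  proof
    define s0 where "s0 = max 0 (ln (real D / e) / w0 + 1)"
    show "s0 \<ge> 0" by (simp add: s0_def)
    have D: "real D > 0" by (simp add: D_def)
    have "ln (real D / e) / w0 < s0" unfolding s0_def by linarith
    then have "ln (real D / e) < s0 * w0" using w0p by (simp add: divide_less_eq)
    then have "real D / e < exp (s0 * w0)" using D e(1) by (metis divide_pos_pos exp_less_mono exp_ln)
    then show "real D * exp (- s0 * w0) < e" using e(1) by (simp add: exp_minus field_simps)
  qed
  have wU: "wbox W s0 A0 \<subseteq> U"
  proof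
    fix X assume "X \<in> wbox W s0 A0"
    then have "dist A0 X < e" using dist_wbox_le[OF _ w0 s0(1)] s0(2) unfolding D_def by fastforce
    then show "X \<in> U" using e(2) by auto
  qed
  define L where "L = ln (2 ^ (D + 1) :: real)"
  have L: "L \<ge> 0" unfolding L_def by (intro ln_ge_zero one_le_power) auto
  \<comment> \<open>Makes the loss of dimension \<open>L / (T * w0)\<close> smaller than
    \<open>D - s\<close>.\<close>
  define T0 where "T0 = L / ((real D - s) * w0) + 1"
  obtain T Pr Y K0 where T: "T \<ge> T0" "T > 0" and root: "Pr A0 s0"
    and hist: "\<And>k A. K0 \<le> k \<Longrightarrow> (\<And>j. j \<le> k \<Longrightarrow> \<exists>B. Pr B (s0 + real j * T) \<and> A \<in> wbox W (s0 + real j * T) B) \<Longrightarrow> (A, s0 + real k * T) \<in> Y"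
    and Pr: "\<And>A s. Pr A s \<Longrightarrow> 4 * card {c\<in>cells W T. \<not> Pr (child W (s + T) A c) (s + T)} \<le> card (cells W T)"
    and hit: "\<And>h. h \<in> closure {flow \<alpha> \<beta> s A ** g |A s g. (A, s) \<in> Y \<and> unim g} \<Longrightarrow> \<bar>det h\<bar> = 1 \<Longrightarrow>
         4 * card (hit_cells \<nu> \<alpha> \<beta> T h) \<le> card (cells W T)"
    using H[OF s0(1), of T0 A0] by blast
  define n where "n = card (cells W T) div 4"
  have "card (hit_cells \<nu> \<alpha> \<beta> T h) \<le> n" if "h \<in> closure {flow \<alpha> \<beta> s A ** g |A s g. (A, s) \<in> Y \<and> unim g}" "\<bar>det h\<bar> = 1" for h
    using hit[OF that] unfolding n_def by linarith
  from uniform_gap[OF w \<nu> T(2) this] obtain \<epsilon> where \<epsilon>: "\<epsilon> > 0" and gap0: "\<forall>A s. (A, s) \<in> Y \<longrightarrow>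
    card {c\<in>cells W T. \<exists>X\<in>wbox W (s + T) (child W (s + T) A c). \<exists>s'\<in>{s - T..s}.
       adm \<nu> (flow \<alpha> \<beta> s' X) (critical_radius \<nu> - \<epsilon>)} \<le> n"
    unfolding W_def by blast
  define bad where "bad A s = {c\<in>cells W T. \<exists>X\<in>wbox W (s + T) (child W (s + T) A c). \<exists>s'\<in>{s - T..s}.
       adm \<nu> (flow \<alpha> \<beta> s' X) (critical_radius \<nu> - \<epsilon>)}" for A s
  have gap: "card (bad A s) \<le> n" if "(A, s) \<in> Y" for A s using gap0 that unfolding bad_def by blast
  define lv where "lv k = s0 + real k * T" for k
  have lvS: "lv (Suc k) = lv k + T" for k by (simp add: lv_def algebra_simps)
  \<comment> \<open>Before level \<open>K0\<close> the history is too short to give membership in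
    \<open>Y\<close>, so hits are not excluded there; \<open>DI\<close> only concerns large
    times.\<close>
  define good where "good = rec_nat (\<lambda>A. A = A0) (\<lambda>k G A'. \<exists>A c. G A \<and> c \<in> cells W T \<and> A' = child W (lv (Suc k)) A c \<and>
      Pr A' (lv (Suc k)) \<and> (K0 \<le> k \<longrightarrow> c \<notin> bad A (lv k)))"
  have g0: "good 0 A \<longleftrightarrow> A = A0" for A by (simp add: good_def)
  have gS: "good (Suc k) A' \<longleftrightarrow> (\<exists>A c. good k A \<and> c \<in> cells W T \<and> A' = child W (lv (Suc k)) A c \<and>
      Pr A' (lv (Suc k)) \<and> (K0 \<le> k \<longrightarrow> c \<notin> bad A (lv k)))" for k A' by (simp add: good_def)
  have gP: "Pr A (lv k)" if "good k A" for k A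
    using that root by (cases k) (auto simp: g0 gS lv_def)
  have ghist: "\<exists>B. Pr B (lv j) \<and> wbox W (lv k) A \<subseteq> wbox W (lv j) B" if "good k A" "j \<le> k" for j k A
    using that
  proof (induction k arbitrary: A)
    case 0
    then show ?case using gP by auto
  next
    case (Suc k)
    show ?case
    proof (cases "j = Suc k")
      case True
      then show ?thesis using gP[OF Suc.prems(1)] by blast
    next
      case False
      obtain B c where B: "good k B" "c \<in> cells W T" "A = child W (lv (Suc k)) B c" using Suc.prems(1) gS by blast
      have "wbox W (lv (Suc k)) A \<subseteq> wbox W (lv k) B" unfolding B(3) lvS by (rule wbox_child_subset[OF B(2)])
      then show ?thesis using Suc.IH[OF B(1)] False Suc.prems(2) by (meson le_Suc_eq order_trans)
    qed
  qed
  have gY: "(A, lv k) \<in> Y" if "good k A" "K0 \<le> k" for k A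
    unfolding lv_def using ghist[OF that(1)] corner_in_wbox[of A W "lv k"] by (intro hist[OF that(2)]) (fastforce simp: lv_def)
  have "hausdorff_measure s {X. \<forall>k. \<exists>A. good k A \<and> X \<in> wbox W (s0 + real k * T) A} \<noteq> 0"
  proof (rule good_tree_measure[OF T(2) s0(1) w0p w0 _ _ s(1)])
    show "good 0 A0" by (simp add: g0)
  next
    fix k A assume A: "good k A"
    let ?N = "{c\<in>cells W T. \<not> Pr (child W (lv k + T) A c) (lv k + T)}"
    let ?Bd = "if K0 \<le> k then bad A (lv k) else {}"
    have "cells W T \<subseteq> {c\<in>cells W T. good (Suc k) (child W (lv (Suc k)) A c)} \<union> ?N \<union> ?Bd"
      using A by (auto simp: gS lvS)
    then have "card (cells W T) \<le> card ({c\<in>cells W T. good (Suc k) (child W (lv (Suc k)) A c)} \<union> ?N \<union> ?Bd)"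
      by (intro card_mono) (auto simp: bad_def)
    also have "\<dots> \<le> card {c\<in>cells W T. good (Suc k) (child W (lv (Suc k)) A c)} + card ?N + card ?Bd"
      by (intro order_trans[OF card_Un_le] add_mono card_Un_le order_refl)
    finally have "card (cells W T) \<le> card {c\<in>cells W T. good (Suc k) (child W (lv (Suc k)) A c)} + card ?N + card ?Bd" .
    moreover have "4 * card ?N \<le> card (cells W T)" by (rule Pr[OF gP[OF A]])
    moreover have "4 * card ?Bd \<le> card (cells W T)" using gap[OF gY[OF A]] unfolding n_def by auto
    ultimately show "card (cells W T) \<le> 2 * card {c\<in>cells W T. good (Suc k) (child W (s0 + real (Suc k) * T) A c)}"
      unfolding lv_def by linarith
  next
    have p: "(real D - s) * w0 > 0" using s(2) w0p by (simp add: D_def)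
    have "L / ((real D - s) * w0) < T" using T(1) unfolding T0_def by linarith
    then have "L < T * ((real D - s) * w0)" using p by (simp add: divide_less_eq)
    also have "T * ((real D - s) * w0) = (real D - s) * (T * w0)" by simp
    finally have "L / (T * w0) < real D - s" using T(2) w0p by (simp add: divide_less_eq)
    then show "s < real (CARD('m) * CARD('n)) - ln (2 ^ (CARD('m) * CARD('n) + 1)) / (T * w0)"
      unfolding L_def D_def by linarith
  qed
  moreover have "{X. \<forall>k. \<exists>A. good k A \<and> X \<in> wbox W (s0 + real k * T) A} \<subseteq> DI \<nu> \<alpha> \<beta> \<inter> U"
  proof
    fix X assume "X \<in> {X. \<forall>k. \<exists>A. good k A \<and> X \<in> wbox W (s0 + real k * T) A}"
    then have X: "\<And>k. \<exists>A. good k A \<and> X \<in> wbox W (lv k) A" unfolding lv_def by blast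
    have "X \<in> U" using X[of 0] wU by (auto simp: g0 lv_def)
    moreover have "X \<in> DI \<nu> \<alpha> \<beta>"
    proof (rule in_DI[OF w \<nu> \<epsilon>])
      have "\<exists>z\<in>int_vectors. z \<noteq> 0 \<and> \<nu> (flow \<alpha> \<beta> s' X *v z) \<le> critical_radius \<nu> - \<epsilon>" if s': "s' \<ge> lv K0" for s'
      proof -
        \<comment> \<open>The level whose past window contains \<open>s'\<close>.\<close>
        define k where "k = nat \<lceil>(s' - s0) / T\<rceil>"
        have "real K0 * T \<le> s' - s0" using s' by (simp add: lv_def)
        then have K0: "real K0 \<le> (s' - s0) / T" using T(2) by (simp add: le_divide_eq)
        then have kc: "real k = of_int \<lceil>(s' - s0) / T\<rceil>" unfolding k_def by simp
        then have k: "(s' - s0) / T \<le> real k" "real k - 1 < (s' - s0) / T" by linarith+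
        have "K0 \<le> k" using K0 k(1) by linarith
        have "s' - s0 \<le> real k * T" "(real k - 1) * T < s' - s0"
          using k T(2) by (simp_all add: divide_le_eq less_divide_eq)
        then have s'in: "s' \<in> {lv k - T..lv k}" by (auto simp: lv_def algebra_simps)
        obtain A' where A': "good (Suc k) A'" "X \<in> wbox W (lv (Suc k)) A'" using X by blast
        then obtain A c where A: "good k A" "c \<in> cells W T" "A' = child W (lv (Suc k)) A c" "c \<notin> bad A (lv k)"
          using gS \<open>K0 \<le> k\<close> by blast
        have "\<not> adm \<nu> (flow \<alpha> \<beta> s' X) (critical_radius \<nu> - \<epsilon>)"
          using A(2,4) A'(2) s'in unfolding bad_def A(3) lvS by blast
        then show ?thesis unfolding adm_def by (auto simp: not_le intro: less_imp_le)
      qed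
      then show "\<forall>\<^sub>F s in at_top. \<exists>z\<in>int_vectors. z \<noteq> 0 \<and> \<nu> (flow \<alpha> \<beta> s X *v z) \<le> critical_radius \<nu> - \<epsilon>"
        by (rule eventually_at_top_linorderI)
    qed
    ultimately show "X \<in> DI \<nu> \<alpha> \<beta> \<inter> U" by blast
  qed
  then have "hausdorff_measure s {X. \<forall>k. \<exists>A. good k A \<and> X \<in> wbox W (s0 + real k * T) A} \<le>
      hausdorff_measure s (DI \<nu> \<alpha> \<beta> \<inter> U)"
    by (rule hausdorff_measure_mono)
  ultimately show "hausdorff_measure s (DI \<nu> \<alpha> \<beta> \<inter> U) \<noteq> 0" by auto
qed

section \<open>Critical lattices\<close>

lemma det_mat: "det (mat k :: real^'d^'d) = k ^ CARD('d)"
  by (subst det_diagonal) (auto simp: mat_def)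

lemma mat_mult_vec: "mat k *v (x::real^'d) = k *\<^sub>R x"
proof -
  have "(mat k *v x) $ i = k * x $ i" for i
  proof -
    have "(mat k *v x) $ i = (\<Sum>j\<in>UNIV. if j = i then k * x $ i else 0)"
      unfolding mat_def matrix_vector_mult_def vec_lambda_beta by (rule sum.cong) auto
    then show ?thesis by simp
  qed
  then show ?thesis by (simp add: vec_eq_iff)
qed

definition critical :: "(real^'d \<Rightarrow> real) \<Rightarrow> real^'d^'d \<Rightarrow> bool" where
  "critical \<nu> y \<longleftrightarrow> \<bar>det y\<bar> = 1 \<and> adm \<nu> y (critical_radius \<nu>)"

definition contact :: "(real^'d \<Rightarrow> real) \<Rightarrow> real^'d^'d \<Rightarrow> (real^'d) set" where
  "contact \<nu> y = {z \<in> int_vectors. z \<noteq> 0 \<and> \<nu> (y *v z) = critical_radius \<nu>}"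

text \<open>By discreteness all nonzero lattice vectors other than contact vectors are longer than
  \<open>r\<close> by a fixed margin, so a perturbation near the identity can push only contact
  vectors below \<open>r\<close>. If it does not, and yet lowers the determinant, rescaling to
  determinant 1 gives an admissible radius beyond the critical one.\<close>

lemma no_improving_perturbation:
  fixes \<nu> :: "real^'d \<Rightarrow> real"
  assumes \<nu>: "is_norm \<nu>" and y: "critical \<nu> y"
  shows "\<exists>\<epsilon>>0. \<forall>L. (\<forall>v. \<nu> (L *v v - v) \<le> \<epsilon> * \<nu> v) \<longrightarrow>
     (\<forall>z \<in> contact \<nu> y. critical_radius \<nu> \<le> \<nu> (L *v (y *v z))) \<longrightarrow> 1 \<le> \<bar>det L\<bar>"
proof -
  define r where "r = critical_radius \<nu>"
  have r: "r > 0" unfolding r_def by (rule critical_radius_pos[OF \<nu>])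
  have det: "\<bar>det y\<bar> = 1" and ad: "adm \<nu> y r" using y by (auto simp: critical_def r_def)
  obtain c0 where c0: "c0 > 0" "\<And>x. c0 * norm x \<le> \<nu> x" using is_norm_lower[OF \<nu>] by blast
  obtain c where c: "c > 0" "\<And>v. c * norm v \<le> norm (y *v v)"
    using norm_le_norm_image[of "norm y"] det by (metis order_refl)
  define Z where "Z = {z \<in> int_vectors. \<nu> (y *v z) \<le> 2 * r}"
  have "Z \<subseteq> {z \<in> int_vectors. norm z \<le> 2 * r / (c0 * c)}"
  proof safe
    fix z assume z: "z \<in> Z"
    have "c0 * (c * norm z) \<le> c0 * norm (y *v z)" using c(2)[of z] c0(1) by (intro mult_left_mono) auto
    also have "\<dots> \<le> 2 * r" using c0(2)[of "y *v z"] z unfolding Z_def by auto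
    finally show "norm z \<le> 2 * r / (c0 * c)" using c0 c by (simp add: field_simps)
  qed (simp add: Z_def)
  then have fZ: "finite Z" using finite_int_vectors_norm_le finite_subset by blast
  \<comment> \<open>The element \<open>2 * r\<close> keeps the set nonempty and is a lower bound for
    all vectors outside the finite \<open>Z\<close>.\<close>
  define V where "V = insert (2 * r) ((\<lambda>z. \<nu> (y *v z)) ` Z \<inter> {r<..})"
  define \<delta> where "\<delta> = Min V"
  have fV: "finite V" "V \<noteq> {}" unfolding V_def using fZ by auto
  have \<delta>: "r < \<delta>" "\<delta> \<le> 2 * r" unfolding \<delta>_def using fV r by (auto simp: V_def)
  have gap: "\<delta> \<le> \<nu> (y *v z)" if "z \<in> int_vectors" "r < \<nu> (y *v z)" for z
  proof (cases "\<nu> (y *v z) \<le> 2 * r")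
    case True
    then have "\<nu> (y *v z) \<in> V" using that unfolding V_def Z_def by auto
    then show ?thesis unfolding \<delta>_def by (rule Min_le[OF fV(1)])
  next
    case False
    then show ?thesis using \<delta> by linarith
  qed
  \<comment> \<open>Chosen so that \<open>(1 - \<epsilon>) * \<delta> = r\<close>: vectors of length
    at least \<open>\<delta>\<close> keep length at least \<open>r\<close>.\<close>
  define \<epsilon> where "\<epsilon> = (\<delta> - r) / \<delta>"
  have \<epsilon>: "\<epsilon> > 0" "\<epsilon> < 1" "(1 - \<epsilon>) * \<delta> = r" using \<delta> r by (auto simp: \<epsilon>_def field_simps)
  show ?thesis
  proof (intro exI[of _ \<epsilon>] conjI allI impI \<epsilon>(1), rule ccontr)
    fix L
    assume L0: "\<forall>v. \<nu> (L *v v - v) \<le> \<epsilon> * \<nu> v"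
      and con: "\<forall>z \<in> contact \<nu> y. critical_radius \<nu> \<le> \<nu> (L *v (y *v z))" and d: "\<not> 1 \<le> \<bar>det L\<bar>"
    note L = L0[rule_format]
    have low: "(1 - \<epsilon>) * \<nu> v \<le> \<nu> (L *v v)" for v
      using is_norm_diff[OF \<nu>, of v "L *v v"] L[of v] is_norm_minus[OF \<nu>, of "L *v v - v"]
      by (simp add: left_diff_distrib)
    have "v = 0" if "L *v v = 0" for v
    proof -
      have "(1 - \<epsilon>) * \<nu> v \<le> 0" using low[of v] that is_norm_zero[OF \<nu>] by simp
      then have "\<nu> v \<le> 0" using \<epsilon> by (simp add: mult_le_0_iff)
      then show ?thesis using is_normD(1,2)[OF \<nu>, of v] by linarith
    qed
    then have "det L \<noteq> 0" by (metis invertible_det_nz invertible_left_inverse matrix_left_invertible_ker)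
    then have d0: "0 < \<bar>det L\<bar>" "\<bar>det L\<bar> < 1" using d by auto
    \<comment> \<open>The scaling that restores determinant 1; it exceeds 1 because the determinant
      of \<open>L\<close> is less than 1 in absolute value.\<close>
    define k where "k = \<bar>det L\<bar> powr (- 1 / real CARD('d))"
    have "k ^ CARD('d) = \<bar>det L\<bar> powr (- 1)"
      unfolding k_def using d0 by (simp add: powr_powr flip: powr_realpow)
    then have kd: "k ^ CARD('d) * \<bar>det L\<bar> = 1" using d0 by (simp add: powr_minus)
    have k0: "k > 0" unfolding k_def using d0 by simp
    have k1: "k > 1"
    proof (rule ccontr)
      assume "\<not> k > 1"
      then have "k ^ CARD('d) \<le> 1" using k0 by (intro power_le_one) auto
      then have "k ^ CARD('d) * \<bar>det L\<bar> \<le> 1 * \<bar>det L\<bar>" by (rule mult_right_mono) auto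
      then show False using kd d0 by simp
    qed
    have "k * r \<le> r" unfolding r_def
    proof (rule adm_le_critical_radius[OF \<nu>])
      show "\<bar>det (mat k ** (L ** y))\<bar> = 1"
        using kd det k0 by (simp add: det_mul abs_mult det_mat)
      show "k * critical_radius \<nu> > 0" using k0 r by (simp add: r_def)
      show "adm \<nu> (mat k ** (L ** y)) (k * critical_radius \<nu>)" unfolding adm_def
      proof (intro ballI impI)
        fix z assume z: "z \<in> int_vectors" "z \<noteq> (0::real^'d)"
        have "r \<le> \<nu> (L *v (y *v z))"
        proof (cases "\<nu> (y *v z) = r")
          case True
          then show ?thesis using con z unfolding contact_def r_def by blast
        next
          case False
          then have "r < \<nu> (y *v z)" using ad z unfolding adm_def by force
          then have "(1 - \<epsilon>) * \<delta> \<le> (1 - \<epsilon>) * \<nu> (y *v z)" using gap[OF z(1)] \<epsilon> by (intro mult_left_mono) auto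
          then show ?thesis using low[of "y *v z"] \<epsilon>(3) by linarith
        qed
        then have "k * r \<le> k * \<nu> (L *v (y *v z))" using k0 by (intro mult_left_mono) auto
        also have "\<dots> = \<nu> ((mat k ** (L ** y)) *v z)"
          using is_normD(3)[OF \<nu>, of k] k0 by (simp add: mat_mult_vec flip: matrix_vector_mul_assoc)
        finally show "k * critical_radius \<nu> \<le> \<nu> ((mat k ** (L ** y)) *v z)" unfolding r_def .
      qed
    qed
    then show False using k1 r by simp
  qed
qed

text \<open>A permutation other than the identity moves at least two indices, so each term in the
  derivative of its product retains an off-diagonal zero of the identity matrix.\<close>

lemma det_deriv_at_identity:
  fixes X :: "real^'d^'d"
  shows "((\<lambda>u. det (mat 1 + u *\<^sub>R X)) has_real_derivative trace X) (at 0)"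
proof -
  let ?P = "{p. p permutes (UNIV::'d set)}"
  define M where "M i j = (mat 1 :: real^'d^'d) $ i $ j" for i j
  have M: "M i j = (if i = j then 1 else 0)" for i j by (simp add: M_def mat_def)
  define D where "D p = (\<Sum>i\<in>UNIV. X$i$p i * (\<Prod>j\<in>UNIV - {i}. M j (p j)))" for p
  have "((\<lambda>u. \<Prod>i\<in>UNIV. (mat 1 + u *\<^sub>R X)$i$p i) has_derivative
     (\<lambda>y. \<Sum>i\<in>UNIV. (y * X$i$p i) * (\<Prod>j\<in>UNIV - {i}. (mat 1 + 0 *\<^sub>R X)$j$p j))) (at 0)" for p :: "'d \<Rightarrow> 'd"
    by (rule has_derivative_prod) (auto intro!: derivative_eq_intros)
  moreover have "(\<lambda>y. \<Sum>i\<in>UNIV. (y * X$i$p i) * (\<Prod>j\<in>UNIV - {i}. (mat 1 + 0 *\<^sub>R X)$j$p j)) = (*) (D p)" for p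
    by (rule ext) (simp add: D_def M_def sum_distrib_right sum_distrib_left mult_ac)
  ultimately have "((\<lambda>u. \<Prod>i\<in>UNIV. (mat 1 + u *\<^sub>R X)$i$p i) has_real_derivative D p) (at 0)" for p
    by (simp add: has_field_derivative_def)
  then have "((\<lambda>u. det (mat 1 + u *\<^sub>R X)) has_real_derivative (\<Sum>p\<in>?P. of_int (sign p) * D p)) (at 0)"
    unfolding det_def by (intro DERIV_sum DERIV_cmult)
  moreover have "(\<Sum>p\<in>?P. of_int (sign p) * D p) = trace X"
  proof -
    have "D p = 0" if p: "p \<in> ?P" "p \<noteq> id" for p
      unfolding D_def
    proof (intro sum.neutral ballI)
      fix i
      obtain k where k: "p k \<noteq> k" using p(2) by (auto simp: fun_eq_iff)
      have "\<exists>j. j \<noteq> i \<and> p j \<noteq> j"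
      proof (cases "k = i")
        case True
        have "inj p" using p(1) permutes_inj by auto
        then have "p (p k) \<noteq> p k" using k by (auto dest: injD)
        then show ?thesis using k True by blast
      qed (use k in blast)
      then obtain j where "j \<noteq> i" "p j \<noteq> j" by blast
      then have "(\<Prod>j\<in>UNIV - {i}. M j (p j)) = 0" by (intro prod_zero) (auto simp: M intro!: bexI[of _ j])
      then show "X$i$p i * (\<Prod>j\<in>UNIV - {i}. M j (p j)) = 0" by simp
    qed
    then have "(\<Sum>p\<in>?P. of_int (sign p) * D p) = (\<Sum>p\<in>{id}. of_int (sign p) * D p)"
      by (intro sum.mono_neutral_right) (auto simp: permutes_id finite_permutations)
    also have "\<dots> = trace X" by (simp add: D_def M trace_def)
    finally show ?thesis .
  qed
  ultimately show ?thesis by simp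
qed

text \<open>Voronoi: an extreme form is perfect. If \<open>S \<noteq> 0\<close> vanished on the contact vectors, then
  \<open>1 + t S\<close> and \<open>1 - t S\<close> would both be admissible perturbations, while
  \<open>det (1 - t\<^sup>2 S\<^sup>2) < 1\<close> for small \<open>t\<close>.\<close>

lemma critical_perfect:
  fixes y S :: "real^'d^'d"
  assumes y: "critical norm y" and sym: "\<And>i j. S$i$j = S$j$i"
    and con: "\<And>z. z \<in> contact norm y \<Longrightarrow> (y *v z) \<bullet> (S *v (y *v z)) = 0"
  shows "S = 0"
proof (rule ccontr)
  assume S: "S \<noteq> 0"
  obtain \<epsilon> where \<epsilon>: "\<epsilon> > 0" "\<forall>L::real^'d^'d. (\<forall>v. norm (L *v v - v) \<le> \<epsilon> * norm v) \<longrightarrow>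
     (\<forall>z \<in> contact norm y. critical_radius (norm :: real^'d \<Rightarrow> real) \<le> norm (L *v (y *v z))) \<longrightarrow> 1 \<le> \<bar>det L\<bar>"
    using no_improving_perturbation[OF is_norm_norm y] by blast
  obtain K where K: "K > 0" "\<And>v. norm (S *v v) \<le> norm v * K"
    using bounded_linear.pos_bounded[OF matrix_vector_mul_bounded_linear[of S]] by blast
  have M: "1 \<le> \<bar>det (mat 1 + t *\<^sub>R S)\<bar>" if t: "\<bar>t\<bar> \<le> \<epsilon> / K" for t
  proof (rule \<epsilon>(2)[rule_format])
    have Mv: "(mat 1 + t *\<^sub>R S) *v v = v + t *\<^sub>R (S *v v)" for v
      by (simp add: matrix_vector_mult_add_rdistrib scaleR_matrix_vector_assoc)
    fix v
    have "norm ((mat 1 + t *\<^sub>R S) *v v - v) = \<bar>t\<bar> * norm (S *v v)" by (simp add: Mv)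
    also have "\<dots> \<le> (\<epsilon> / K) * (norm v * K)" using t K \<epsilon>(1) by (intro mult_mono) auto
    finally show "norm ((mat 1 + t *\<^sub>R S) *v v - v) \<le> \<epsilon> * norm v" using K by simp
  next
    fix z assume z: "z \<in> contact norm y"
    have Mv: "(mat 1 + t *\<^sub>R S) *v v = v + t *\<^sub>R (S *v v)" for v
      by (simp add: matrix_vector_mult_add_rdistrib scaleR_matrix_vector_assoc)
    define u where "u = y *v z"
    have "orthogonal u (t *\<^sub>R (S *v u))" using con[OF z] by (simp add: orthogonal_def u_def)
    then have "(norm (u + t *\<^sub>R (S *v u)))\<^sup>2 = (norm u)\<^sup>2 + (norm (t *\<^sub>R (S *v u)))\<^sup>2"
      by (rule norm_add_Pythagorean)
    then have "norm u \<le> norm (u + t *\<^sub>R (S *v u))" by (auto intro: power2_le_imp_le)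
    then show "critical_radius (norm :: real^'d \<Rightarrow> real) \<le> norm ((mat 1 + t *\<^sub>R S) *v (y *v z))"
      unfolding Mv using z by (simp add: contact_def u_def)
  qed
  \<comment> \<open>Minus the square of \<open>S\<close>. As \<open>S\<close> is symmetric, the
    trace is minus the sum of the squares of its entries, hence negative.\<close>
  define X where "X = - (S ** S)"
  have tX: "trace X < 0"
  proof -
    have "trace X = - (\<Sum>i\<in>UNIV. \<Sum>j\<in>UNIV. S$i$j * S$i$j)"
      by (simp add: X_def trace_def matrix_matrix_mult_def sum_negf sym)
    moreover have "0 < (\<Sum>i\<in>UNIV. \<Sum>j\<in>UNIV. S$i$j * S$i$j)"
    proof -
      obtain i j where ij: "S$i$j \<noteq> 0" using S by (auto simp: vec_eq_iff)
      have "0 < S$i$j * S$i$j" using ij by (simp add: zero_less_mult_iff) linarith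
      also have "\<dots> \<le> (\<Sum>j\<in>UNIV. S$i$j * S$i$j)" by (rule member_le_sum) auto
      also have "\<dots> \<le> (\<Sum>i\<in>UNIV. \<Sum>j\<in>UNIV. S$i$j * S$i$j)"
        by (rule member_le_sum[of i UNIV "\<lambda>i. \<Sum>j\<in>UNIV. S$i$j * S$i$j"]) (auto intro: sum_nonneg)
      finally show ?thesis .
    qed
    ultimately show ?thesis by simp
  qed
  have prod: "(mat 1 + t *\<^sub>R S) ** (mat 1 + (- t) *\<^sub>R S) = mat 1 + t\<^sup>2 *\<^sub>R X" for t
  proof -
    have "((mat 1 + t *\<^sub>R S) ** (mat 1 + (- t) *\<^sub>R S)) *v v = (mat 1 + t\<^sup>2 *\<^sub>R X) *v v" for v
    proof -
      have neg: "(- N) *v u = - (N *v u)" for N :: "real^'d^'d" and u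
        by (simp add: vec_eq_iff matrix_vector_mult_def sum_negf)
      have "X *v v = - (S *v (S *v v))"
        by (simp add: X_def neg matrix_vector_mul_assoc)
      then show ?thesis
        by (simp add: matrix_vector_mult_add_rdistrib matrix_vector_mult_diff_rdistrib
          matrix_vector_right_distrib matrix_vector_mult_diff_distrib matrix_vector_mult_scaleR scaleR_right_distrib power2_eq_square
          flip: matrix_vector_mul_assoc scaleR_matrix_vector_assoc)
    qed
    then show ?thesis by (simp add: matrix_eq)
  qed
  define f where "f u = det (mat 1 + u *\<^sub>R X)" for u
  have f0: "f 0 = 1" by (simp add: f_def)
  have df: "(f has_real_derivative trace X) (at 0)" unfolding f_def by (rule det_deriv_at_identity)
  obtain d where d: "d > 0" "\<And>h. 0 < h \<Longrightarrow> h < d \<Longrightarrow> f (0 + h) < f 0"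
    using DERIV_neg_dec_right[OF df tX] by blast
  \<comment> \<open>Continuity keeps \<open>f\<close> positive near 0, so the absolute values of the
    two determinants do no harm in the product.\<close>
  have "isCont f 0" using df by (rule DERIV_isCont)
  then have "\<exists>d>0. \<forall>h. dist h 0 < d \<longrightarrow> dist (f h) (f 0) < 1"
    unfolding continuous_at_eps_delta dist_norm by auto
  then obtain d' where d': "d' > 0" "\<And>h. \<bar>h\<bar> < d' \<Longrightarrow> \<bar>f h - f 0\<bar> < 1"
    unfolding dist_real_def by auto
  define t where "t = min (\<epsilon> / K) (min 1 (min d d' / 2))"
  have t: "0 < t" "t \<le> \<epsilon> / K" "t \<le> 1" "t < d" "t < d'" 
    using divide_pos_pos[OF \<epsilon>(1) K(1)] d(1) d'(1) unfolding t_def by linarith+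
  have t2: "0 < t\<^sup>2" "t\<^sup>2 \<le> t" using t by (auto simp: power2_eq_square intro: mult_left_le)
  have "f (t\<^sup>2) < 1" using d(2)[of "t\<^sup>2"] t2 t f0 by simp
  moreover have "f (t\<^sup>2) > 0" using d'(2)[of "t\<^sup>2"] t2 t f0 by auto
  moreover have "f (t\<^sup>2) = det (mat 1 + t *\<^sub>R S) * det (mat 1 + (- t) *\<^sub>R S)"
    unfolding f_def prod[symmetric] det_mul ..
  moreover have "1 * 1 \<le> \<bar>det (mat 1 + t *\<^sub>R S)\<bar> * \<bar>det (mat 1 + (- t) *\<^sub>R S)\<bar>"
    using M[of t] M[of "- t"] t by (intro mult_mono) auto
  ultimately show False by (simp add: abs_mult[symmetric])
qed

text \<open>With \<open>K\<close> carrying \<open>y\<close> to \<open>y'\<close>, the symmetric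
  matrix \<open>transpose K ** K - mat 1\<close> is the difference of the two squared norms. It
  vanishes on the contact vectors, where both norms equal the critical radius, so perfection makes
  it zero.\<close>

lemma critical_norm_determined_by_contact:
  fixes y y' :: "real^'d^'d"
  assumes y: "critical norm y" and y': "critical norm y'" and con: "contact norm y = contact norm y'"
  shows "norm (y *v v) = norm (y' *v v)"
proof -
  have "det y \<noteq> 0" using y by (auto simp: critical_def)
  then obtain Yi where Yi: "y ** Yi = mat 1" "Yi ** y = mat 1" by (metis invertible_det_nz invertible_def)
  define K where "K = y' ** Yi"
  define S where "S = transpose K ** K - mat 1"
  have q: "w \<bullet> (S *v w) = (norm (K *v w))\<^sup>2 - (norm w)\<^sup>2" for w
  proof -
    have "S *v w = transpose K *v (K *v w) - w"
      by (simp add: S_def matrix_vector_mult_diff_rdistrib matrix_vector_mul_assoc)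
    moreover have "w \<bullet> (transpose K *v (K *v w)) = (K *v w) \<bullet> (K *v w)"
      by (metis dot_lmul_matrix vector_transpose_matrix inner_commute transpose_matrix_vector transpose_transpose)
    ultimately show ?thesis by (simp add: inner_diff_right power2_norm_eq_inner)
  qed
  have Ky: "K *v (y *v z) = y' *v z" for z
    unfolding K_def matrix_vector_mul_assoc matrix_mul_assoc[symmetric] Yi by simp
  have "S = 0"
  proof (rule critical_perfect[OF y])
    show "S$i$j = S$j$i" for i j
      by (simp add: S_def matrix_matrix_mult_def transpose_def mat_def mult.commute)
    fix z assume z: "z \<in> contact norm y"
    then have "z \<in> contact norm y'" using con by simp
    then show "(y *v z) \<bullet> (S *v (y *v z)) = 0" using z unfolding q Ky by (simp add: contact_def)
  qed
  then have "(norm (K *v (y *v v)))\<^sup>2 = (norm (y *v v))\<^sup>2" using q[of "y *v v"] by simp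
  then show ?thesis unfolding Ky by simp
qed

text \<open>The length of the image of the basis vector \<open>Inl i\<close> gives the time, and
  polarisation against \<open>Inr j\<close> then gives \<open>b$i$j\<close>. So a quadratic form
  belongs to at most one parameter.\<close>

lemma flow_determined_by_norm:
  fixes \<alpha> :: "real^'m" and \<beta> :: "real^'n"
  assumes w: "weight_vector \<alpha> \<beta>" and eq: "\<And>u. norm (flow \<alpha> \<beta> s b *v u) = norm (flow \<alpha> \<beta> s' b' *v u)"
  shows "b = b'"
proof -
  define F where "F s b = (*v) (flow \<alpha> \<beta> s b)" for s b
  have Fi: "F s b (axis (Inl i) 1) = exp (s * \<alpha>$i) *\<^sub>R axis (Inl i) 1" for s b i
    by (auto simp: F_def vec_eq_Plus_iff flow_Inl flow_Inr axis_def)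
  have Fj: "(F s b (axis (Inr j) 1)) $ Inl i = exp (s * \<alpha>$i) * b$i$j" for s b i j
    by (simp add: F_def flow_Inl axis_def if_distrib cong: if_cong)
  have "b$i$j = b'$i$j" for i j
  proof -
    have "exp (s * \<alpha>$i) = exp (s' * \<alpha>$i)" using eq[of "axis (Inl i) 1"] unfolding F_def[symmetric] Fi by simp
    then have s: "s = s'" using weight_vectorD(1)[OF w, of i] by simp
    define u v where "u = axis (Inl i :: 'm + 'n) (1::real)" and "v = axis (Inr j :: 'm + 'n) (1::real)"
    have add: "F s b (u + v) = F s b u + F s b v" for s b by (simp add: F_def matrix_vector_right_distrib)
    have n: "norm (F s b x) = norm (F s' b' x)" for x using eq by (simp add: F_def)
    have dot: "F s b u \<bullet> F s b v = exp (s * \<alpha>$i) * (exp (s * \<alpha>$i) * b$i$j)" for s b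
      unfolding u_def v_def Fi by (simp add: inner_axis' Fj)
    have "F s b u \<bullet> F s b v = F s' b' u \<bullet> F s' b' v"
      using n[of u] n[of v] n[of "u + v"] unfolding add dot_norm by simp
    then show ?thesis unfolding dot s by simp
  qed
  then show ?thesis by (simp add: vec_eq_iff)
qed

section \<open>The Euclidean norm\<close>

lemma shrink_shrink: "shrink \<alpha> \<beta> s (shrink \<alpha> \<beta> t b) = shrink \<alpha> \<beta> (s + t) b"
proof -
  have "exp (- (s + t) * a) = exp (- s * a) * exp (- t * a)" for a :: real
    by (simp add: algebra_simps flip: exp_add)
  then have "exp (- s * a) * (exp (- t * a) * x) = exp (- (s + t) * a) * x" for a x :: real
    by simp
  then show ?thesis unfolding vec_eq_iff shrink_def vec_lambda_beta by blast
qed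

lemma shrink_0 [simp]: "shrink \<alpha> \<beta> 0 b = b"
  by (simp add: shrink_def vec_eq_iff)

lemma shrink_le:
  assumes "weight_vector \<alpha> \<beta>" "s \<ge> 0" "0 \<le> b$i$j" "b$i$j \<le> 1"
  shows "0 \<le> shrink \<alpha> \<beta> s b $ i $ j" "shrink \<alpha> \<beta> s b $ i $ j \<le> 1"
proof -
  have "- s * (\<alpha>$i + \<beta>$j) \<le> 0" using weight_vectorD(7)[OF assms(1), of "(i,j)"] assms(2)
    by (simp add: rate_def mult_nonneg_nonneg)
  then have "exp (- s * (\<alpha>$i + \<beta>$j)) \<le> 1" by (simp del: mult_minus_left)
  then have "exp (- s * (\<alpha>$i + \<beta>$j)) * b$i$j \<le> 1 * 1" using assms(3,4) by (intro mult_mono) auto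
  then show "0 \<le> shrink \<alpha> \<beta> s b $ i $ j" "shrink \<alpha> \<beta> s b $ i $ j \<le> 1"
    using assms(3) by (auto simp: shrink_def)
qed

definition unit_box :: "(real^'n^'m) set" where
  "unit_box = {b. \<forall>i j. 0 \<le> b$i$j \<and> b$i$j \<le> 1}"

section \<open>Hits during one unit of time\<close>

definition hits :: "(real^('m + 'n) \<Rightarrow> real) \<Rightarrow> real^'m \<Rightarrow> real^'n \<Rightarrow> real^('m + 'n)^('m + 'n) \<Rightarrow> (real^'n^'m) set" where
  "hits \<nu> \<alpha> \<beta> h = {b \<in> unit_box. \<exists>\<sigma>\<in>{-1..0}. critical \<nu> (flow \<alpha> \<beta> \<sigma> b ** h)}"

text \<open>The window of length \<open>N\<close> is cut into unit intervals. On the interval that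
  ends at time \<open>-j\<close> the starting lattice is flowed back by \<open>j\<close>, and the
  parameter becomes \<open>shrink \<alpha> \<beta> j b\<close>, still in the unit box.\<close>

lemma hit_cells_subset_hits:
  fixes \<alpha> :: "real^'m" and \<beta> :: "real^'n"
  assumes w: "weight_vector \<alpha> \<beta>" and N: "N > 0" and h: "\<bar>det h\<bar> = 1"
  shows "hit_cells \<nu> \<alpha> \<beta> (real N) h \<subseteq> (\<Union>j<N. {c\<in>cells (rate \<alpha> \<beta>) (real N).
     \<exists>b\<in>wbox (rate \<alpha> \<beta>) (real N) (child (rate \<alpha> \<beta>) (real N) 0 c).
       shrink \<alpha> \<beta> (real j) b \<in> hits \<nu> \<alpha> \<beta> (flow \<alpha> \<beta> (- real j) 0 ** h)})"
proof
  fix c assume "c \<in> hit_cells \<nu> \<alpha> \<beta> (real N) h"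
  then obtain b s where c: "c \<in> cells (rate \<alpha> \<beta>) (real N)"
    and b: "b \<in> wbox (rate \<alpha> \<beta>) (real N) (child (rate \<alpha> \<beta>) (real N) 0 c)"
    and s: "- real N \<le> s" "s \<le> 0" and ad: "adm \<nu> (flow \<alpha> \<beta> s b ** h) (critical_radius \<nu>)"
    unfolding hit_cells_def by auto
  \<comment> \<open>The cap \<open>N - 1\<close> is for \<open>s = -N\<close>, which belongs to the
    last unit interval.\<close>
  define j where "j = min (nat \<lfloor>- s\<rfloor>) (N - 1)"
  have j: "j < N" using N by (simp add: j_def)
  have sj: "s + real j \<in> {-1..0}"
  proof (cases "nat \<lfloor>- s\<rfloor> \<le> N - 1")
    case True
    then have "real j = of_int \<lfloor>- s\<rfloor>" using s by (simp add: j_def)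
    then show ?thesis by simp linarith
  next
    case False
    then have "real j = real N - 1" "real N \<le> - s" using N s unfolding j_def by (auto simp: of_nat_diff) linarith
    then show ?thesis using s by simp
  qed
  have "flow \<alpha> \<beta> (s + real j) (shrink \<alpha> \<beta> (real j) b) ** flow \<alpha> \<beta> (- real j) 0 = flow \<alpha> \<beta> s b"
    unfolding flow_mult shrink_shrink by simp
  then have "flow \<alpha> \<beta> (s + real j) (shrink \<alpha> \<beta> (real j) b) ** (flow \<alpha> \<beta> (- real j) 0 ** h) = flow \<alpha> \<beta> s b ** h"
    by (simp add: matrix_mul_assoc)
  moreover have "critical \<nu> (flow \<alpha> \<beta> s b ** h)" unfolding critical_def using ad h det_flow[OF w, of s b]
    by (simp add: det_mul)
  moreover have "shrink \<alpha> \<beta> (real j) b \<in> unit_box"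
    unfolding unit_box_def using shrink_le[OF w, of "real j" b] unit_cell[OF c b] by auto
  ultimately have "shrink \<alpha> \<beta> (real j) b \<in> hits \<nu> \<alpha> \<beta> (flow \<alpha> \<beta> (- real j) 0 ** h)"
    unfolding hits_def using sj by (auto intro!: bexI[of _ "s + real j"])
  then show "c \<in> (\<Union>j<N. {c\<in>cells (rate \<alpha> \<beta>) (real N).
     \<exists>b\<in>wbox (rate \<alpha> \<beta>) (real N) (child (rate \<alpha> \<beta>) (real N) 0 c).
       shrink \<alpha> \<beta> (real j) b \<in> hits \<nu> \<alpha> \<beta> (flow \<alpha> \<beta> (- real j) 0 ** h)})"
    using c b j by blast
qed

lemma critical_unim: "unim g \<Longrightarrow> critical \<nu> (y ** g) \<longleftrightarrow> critical \<nu> y"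
  unfolding critical_def by (simp add: adm_unim det_mul abs_mult det_unim)

lemma hits_unim: "unim g \<Longrightarrow> hits \<nu> \<alpha> \<beta> (h ** g) = hits \<nu> \<alpha> \<beta> h"
  unfolding hits_def by (simp add: critical_unim matrix_mul_assoc)

text \<open>A lattice that hits is admissible up to a constant, so after a change of basis it ranges
  over a fixed compact set. This makes the counts uniform in \<open>h\<close>.\<close>

lemma hits_bounded_representative:
  fixes \<alpha> :: "real^'m" and \<beta> :: "real^'n" and \<nu> :: "real^('m + 'n) \<Rightarrow> real"
  assumes w: "weight_vector \<alpha> \<beta>" and \<nu>: "is_norm \<nu>"
  shows "\<exists>B. \<forall>h. \<bar>det h\<bar> = 1 \<longrightarrow> hits \<nu> \<alpha> \<beta> h \<noteq> {} \<longrightarrow> (\<exists>g. unim g \<and> norm (h ** g) \<le> B)"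
proof -
  obtain \<kappa> where \<kappa>: "\<kappa> > 0" "\<And>\<sigma> b x q. \<bar>\<sigma>\<bar> \<le> 1 \<Longrightarrow> (\<And>i j. \<bar>b$i$j\<bar> \<le> 1) \<Longrightarrow>
    adm \<nu> (flow \<alpha> \<beta> \<sigma> b ** x) q \<Longrightarrow> adm norm x (\<kappa> * q)"
    using adm_of_adm_flow[OF w \<nu>] by blast
  have "\<kappa> * critical_radius \<nu> > 0" using \<kappa>(1) critical_radius_pos[OF \<nu>] by simp
  then obtain B where B: "\<And>y::real^('m + 'n)^('m + 'n). \<bar>det y\<bar> = 1 \<Longrightarrow> adm norm y (\<kappa> * critical_radius \<nu>) \<Longrightarrow>
      \<exists>g. unim g \<and> norm (y ** g) \<le> B"
    using mahler_bounded_representative by blast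
  have "\<exists>g. unim g \<and> norm (h ** g) \<le> B" if h: "\<bar>det h\<bar> = 1" "hits \<nu> \<alpha> \<beta> h \<noteq> {}" for h
  proof -
    obtain b \<sigma> where b: "b \<in> unit_box" "\<sigma> \<in> {-1..0}" "critical \<nu> (flow \<alpha> \<beta> \<sigma> b ** h)"
      using h(2) unfolding hits_def by blast
    have "adm norm h (\<kappa> * critical_radius \<nu>)"
    proof (rule \<kappa>(2))
      show "\<bar>\<sigma>\<bar> \<le> 1" using b(2) by auto
      show "\<bar>b$i$j\<bar> \<le> 1" for i j using b(1) unfolding unit_box_def by auto
      show "adm \<nu> (flow \<alpha> \<beta> \<sigma> b ** h) (critical_radius \<nu>)" using b(3) unfolding critical_def by blast
    qed
    then show ?thesis by (rule B[OF h(1)])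
  qed
  then show ?thesis by blast
qed

text \<open>The inverse of \<open>h\<close> and the inverse of the flow over a unit of time lengthen
  vectors by bounded factors, so a contact vector comes from an integer vector of bounded
  length.\<close>

lemma contacts_finite:
  fixes \<alpha> :: "real^'m" and \<beta> :: "real^'n" and \<nu> :: "real^('m + 'n) \<Rightarrow> real"
  assumes w: "weight_vector \<alpha> \<beta>" and \<nu>: "is_norm \<nu>"
  shows "\<exists>Z. finite Z \<and> Z \<subseteq> int_vectors \<and> (\<forall>h \<sigma> b. \<bar>det h\<bar> = 1 \<longrightarrow> norm h \<le> B \<longrightarrow> \<sigma> \<in> {-1..0} \<longrightarrow> b \<in> unit_box \<longrightarrow>
     contact \<nu> (flow \<alpha> \<beta> \<sigma> b ** h) \<subseteq> Z)"
proof -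
  obtain c where c: "c > 0" "\<And>(h::real^('m + 'n)^('m + 'n)) v. \<bar>det h\<bar> = 1 \<Longrightarrow> norm h \<le> B \<Longrightarrow> c * norm v \<le> norm (h *v v)"
    using norm_le_norm_image[of B] by blast
  obtain c0 where c0: "c0 > 0" "\<And>x. c0 * norm x \<le> \<nu> x" using is_norm_lower[OF \<nu>] by blast
  define K where "K = (real CARD('m) * (1 + real CARD('n)) + real CARD('n)) * exp 1"
  have K: "K > 0" unfolding K_def by (intro mult_pos_pos add_nonneg_pos) auto
  define Z where "Z = {z \<in> int_vectors. norm (z::real^('m + 'n)) \<le> K * critical_radius \<nu> / (c0 * c)}"
  have "contact \<nu> (flow \<alpha> \<beta> \<sigma> b ** h) \<subseteq> Z" if h: "\<bar>det h\<bar> = 1" "norm h \<le> B" and \<sigma>: "\<sigma> \<in> {-1..0}" and b: "b \<in> unit_box" for h \<sigma> b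
  proof
    fix z assume z: "z \<in> contact \<nu> (flow \<alpha> \<beta> \<sigma> b ** h)"
    \<comment> \<open>The parameter of the inverse flow; its entries stay within 1 in absolute value
      because \<open>- \<sigma>\<close> is nonnegative.\<close>
    define b' where "b' = - shrink \<alpha> \<beta> (- \<sigma>) b"
    have b'1: "\<bar>b'$i$j\<bar> \<le> 1" for i j
      using shrink_le[OF w, of "- \<sigma>" b i j] b \<sigma> unfolding b'_def unit_box_def by simp
    have "b + shrink \<alpha> \<beta> \<sigma> b' = 0"
    proof -
      have "shrink \<alpha> \<beta> \<sigma> b' = - shrink \<alpha> \<beta> \<sigma> (shrink \<alpha> \<beta> (- \<sigma>) b)"
        by (simp add: b'_def shrink_def vec_eq_iff)
      then show ?thesis by (simp add: shrink_shrink)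
    qed
    then have "flow \<alpha> \<beta> (- \<sigma>) b' ** flow \<alpha> \<beta> \<sigma> b = mat 1" by (simp add: flow_mult flow_0_0)
    then have e: "h *v z = flow \<alpha> \<beta> (- \<sigma>) b' *v ((flow \<alpha> \<beta> \<sigma> b ** h) *v z)"
      by (simp add: matrix_vector_mul_assoc matrix_mul_assoc)
    have "c * norm z \<le> norm (h *v z)" by (rule c(2)[OF h])
    also have "\<dots> \<le> K * norm ((flow \<alpha> \<beta> \<sigma> b ** h) *v z)"
      unfolding e K_def by (rule norm_flow_le[OF w _ b'1]) (use \<sigma> in auto)
    finally have "c0 * (c * norm z) \<le> c0 * (K * norm ((flow \<alpha> \<beta> \<sigma> b ** h) *v z))" using c0 by (intro mult_left_mono) auto
    also have "\<dots> = K * (c0 * norm ((flow \<alpha> \<beta> \<sigma> b ** h) *v z))" by simp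
    also have "\<dots> \<le> K * critical_radius \<nu>"
      using c0(2)[of "(flow \<alpha> \<beta> \<sigma> b ** h) *v z"] z K unfolding contact_def by (intro mult_left_mono) auto
    finally show "z \<in> Z" using z c c0 unfolding Z_def contact_def by (simp add: field_simps)
  qed
  moreover have "finite Z" unfolding Z_def by (rule finite_int_vectors_norm_le)
  moreover have "Z \<subseteq> int_vectors" unfolding Z_def by blast
  ultimately show ?thesis by blast
qed

text \<open>The bound is the same for all lattices: after the reduction to bounded \<open>h\<close>,
  the hits are labelled by subsets of one finite \<open>Z\<close>.\<close>

lemma card_hits_euclidean:
  fixes \<alpha> :: "real^'m" and \<beta> :: "real^'n"
  assumes w: "weight_vector \<alpha> \<beta>"
  shows "\<exists>N0. \<forall>h. \<bar>det h\<bar> = 1 \<longrightarrow> finite (hits norm \<alpha> \<beta> h) \<and> card (hits norm \<alpha> \<beta> h) \<le> N0"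
proof -
  obtain B where B: "\<And>h. \<bar>det h\<bar> = 1 \<Longrightarrow> hits norm \<alpha> \<beta> h \<noteq> {} \<Longrightarrow> \<exists>g. unim g \<and> norm (h ** g) \<le> B"
    using hits_bounded_representative[OF w is_norm_norm] by blast
  obtain Z where Z: "finite Z" "\<And>h \<sigma> b. \<bar>det h\<bar> = 1 \<Longrightarrow> norm h \<le> B \<Longrightarrow> \<sigma> \<in> {-1..0} \<Longrightarrow> b \<in> unit_box \<Longrightarrow>
     contact norm (flow \<alpha> \<beta> \<sigma> b ** h) \<subseteq> Z"
    using contacts_finite[OF w is_norm_norm, of B] by blast
  have "finite (hits norm \<alpha> \<beta> h) \<and> card (hits norm \<alpha> \<beta> h) \<le> card (Pow Z)" if h0: "\<bar>det h\<bar> = 1" for h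
  proof (cases "hits norm \<alpha> \<beta> h = {}")
    case False
    obtain g where g: "unim g" "norm (h ** g) \<le> B" using B[OF h0 False] by blast
    define h' where "h' = h ** g"
    have h': "\<bar>det h'\<bar> = 1" "norm h' \<le> B" using h0 g det_unim by (auto simp: h'_def det_mul abs_mult)
    have hh: "hits norm \<alpha> \<beta> h = hits norm \<alpha> \<beta> h'" using hits_unim[OF g(1)] by (simp add: h'_def)
    define \<sigma> where "\<sigma> b = (SOME s. s \<in> {-1..0} \<and> critical norm (flow \<alpha> \<beta> s b ** h'))" for b
    have \<sigma>: "\<sigma> b \<in> {-1..0} \<and> critical norm (flow \<alpha> \<beta> (\<sigma> b) b ** h')" if "b \<in> hits norm \<alpha> \<beta> h'" for b
      unfolding \<sigma>_def by (rule someI_ex) (use that in \<open>auto simp: hits_def\<close>)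
    define f where "f b = contact norm (flow \<alpha> \<beta> (\<sigma> b) b ** h')" for b
    have "inj_on f (hits norm \<alpha> \<beta> h')"
    proof (rule inj_onI)
      fix b b' assume b: "b \<in> hits norm \<alpha> \<beta> h'" "b' \<in> hits norm \<alpha> \<beta> h'" and eq: "f b = f b'"
      have n: "norm ((flow \<alpha> \<beta> (\<sigma> b) b ** h') *v v) = norm ((flow \<alpha> \<beta> (\<sigma> b') b' ** h') *v v)" for v
        by (rule critical_norm_determined_by_contact) (use \<sigma> b eq in \<open>auto simp: f_def\<close>)
      have "det h' \<noteq> 0" using h' by auto
      then obtain hi where hi: "h' ** hi = mat 1" by (metis invertible_det_nz invertible_def)
      show "b = b'"
      proof (rule flow_determined_by_norm[OF w])
        fix u
        show "norm (flow \<alpha> \<beta> (\<sigma> b) b *v u) = norm (flow \<alpha> \<beta> (\<sigma> b') b' *v u)"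
          using n[of "hi *v u"] by (simp add: matrix_vector_mul_assoc hi flip: matrix_mul_assoc)
      qed
    qed
    moreover have "f ` hits norm \<alpha> \<beta> h' \<subseteq> Pow Z"
    proof (rule image_subsetI)
      fix b assume b: "b \<in> hits norm \<alpha> \<beta> h'"
      then have "b \<in> unit_box" by (simp add: hits_def)
      then show "f b \<in> Pow Z" unfolding f_def using Z(2)[OF h'] \<sigma>[OF b] by blast
    qed
    moreover have "finite (Pow Z)" using Z by simp
    ultimately show ?thesis unfolding hh by (meson card_inj_on_le inj_on_finite)
  qed simp
  then show ?thesis by blast
qed

text \<open>Cells are closed, so a point on a common face belongs to two cells per entry.\<close>

lemma card_cells_containing_point:
  fixes w :: "'m::finite \<times> 'n::finite \<Rightarrow> real"
  shows "card {c\<in>cells w T. b \<in> wbox w T (child w T 0 c)} \<le> 2 ^ (CARD('m) * CARD('n))"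
proof -
  define y where "y l = b $ fst l $ snd l * exp (T * w l)" for l
  define R where "R = PiE UNIV (\<lambda>l. {nat \<lceil>y l - 1\<rceil>, nat \<lceil>y l - 1\<rceil> + 1})"
  have "{c\<in>cells w T. b \<in> wbox w T (child w T 0 c)} \<subseteq> R"
  proof
    fix c assume c: "c \<in> {c\<in>cells w T. b \<in> wbox w T (child w T 0 c)}"
    have "c l \<in> {nat \<lceil>y l - 1\<rceil>, nat \<lceil>y l - 1\<rceil> + 1}" for l
    proof -
      have 1: "real (c l) * exp (- T * w l) \<le> b $ fst l $ snd l"
        "b $ fst l $ snd l \<le> real (c l) * exp (- T * w l) + exp (- T * w l)"
        using c unfolding wbox_def child_def by (cases l; auto)+
      have e: "exp (- T * w l) * exp (T * w l) = 1" by (simp flip: exp_add)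
      have "real (c l) * exp (- T * w l) * exp (T * w l) \<le> y l"
        unfolding y_def by (intro mult_right_mono 1) auto
      then have "real (c l) \<le> y l" unfolding mult.assoc e by simp
      moreover have "y l \<le> (real (c l) * exp (- T * w l) + exp (- T * w l)) * exp (T * w l)"
        unfolding y_def by (intro mult_right_mono 1) auto
      then have "y l \<le> real (c l) + 1" unfolding distrib_right mult.assoc e by simp
      ultimately have "\<lceil>y l - 1\<rceil> = int (c l) \<or> \<lceil>y l - 1\<rceil> + 1 = int (c l)" by linarith
      then show ?thesis
      proof
        assume "\<lceil>y l - 1\<rceil> + 1 = int (c l)"
        then show ?thesis by (cases "c l") auto
      qed simp
    qed
    then show "c \<in> R" unfolding R_def by auto
  qed
  moreover have "finite R" unfolding R_def by (rule finite_PiE) auto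
  moreover have "card R = 2 ^ (CARD('m) * CARD('n))" unfolding R_def by (subst card_PiE) (auto simp: numeral_2_eq_2)
  ultimately show ?thesis using card_mono[of R] by fastforce
qed

lemma linear_le_exp:
  fixes a K :: real
  assumes "a > 0" "K \<ge> 0" "T \<ge> 2 * K / a\<^sup>2" "T \<ge> 0"
  shows "K * T \<le> exp (a * T)"
proof -
  have "2 * K \<le> a\<^sup>2 * T" using assms by (simp add: divide_le_eq mult.commute)
  then have "2 * K * T \<le> a\<^sup>2 * T * T" using assms(4) by (rule mult_right_mono)
  then have "K * T \<le> (a * T)\<^sup>2 / 2" by (simp add: power2_eq_square mult_ac)
  also have "\<dots> \<le> exp (a * T)" using exp_lower_Taylor_quadratic[of "a * T"] mult_nonneg_nonneg[of a T] assms(1,4) by linarith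
  finally show ?thesis .
qed

lemma thick_DI_euclidean:
  fixes \<alpha> :: "real^'m" and \<beta> :: "real^'n"
  assumes w: "weight_vector \<alpha> \<beta>"
  shows "thick (DI (norm :: real^('m + 'n) \<Rightarrow> real) \<alpha> \<beta>)"
proof (rule thick_DI_criterion[OF w is_norm_norm])
  fix A0 :: "real^'n^'m" and s0 T0 :: real
  define D where "D = CARD('m) * CARD('n)"
  obtain N0 where N0: "\<And>h. \<bar>det h\<bar> = 1 \<Longrightarrow> finite (hits (norm :: real^('m + 'n) \<Rightarrow> real) \<alpha> \<beta> h) \<and>
      card (hits (norm :: real^('m + 'n) \<Rightarrow> real) \<alpha> \<beta> h) \<le> N0"
    using card_hits_euclidean[OF w] by blast
  define a where "a = (\<Sum>l\<in>UNIV. rate \<alpha> \<beta> l)"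
  have a: "a > 0" unfolding a_def by (rule sum_pos) (use weight_vectorD(7)[OF w] in auto)
  \<comment> \<open>The 4 is for the quarter, one \<open>2 ^ D\<close> for the cells around a point,
    the other for the rounding in \<open>card_cells_ge\<close>.\<close>
  define K where "K = 4 * real N0 * 2 ^ D * 2 ^ D"
  have K0: "K \<ge> 0" by (simp add: K_def)
  \<comment> \<open>An integral time, so that the window splits into unit intervals.\<close>
  obtain N :: nat where N: "max T0 (max 1 (2 * K / a\<^sup>2)) \<le> real N" using real_arch_simple by blast
  have N1: "N > 0" using N by auto
  have KN: "K * real N \<le> exp (a * real N)"
    by (rule linear_le_exp[OF a K0]) (use N in auto)
  define W where "W = rate \<alpha> \<beta>"
  have "4 * card (hit_cells norm \<alpha> \<beta> (real N) h) \<le> card (cells W (real N))" if h: "\<bar>det h\<bar> = 1" for h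
  proof -
    define H where "H j = hits norm \<alpha> \<beta> (flow \<alpha> \<beta> (- real j) 0 ** h)" for j
    have H: "finite (H j)" "card (H j) \<le> N0" for j
      using N0[of "flow \<alpha> \<beta> (- real j) 0 ** h"] h det_flow[OF w] unfolding H_def by (auto simp: det_mul)
    define C where "C b = {c\<in>cells W (real N). b \<in> wbox W (real N) (child W (real N) 0 c)}" for b
    have C: "finite (C b)" "card (C b) \<le> 2 ^ D" for b
      unfolding C_def D_def by (auto intro: card_cells_containing_point)
    have "hit_cells norm \<alpha> \<beta> (real N) h \<subseteq> (\<Union>j<N. \<Union>b\<in>H j. C (shrink \<alpha> \<beta> (- real j) b))"
    proof
      fix c assume "c \<in> hit_cells norm \<alpha> \<beta> (real N) h"
      then obtain j b where j: "j < N" "c \<in> cells W (real N)" "b \<in> wbox W (real N) (child W (real N) 0 c)"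
        "shrink \<alpha> \<beta> (real j) b \<in> H j"
        using hit_cells_subset_hits[OF w N1 h] unfolding H_def W_def by blast
      have "c \<in> C (shrink \<alpha> \<beta> (- real j) (shrink \<alpha> \<beta> (real j) b))"
        using j(2,3) unfolding shrink_shrink C_def by simp
      then show "c \<in> (\<Union>j<N. \<Union>b\<in>H j. C (shrink \<alpha> \<beta> (- real j) b))" using j(1,4) by blast
    qed
    then have "card (hit_cells norm \<alpha> \<beta> (real N) h) \<le> card (\<Union>j<N. \<Union>b\<in>H j. C (shrink \<alpha> \<beta> (- real j) b))"
      by (intro card_mono finite_UN_I H C) auto
    also have "\<dots> \<le> (\<Sum>j<N. card (\<Union>b\<in>H j. C (shrink \<alpha> \<beta> (- real j) b)))" by (rule card_UN_le) simp
    also have "\<dots> \<le> (\<Sum>j<N. N0 * 2 ^ D)"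
    proof (rule sum_mono)
      fix j
      have "card (\<Union>b\<in>H j. C (shrink \<alpha> \<beta> (- real j) b)) \<le> (\<Sum>b\<in>H j. card (C (shrink \<alpha> \<beta> (- real j) b)))"
        by (rule card_UN_le[OF H(1)])
      also have "\<dots> \<le> (\<Sum>b\<in>H j. 2 ^ D)" by (intro sum_mono C)
      also have "\<dots> \<le> N0 * 2 ^ D" using H(2)[of j] by simp
      finally show "card (\<Union>b\<in>H j. C (shrink \<alpha> \<beta> (- real j) b)) \<le> N0 * 2 ^ D" .
    qed
    finally have "card (hit_cells norm \<alpha> \<beta> (real N) h) \<le> N * (N0 * 2 ^ D)" by simp
    then have "real (card (hit_cells norm \<alpha> \<beta> (real N) h)) \<le> real (N * (N0 * 2 ^ D))" by (rule of_nat_mono)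
    then have "2 ^ D * (4 * real (card (hit_cells norm \<alpha> \<beta> (real N) h))) \<le> K * real N"
      by (simp add: K_def mult_ac)
    also have "\<dots> \<le> exp (real N * a)" using KN by (simp add: mult.commute)
    also have "\<dots> \<le> 2 ^ D * real (card (cells W (real N)))"
      unfolding a_def D_def W_def
      by (rule card_cells_ge) (use N1 weight_vectorD(7)[OF w] less_imp_le in auto)
    finally show ?thesis by simp
  qed
  then show "\<exists>T Pr Y K0. T \<ge> T0 \<and> T > 0 \<and> Pr A0 s0 \<and>
      (\<forall>k A. K0 \<le> k \<longrightarrow> (\<forall>j\<le>k. \<exists>B. Pr B (s0 + real j * T) \<and> A \<in> wbox (rate \<alpha> \<beta>) (s0 + real j * T) B) \<longrightarrow> (A, s0 + real k * T) \<in> Y) \<and>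
      (\<forall>A s. Pr A s \<longrightarrow> 4 * card {c\<in>cells (rate \<alpha> \<beta>) T. \<not> Pr (child (rate \<alpha> \<beta>) (s + T) A c) (s + T)} \<le> card (cells (rate \<alpha> \<beta>) T)) \<and>
      (\<forall>h \<in> closure {flow \<alpha> \<beta> s A ** g |A s g. (A, s) \<in> Y \<and> unim g}. \<bar>det h\<bar> = 1 \<longrightarrow>
         4 * card (hit_cells norm \<alpha> \<beta> T h) \<le> card (cells (rate \<alpha> \<beta>) T))"
    using N N1 unfolding W_def
    by (intro exI[of _ "real N"] exI[of _ "\<lambda>_ _. True"] exI[of _ UNIV] exI[of _ 0]) auto
qed

section \<open>Cylindrical norms\<close>

text \<open>First-order form of \<open>no_improving_perturbation\<close>: \<open>trace X\<close> is
  the derivative of the determinant of \<open>mat 1 + u *\<^sub>R X\<close> at 0, so a small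
  \<open>u > 0\<close> lowers the determinant while no contact vector falls below the critical
  radius.\<close>

lemma no_infinitesimal_improvement:
  fixes \<nu> :: "real^'d \<Rightarrow> real" and X :: "real^'d^'d"
  assumes \<nu>: "is_norm \<nu>" and y: "critical \<nu> y" and tr: "trace X < 0"
    and con: "\<And>z u. z \<in> contact \<nu> y \<Longrightarrow> 0 < u \<Longrightarrow> critical_radius \<nu> \<le> \<nu> (y *v z + u *\<^sub>R (X *v (y *v z)))"
  shows False
proof -
  obtain \<epsilon> where \<epsilon>: "\<epsilon> > 0" "\<forall>L. (\<forall>v. \<nu> (L *v v - v) \<le> \<epsilon> * \<nu> v) \<longrightarrow>
     (\<forall>z \<in> contact \<nu> y. critical_radius \<nu> \<le> \<nu> (L *v (y *v z))) \<longrightarrow> 1 \<le> \<bar>det L\<bar>"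
    using no_improving_perturbation[OF \<nu> y] by blast
  obtain C where C: "C > 0" "\<And>x. \<nu> x \<le> C * norm x" using is_norm_upper[OF \<nu>] by blast
  obtain c0 where c0: "c0 > 0" "\<And>x. c0 * norm x \<le> \<nu> x" using is_norm_lower[OF \<nu>] by blast
  obtain K where K: "K > 0" "\<And>v. norm (X *v v) \<le> norm v * K"
    using bounded_linear.pos_bounded[OF matrix_vector_mul_bounded_linear[of X]] by blast
  define f where "f u = det (mat 1 + u *\<^sub>R X)" for u
  have f0: "f 0 = 1" by (simp add: f_def)
  have df: "(f has_real_derivative trace X) (at 0)" unfolding f_def by (rule det_deriv_at_identity)
  obtain d where d: "d > 0" "\<And>h. 0 < h \<Longrightarrow> h < d \<Longrightarrow> f (0 + h) < f 0"
    using DERIV_neg_dec_right[OF df tr] by blast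
  have "isCont f 0" using df by (rule DERIV_isCont)
  then have "\<exists>d>0. \<forall>h. dist h 0 < d \<longrightarrow> dist (f h) (f 0) < 1"
    unfolding continuous_at_eps_delta dist_norm by auto
  then obtain d' where d': "d' > 0" "\<And>h. \<bar>h\<bar> < d' \<Longrightarrow> \<bar>f h - f 0\<bar> < 1"
    unfolding dist_real_def by auto
  \<comment> \<open>For \<open>u\<close> up to this bound, \<open>\<nu> (L *v v - v)\<close> is at
    most \<open>\<epsilon> * \<nu> v\<close>.\<close>
  define e where "e = \<epsilon> * c0 / (C * K)"
  have e: "e > 0" using \<epsilon>(1) c0 C K by (simp add: e_def)
  define u where "u = min e (min d d' / 2)"
  have u: "0 < u" "u \<le> e" "u < d" "u < d'" using e d(1) d'(1) unfolding u_def by linarith+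
  define L where "L = mat 1 + u *\<^sub>R X"
  have Lv: "L *v v = v + u *\<^sub>R (X *v v)" for v
    by (simp add: L_def matrix_vector_mult_add_rdistrib scaleR_matrix_vector_assoc)
  have "1 \<le> \<bar>det L\<bar>"
  proof (rule \<epsilon>(2)[rule_format])
    fix v
    have "\<nu> (L *v v - v) = u * \<nu> (X *v v)" unfolding Lv using is_normD(3)[OF \<nu>, of u] u(1) by simp
    also have "\<dots> \<le> e * (C * (norm v * K))"
      using C(2)[of "X *v v"] K(2)[of v] C(1) u e is_normD(1)[OF \<nu>]
      by (intro mult_mono) (auto intro: order_trans mult_left_mono)
    also have "\<dots> = \<epsilon> * (c0 * norm v)" using C K by (simp add: e_def)
    also have "\<dots> \<le> \<epsilon> * \<nu> v" using c0(2)[of v] \<epsilon>(1) by (intro mult_left_mono) auto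
    finally show "\<nu> (L *v v - v) \<le> \<epsilon> * \<nu> v" .
  next
    fix z assume "z \<in> contact \<nu> y"
    then show "critical_radius \<nu> \<le> \<nu> (L *v (y *v z))" unfolding Lv using con u(1) by blast
  qed
  moreover have "f u < 1" "0 < f u" using d(2)[of u] d'(2)[of u] u f0 by auto
  ultimately show False unfolding f_def L_def by simp
qed

definition hor :: "real^(2 + 1) \<Rightarrow> real^2" where
  "hor v = vector [v $ Inl 1, v $ Inl 2]"

definition cyl :: "(real^2 \<Rightarrow> real) \<Rightarrow> real^(2 + 1) \<Rightarrow> real" where
  "cyl \<eta> v = max (\<eta> (hor v)) \<bar>v $ Inr 1\<bar>"

definition cross2 :: "real^2 \<Rightarrow> real^2 \<Rightarrow> real" where
  "cross2 u v = u$1 * v$2 - u$2 * v$1"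

lemma vec_eq_21_iff: "v = w \<longleftrightarrow> v $ Inl 1 = w $ Inl 1 \<and> v $ Inl 2 = w $ Inl 2 \<and> v $ Inr 1 = (w::'a^(2+1)) $ Inr 1"
  unfolding vec_eq_Plus_iff by (auto simp: forall_2)

lemma hor_nth [simp]: "hor v $ 1 = v $ Inl 1" "hor v $ 2 = v $ Inl 2"
  by (auto simp: hor_def)

lemma hor_add: "hor (v + w) = hor v + hor w" and hor_scaleR: "hor (c *\<^sub>R v) = c *\<^sub>R hor v"
  by (auto simp: vec_eq_iff forall_2)

lemma is_norm_cyl:
  assumes "is_norm \<eta>"
  shows "is_norm (cyl \<eta>)"
  unfolding is_norm_def
proof (intro conjI allI)
  fix x y :: "real^(2+1)" and c :: real
  show "0 \<le> cyl \<eta> x" by (simp add: cyl_def le_max_iff_disj)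
  show "cyl \<eta> x = 0 \<longleftrightarrow> x = 0"
  proof
    assume z: "cyl \<eta> x = 0"
    then have "\<eta> (hor x) \<le> 0" "\<bar>x $ Inr 1\<bar> \<le> 0" unfolding cyl_def by (metis max.cobounded1, metis max.cobounded2)
    then have "hor x = 0" "x $ Inr 1 = 0" using is_normD(1,2)[OF assms, of "hor x"] by auto
    then have "hor x $ 1 = 0" "hor x $ 2 = 0" by simp_all
    then show "x = 0" using \<open>x $ Inr 1 = 0\<close> by (simp add: vec_eq_21_iff)
  next
    assume "x = 0"
    moreover have "hor 0 = 0" by (simp add: vec_eq_iff forall_2)
    ultimately show "cyl \<eta> x = 0" by (simp add: cyl_def is_norm_zero[OF assms])
  qed
  show "cyl \<eta> (c *\<^sub>R x) = \<bar>c\<bar> * cyl \<eta> x"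
    unfolding cyl_def hor_scaleR is_normD(3)[OF assms] by (simp add: abs_mult max_mult_distrib_left)
  have "\<eta> (hor x + hor y) \<le> \<eta> (hor x) + \<eta> (hor y)" by (rule is_normD(4)[OF assms])
  moreover have "\<bar>x $ Inr 1 + y $ Inr 1\<bar> \<le> \<bar>x $ Inr 1\<bar> + \<bar>y $ Inr 1\<bar>" by simp
  ultimately show "cyl \<eta> (x + y) \<le> cyl \<eta> x + cyl \<eta> y"
    unfolding cyl_def hor_add by (simp add: max_def)
qed

text \<open>Without a contact on the top face the lattice could be squeezed vertically; without the
  lateral contacts of the third kind it could be squeezed horizontally.\<close>

lemma critical_cyl:
  assumes \<eta>: "is_norm \<eta>" and y: "critical (cyl \<eta>) y"
  defines "r \<equiv> critical_radius (cyl \<eta>)"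
  shows "\<exists>z \<in> contact (cyl \<eta>) y. \<bar>(y *v z) $ Inr 1\<bar> = r"
    and "(\<exists>z \<in> contact (cyl \<eta>) y. \<eta> (hor (y *v z)) = r \<and> (y *v z) $ Inr 1 \<noteq> 0) \<or>
      (\<exists>z \<in> contact (cyl \<eta>) y. \<exists>z' \<in> contact (cyl \<eta>) y. (y *v z) $ Inr 1 = 0 \<and> (y *v z') $ Inr 1 = 0 \<and>
         cross2 (hor (y *v z)) (hor (y *v z')) \<noteq> 0)"
proof -
  note \<nu> = is_norm_cyl[OF \<eta>]
  have con: "cyl \<eta> (y *v z) = r" if "z \<in> contact (cyl \<eta>) y" for z using that by (simp add: contact_def r_def)
  have dich: "\<eta> (hor (y *v z)) = r \<or> \<bar>(y *v z) $ Inr 1\<bar> = r" if "z \<in> contact (cyl \<eta>) y" for z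
    using con[OF that] unfolding cyl_def by linarith
  show "\<exists>z \<in> contact (cyl \<eta>) y. \<bar>(y *v z) $ Inr 1\<bar> = r"
  proof (rule ccontr)
    assume "\<not> ?thesis"
    then have side: "\<eta> (hor (y *v z)) = r" if "z \<in> contact (cyl \<eta>) y" for z using dich that by blast
    \<comment> \<open>Compression of the vertical axis, which leaves the horizontal part of every
      vector alone.\<close>
    define X :: "real^(2+1)^(2+1)" where "X = (\<chi> k l. if k = Inr 1 \<and> l = Inr 1 then -1 else 0)"
    show False
    proof (rule no_infinitesimal_improvement[OF \<nu> y])
      show "trace X < 0" by (simp add: trace_def X_def sum_UNIV_Plus)
      fix z and u :: real assume z: "z \<in> contact (cyl \<eta>) y" "0 < u"
      have "(X *v v) $ Inl i = 0" for v i by (simp add: matrix_vector_mult_def X_def)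
      then have "hor (y *v z + u *\<^sub>R (X *v (y *v z))) = hor (y *v z)"
        by (simp add: vec_eq_iff forall_2)
      then have "r \<le> cyl \<eta> (y *v z + u *\<^sub>R (X *v (y *v z)))" using side[OF z(1)] by (simp add: cyl_def)
      then show "critical_radius (cyl \<eta>) \<le> cyl \<eta> (y *v z + u *\<^sub>R (X *v (y *v z)))" by (simp add: r_def)
    qed
  qed
  show "(\<exists>z \<in> contact (cyl \<eta>) y. \<eta> (hor (y *v z)) = r \<and> (y *v z) $ Inr 1 \<noteq> 0) \<or>
      (\<exists>z \<in> contact (cyl \<eta>) y. \<exists>z' \<in> contact (cyl \<eta>) y. (y *v z) $ Inr 1 = 0 \<and> (y *v z') $ Inr 1 = 0 \<and>
         cross2 (hor (y *v z)) (hor (y *v z')) \<noteq> 0)"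
  proof (rule ccontr)
    assume neg: "\<not> ?thesis"
    then have flat: "(y *v z) $ Inr 1 = 0" if "z \<in> contact (cyl \<eta>) y" "\<eta> (hor (y *v z)) = r" for z
      using that by blast
    \<comment> \<open>The lateral contacts are horizontal and, by assumption, pairwise parallel, so
      one direction \<open>w\<close> covers them all; if there are none, any \<open>w\<close>
      does.\<close>
    have "\<exists>w. w \<noteq> 0 \<and> (\<forall>z \<in> contact (cyl \<eta>) y. \<eta> (hor (y *v z)) = r \<longrightarrow> cross2 w (hor (y *v z)) = 0)"
    proof (cases "\<exists>z \<in> contact (cyl \<eta>) y. \<eta> (hor (y *v z)) = r")
      case True
      then obtain z0 where z0: "z0 \<in> contact (cyl \<eta>) y" "\<eta> (hor (y *v z0)) = r" by blast
      have "r > 0" unfolding r_def by (rule critical_radius_pos[OF \<nu>])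
      then have "hor (y *v z0) \<noteq> 0" using z0(2) is_norm_zero[OF \<eta>] by auto
      then show ?thesis using neg flat z0 by blast
    next
      case False
      then show ?thesis by (intro exI[of _ 1]) auto
    qed
    then obtain w where w: "w \<noteq> 0" "\<And>z. z \<in> contact (cyl \<eta>) y \<Longrightarrow> \<eta> (hor (y *v z)) = r \<Longrightarrow> cross2 w (hor (y *v z)) = 0"
      by blast
    \<comment> \<open>The horizontal normal of \<open>w\<close>: \<open>X\<close> compresses across
      \<open>w\<close>, which fixes the lateral contacts and the heights of the others.\<close>
    define n where "n k = (case k of Inl i \<Rightarrow> if i = 1 then - w$2 else w$1 | Inr j \<Rightarrow> 0)" for k :: "2 + 1"
    define X :: "real^(2+1)^(2+1)" where "X = (\<chi> k l. - n k * n l)"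
    have Xv: "(X *v v) $ k = - cross2 w (hor v) * n k" for v k
      by (simp add: matrix_vector_mult_def X_def sum_UNIV_Plus sum_2 n_def cross2_def algebra_simps)
    show False
    proof (rule no_infinitesimal_improvement[OF \<nu> y])
      have "w$1 \<noteq> 0 \<or> w$2 \<noteq> 0" using w(1) by (auto simp: vec_eq_iff forall_2)
      then have "w$1 * w$1 + w$2 * w$2 > 0" by (metis sum_squares_gt_zero_iff)
      then show "trace X < 0" by (simp add: trace_def X_def sum_UNIV_Plus sum_2 n_def)
      fix z and u :: real assume z: "z \<in> contact (cyl \<eta>) y" "0 < u"
      show "critical_radius (cyl \<eta>) \<le> cyl \<eta> (y *v z + u *\<^sub>R (X *v (y *v z)))"
      proof (cases "\<eta> (hor (y *v z)) = r")
        case True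
        then have "X *v (y *v z) = 0" using w(2)[OF z(1)] by (simp add: vec_eq_iff Xv)
        then show ?thesis using con[OF z(1)] by (simp add: r_def)
      next
        case False
        then have "\<bar>(y *v z) $ Inr 1\<bar> = r" using dich[OF z(1)] by blast
        moreover have "(y *v z + u *\<^sub>R (X *v (y *v z))) $ Inr 1 = (y *v z) $ Inr 1" by (simp add: Xv n_def)
        ultimately have "r \<le> cyl \<eta> (y *v z + u *\<^sub>R (X *v (y *v z)))" unfolding cyl_def by linarith
        then show ?thesis by (simp only: r_def)
      qed
    qed
  qed
qed

text \<open>On a diagonal, two members of \<open>S\<close> are at most one step apart.\<close>

lemma card_antichain_le:
  fixes S :: "(nat \<times> nat) set" and e1 e2 :: int
  assumes S: "S \<subseteq> {..<M1} \<times> {..<M2}" and e: "e1 = 1 \<or> e1 = -1" "e2 = 1 \<or> e2 = -1"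
    and anti: "\<And>i j i' j'. (i,j) \<in> S \<Longrightarrow> (i',j') \<in> S \<Longrightarrow>
       \<not> (2 \<le> e1 * (int i' - int i) \<and> 2 \<le> e2 * (int j' - int j))"
  shows "card S \<le> 4 * (M1 + M2) + 2"
proof -
  \<comment> \<open>Diagonal and parity: two members with the same value differ by an even number of
    steps along a diagonal, and by fewer than 2.\<close>
  define f where "f = (\<lambda>(i,j). (e1 * int i - e2 * int j, i mod 2))"
  define R where "R = {- int (M1 + M2) .. int (M1 + M2)} \<times> {0, 1::nat}"
  have "inj_on f S"
  proof (rule inj_onI, clarify)
    fix i j i' j' assume S: "(i,j) \<in> S" "(i',j') \<in> S" and eq: "f (i,j) = f (i',j')"
    have d: "e1 * (int i' - int i) = e2 * (int j' - int j)" and p: "i mod 2 = i' mod 2"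
      using eq by (auto simp: f_def algebra_simps)
    have "even (int i' - int i)" using p by presburger
    moreover have "\<not> 2 \<le> e1 * (int i' - int i)" using anti[OF S] d by auto
    moreover have "e1 * (int i - int i') = e2 * (int j - int j')" using d by (simp add: algebra_simps)
    then have "\<not> 2 \<le> e1 * (int i - int i')" using anti[OF S(2,1)] by auto
    ultimately have "even (int i' - int i)" "\<not> 2 \<le> int i' - int i" "\<not> 2 \<le> int i - int i'" using e(1) by auto
    then have "int i' = int i" by presburger
    then show "i = i' \<and> j = j'" using d e(2) by auto
  qed
  moreover have "f ` S \<subseteq> R"
  proof (rule image_subsetI, clarify)
    fix i j assume "(i,j) \<in> S"
    then have "i < M1" "j < M2" using S by auto
    then show "f (i,j) \<in> R" using e unfolding f_def R_def by auto
  qed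
  ultimately have "card S \<le> card R" unfolding R_def by (intro card_inj_on_le) auto
  also have "card R = 4 * (M1 + M2) + 2" unfolding R_def by (simp add: card_cartesian_product)
  finally show ?thesis .
qed

text \<open>Separate \<open>x\<close> from the convex set where \<open>g < r\<close>. A point with
  \<open>g x' = r\<close> is reached from inside along the segment from the centre
  \<open>x0\<close>, where \<open>g\<close> vanishes; the centre exists because \<open>ka\<close>
  and \<open>kb\<close> are nonzero.\<close>

lemma supporting_functional:
  fixes \<eta> :: "real^2 \<Rightarrow> real" and ua ub ka kb r :: real
  assumes \<eta>: "is_norm \<eta>" and k: "ka \<noteq> 0" "kb \<noteq> 0" and r: "r > 0"
  defines "g \<equiv> \<lambda>x::real^2. \<eta> (vector [ua + ka * x$1, ub + kb * x$2])"
  assumes x: "g x = r"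
  shows "\<exists>n. n \<noteq> 0 \<and> (\<forall>x'. g x' \<le> r \<longrightarrow> n \<bullet> x' \<le> n \<bullet> x)"
proof -
  define \<phi> where "\<phi> x = (vector [ua + ka * x$1, ub + kb * x$2] :: real^2)" for x :: "real^2"
  have aff: "\<phi> ((1 - t) *\<^sub>R a + t *\<^sub>R b) = (1 - t) *\<^sub>R \<phi> a + t *\<^sub>R \<phi> b" for t a b
    by (simp add: vec_eq_iff forall_2 \<phi>_def algebra_simps)
  have cvx: "g ((1 - t) *\<^sub>R a + t *\<^sub>R b) \<le> (1 - t) * g a + t * g b" if "0 \<le> t" "t \<le> 1" for t a b
    using is_normD(4)[OF \<eta>, of "(1 - t) *\<^sub>R \<phi> a" "t *\<^sub>R \<phi> b"] that
    unfolding g_def \<phi>_def[symmetric] aff is_normD(3)[OF \<eta>] by simp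
  define K where "K = {x. g x < r}"
  define x0 :: "real^2" where "x0 = vector [- ua / ka, - ub / kb]"
  have "\<phi> x0 = 0" using k by (simp add: \<phi>_def x0_def vec_eq_iff forall_2)
  then have g0: "g x0 = 0" unfolding g_def \<phi>_def[symmetric] by (simp add: is_norm_zero[OF \<eta>])
  have "convex K"
  proof (rule convexI)
    fix a b and s t :: real assume ab: "a \<in> K" "b \<in> K" and st: "0 \<le> s" "0 \<le> t" "s + t = 1"
    have s: "s = 1 - t" using st by simp
    have "g (s *\<^sub>R a + t *\<^sub>R b) \<le> (1 - t) * g a + t * g b" unfolding s using st by (intro cvx) auto
    also have "\<dots> < r"
    proof (cases "t = 0")
      case False
      then have "t * g b < t * r" using ab st by (simp add: K_def)
      moreover have "(1 - t) * g a \<le> (1 - t) * r" using ab st by (intro mult_left_mono) (auto simp: K_def)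
      ultimately show ?thesis by (simp add: algebra_simps)
    qed (use ab in \<open>simp add: K_def\<close>)
    finally show "s *\<^sub>R a + t *\<^sub>R b \<in> K" by (simp add: K_def)
  qed
  moreover have "x0 \<in> K" using g0 r by (simp add: K_def)
  moreover have "K \<inter> {x} = {}" using x by (simp add: K_def)
  ultimately obtain n b where n: "n \<noteq> 0" "\<forall>a\<in>K. n \<bullet> a \<le> b" "\<forall>a\<in>{x}. b \<le> n \<bullet> a"
    using separating_hyperplane_sets[of K "{x}"] by (metis convex_singleton empty_iff insert_not_empty)
  have nK: "n \<bullet> a \<le> n \<bullet> x" if "a \<in> K" for a using n that by fastforce
  have "n \<bullet> x' \<le> n \<bullet> x" if x': "g x' \<le> r" for x'
  proof (rule ccontr)
    assume "\<not> n \<bullet> x' \<le> n \<bullet> x"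
    define p q m where "p = n \<bullet> x0" and "q = n \<bullet> x'" and "m = n \<bullet> x"
    have qm: "q > m" "p \<le> m" using \<open>\<not> n \<bullet> x' \<le> n \<bullet> x\<close> nK[OF \<open>x0 \<in> K\<close>] by (auto simp: p_def q_def m_def)
    \<comment> \<open>Gives up half of the excess: the point \<open>a\<close> is inside the sublevel
      set and still beyond \<open>x\<close>.\<close>
    define e where "e = (q - m) / (2 * (q - p))"
    have e: "0 < e" "e \<le> 1/2" "e * (q - p) = (q - m) / 2" using qm by (auto simp: e_def field_simps)
    define a where "a = (1 - (1 - e)) *\<^sub>R x0 + (1 - e) *\<^sub>R x'"
    have "g a \<le> (1 - (1 - e)) * g x0 + (1 - e) * g x'" unfolding a_def using e by (intro cvx) auto
    also have "\<dots> \<le> (1 - e) * r" using g0 x' e by (simp add: mult_left_mono)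
    also have "\<dots> < r" using e r by simp
    finally have "n \<bullet> a \<le> m" using nK[of a] by (simp add: K_def m_def)
    moreover have "n \<bullet> a = q - e * (q - p)"
      by (simp add: a_def inner_add_right inner_scaleR_right p_def q_def algebra_simps)
    ultimately have "q - (q - m) / 2 \<le> m" unfolding e(3) by simp
    then show False using qm by (simp add: field_simps)
  qed
  then show ?thesis using n(1) by blast
qed

text \<open>A supporting functional of \<open>\<eta>\<close> at a point of the level set has one of four sign patterns; the
  cells that belong to one pattern form an antichain for the corresponding diagonal order.\<close>

lemma card_cells_curve:
  fixes \<eta> :: "real^2 \<Rightarrow> real" and w :: "2 \<times> 1 \<Rightarrow> real" and u1 u2 k1 k2 r T :: real
  assumes \<eta>: "is_norm \<eta>" and k: "k1 \<noteq> 0" "k2 \<noteq> 0" and r: "r > 0"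
  defines "M \<equiv> \<lambda>l. nat \<lfloor>exp (T * w l)\<rfloor>"
  shows "card {c\<in>cells w T. \<exists>b\<in>wbox w T (child w T 0 c). \<eta> (vector [u1 + k1 * b$1$1, u2 + k2 * b$2$1]) = r}
    \<le> 16 * (M (1,1) + M (2,1)) + 8"
proof -
  define H where "H = {c\<in>cells w T. \<exists>b\<in>wbox w T (child w T 0 c). \<eta> (vector [u1 + k1 * b$1$1, u2 + k2 * b$2$1]) = r}"
  define g where "g x = \<eta> (vector [u1 + k1 * x$1, u2 + k2 * x$2])" for x :: "real^2"
  define Q where "Q c x n \<longleftrightarrow> g x = r \<and> n \<noteq> 0 \<and> (\<forall>x'. g x' \<le> r \<longrightarrow> n \<bullet> x' \<le> n \<bullet> x) \<and>
     (\<forall>i. real (c (i,1)) * exp (- T * w (i,1)) \<le> x$i \<and> x$i \<le> (real (c (i,1)) + 1) * exp (- T * w (i,1)))" for c :: "2 \<times> 1 \<Rightarrow> nat" and x n :: "real^2"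
  have "\<forall>c\<in>H. \<exists>p. Q c (fst p) (snd p)"
  proof
    fix c assume "c \<in> H"
    then obtain b where b: "b \<in> wbox w T (child w T 0 c)" "\<eta> (vector [u1 + k1 * b$1$1, u2 + k2 * b$2$1]) = r"
      unfolding H_def by blast
    define x :: "real^2" where "x = (\<chi> i. b$i$1)"
    have gx: "g x = r" using b(2) by (simp add: g_def x_def)
    obtain n where n: "n \<noteq> 0" "\<forall>x'. g x' \<le> r \<longrightarrow> n \<bullet> x' \<le> n \<bullet> x"
      using supporting_functional[OF \<eta> k r, where ua = u1 and ub = u2 and x = x] gx unfolding g_def by blast
    have "\<forall>i. real (c (i,1)) * exp (- T * w (i,1)) \<le> x$i \<and> x$i \<le> (real (c (i,1)) + 1) * exp (- T * w (i,1))"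
      using b(1) unfolding wbox_def child_def x_def by (auto simp: distrib_right)
    then have "Q c x n" using gx n unfolding Q_def by blast
    then show "\<exists>p. Q c (fst p) (snd p)" by (intro exI[of _ "(x, n)"]) simp
  qed
  from bchoice[OF this] obtain p where p: "\<forall>c\<in>H. Q c (fst (p c)) (snd (p c))" ..
  define x n where "x c = fst (p c)" and "n c = snd (p c)" for c
  have xn: "\<And>c. c \<in> H \<Longrightarrow> g (x c) = r" "\<And>c. c \<in> H \<Longrightarrow> n c \<noteq> 0"
    "\<And>c x'. c \<in> H \<Longrightarrow> g x' \<le> r \<Longrightarrow> n c \<bullet> x' \<le> n c \<bullet> x c"
    "\<And>c i. c \<in> H \<Longrightarrow> real (c (i,1)) * exp (- T * w (i,1)) \<le> x c$i"
    "\<And>c i. c \<in> H \<Longrightarrow> x c$i \<le> (real (c (i,1)) + 1) * exp (- T * w (i,1))"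
    using p unfolding Q_def x_def n_def by blast+
  \<comment> \<open>The sign of a coordinate of the functional, with 0 counted as positive.\<close>
  define sg :: "bool \<Rightarrow> int" where "sg p = (if p then 1 else -1)" for p
  define cl where "cl p q = {c\<in>H. (p \<longleftrightarrow> 0 \<le> n c $ 1) \<and> (q \<longleftrightarrow> 0 \<le> n c $ 2)}" for p q
  define pr where "pr c = (c (1,1), c (2,1))" for c :: "2 \<times> 1 \<Rightarrow> nat"
  have injpr: "inj pr"
  proof (rule injI, rule ext)
    fix c d and l :: "2 \<times> 1" assume eq: "pr c = pr d"
    obtain k where k: "l = (k, 1)" by (cases l) auto
    show "c l = d l" using eq exhaust_2[of k] unfolding k pr_def by auto
  qed
  have cl: "card (cl p q) \<le> 4 * (M (1,1) + M (2,1)) + 2" for p q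
  proof -
    have "card (pr ` cl p q) \<le> 4 * (M (1,1) + M (2,1)) + 2"
    proof (rule card_antichain_le[of _ _ _ "sg p" "sg q"])
      show "pr ` cl p q \<subseteq> {..<M (1,1)} \<times> {..<M (2,1)}"
        unfolding cl_def H_def pr_def M_def cells_iff by auto
      show "sg p = 1 \<or> sg p = -1" "sg q = 1 \<or> sg q = -1" by (auto simp: sg_def)
      fix i j i' j' assume ij: "(i,j) \<in> pr ` cl p q" and ij': "(i',j') \<in> pr ` cl p q"
      obtain c where c: "c \<in> cl p q" "c (1,1) = i" "c (2,1) = j" using ij by (auto simp: pr_def)
      obtain d where d: "d \<in> cl p q" "d (1,1) = i'" "d (2,1) = j'" using ij' by (auto simp: pr_def)
      have cH: "c \<in> H" "d \<in> H" using c d by (auto simp: cl_def)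
      \<comment> \<open>Cells are closed and neighbours share points, so a strict inequality of
        coordinates takes an index gap of 2.\<close>
      have step: "0 < e * (x d $ m - x c $ m)" if "e = 1 \<or> e = -1" "2 \<le> e * (int (d (m,1)) - int (c (m,1)))" for e :: int and m
      proof -
        define E where "E = exp (- T * w (m,1))"
        have E: "E > 0" by (simp add: E_def)
        have b: "real (c (m,1)) * E \<le> x c $ m" "x c $ m \<le> (real (c (m,1)) + 1) * E"
          "real (d (m,1)) * E \<le> x d $ m" "x d $ m \<le> (real (d (m,1)) + 1) * E"
          using xn(4,5) cH unfolding E_def by blast+
        from that(1) show ?thesis
        proof
          assume e: "e = 1"
          then have "int (c (m,1)) + 2 \<le> int (d (m,1))" using that(2) by simp
          then have "real (c (m,1)) + 1 < real (d (m,1))" by linarith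
          then have "(real (c (m,1)) + 1) * E < real (d (m,1)) * E" using E by simp
          then show ?thesis using b e by simp
        next
          assume e: "e = -1"
          then have "int (d (m,1)) + 2 \<le> int (c (m,1))" using that(2) by simp
          then have "real (d (m,1)) + 1 < real (c (m,1))" by linarith
          then have "(real (d (m,1)) + 1) * E < real (c (m,1)) * E" using E by simp
          then show ?thesis using b e by simp
        qed
      qed
      show "\<not> (2 \<le> sg p * (int i' - int i) \<and> 2 \<le> sg q * (int j' - int j))"
      proof
        assume A: "2 \<le> sg p * (int i' - int i) \<and> 2 \<le> sg q * (int j' - int j)"
        have 1: "0 < sg p * (x d $ 1 - x c $ 1)" by (rule step) (use A c d in \<open>auto simp: sg_def\<close>)
        have 2: "0 < sg q * (x d $ 2 - x c $ 2)" by (rule step) (use A c d in \<open>auto simp: sg_def\<close>)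
        have "n c \<bullet> x d \<le> n c \<bullet> x c" using xn(3)[OF cH(1), of "x d"] xn(1)[OF cH(2)] by simp
        then have le: "n c $ 1 * (x d $ 1 - x c $ 1) + n c $ 2 * (x d $ 2 - x c $ 2) \<le> 0"
          by (simp add: inner_vec_def sum_2 algebra_simps)
        have n1: "0 \<le> sg p * n c $ 1" "0 \<le> sg q * n c $ 2" using c(1) by (auto simp: cl_def sg_def)
        have "n c $ 1 \<noteq> 0 \<or> n c $ 2 \<noteq> 0" using xn(2)[OF cH(1)] by (auto simp: vec_eq_iff forall_2)
        moreover have t1: "0 \<le> n c $ 1 * (x d $ 1 - x c $ 1)" "n c $ 1 \<noteq> 0 \<Longrightarrow> 0 < n c $ 1 * (x d $ 1 - x c $ 1)"
          using n1(1) 1 by (cases p; auto simp: sg_def zero_le_mult_iff zero_less_mult_iff)+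
        moreover have t2: "0 \<le> n c $ 2 * (x d $ 2 - x c $ 2)" "n c $ 2 \<noteq> 0 \<Longrightarrow> 0 < n c $ 2 * (x d $ 2 - x c $ 2)"
          using n1(2) 2 by (cases q; auto simp: sg_def zero_le_mult_iff zero_less_mult_iff)+
        ultimately show False using le by linarith
      qed
    qed
    moreover have "card (pr ` cl p q) = card (cl p q)" by (intro card_image inj_on_subset[OF injpr]) auto
    ultimately show ?thesis by simp
  qed
  have fin: "finite (cl p q)" for p q unfolding cl_def H_def by simp
  have "H \<subseteq> cl True True \<union> cl True False \<union> (cl False True \<union> cl False False)" unfolding cl_def by blast
  then have "card H \<le> card (cl True True \<union> cl True False \<union> (cl False True \<union> cl False False))"
    by (intro card_mono) (use fin in auto)
  also have "\<dots> \<le> (card (cl True True) + card (cl True False)) + (card (cl False True) + card (cl False False))"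
    by (intro order_trans[OF card_Un_le] add_mono card_Un_le)
  also have "\<dots> \<le> 16 * (M (1,1) + M (2,1)) + 8"
    using cl[of True True] cl[of True False] cl[of False True] cl[of False False] by linarith
  finally show ?thesis unfolding H_def .
qed

section \<open>Badly approximable vectors in the plane\<close>

text \<open>The action of \<open>flow\<close> for m = 2 and n = 1, written in \<open>real^3\<close>,
  where cross products are available.\<close>

definition prim :: "real^2 \<Rightarrow> real \<Rightarrow> real^1^2 \<Rightarrow> real^3 \<Rightarrow> real^3" where
  "prim \<alpha> s A z = vector [exp (s * \<alpha>$1) * (z$1 + A$1$1 * z$3), exp (s * \<alpha>$2) * (z$2 + A$2$1 * z$3), exp (- s) * z$3]"

text \<open>The inverse transpose of the matrix of \<open>prim\<close>, hence the flow on the dual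
  lattice.\<close>

definition dual :: "real^2 \<Rightarrow> real \<Rightarrow> real^1^2 \<Rightarrow> real^3 \<Rightarrow> real^3" where
  "dual \<alpha> s A q = vector [exp (- s * \<alpha>$1) * q$1, exp (- s * \<alpha>$2) * q$2, exp s * (q$3 - A$1$1 * q$1 - A$2$1 * q$2)]"

text \<open>Bad approximability at time \<open>s\<close>, required of the lattice and of its dual.\<close>

definition ba :: "real \<Rightarrow> real^2 \<Rightarrow> real \<Rightarrow> real^1^2 \<Rightarrow> bool" where
  "ba \<delta> \<alpha> s A \<longleftrightarrow> (\<forall>z\<in>int_vectors. z \<noteq> 0 \<longrightarrow>
     (\<exists>i. \<delta> \<le> \<bar>prim \<alpha> s A z $ i\<bar>) \<and> (\<exists>i. \<delta> \<le> \<bar>dual \<alpha> s A z $ i\<bar>))"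

lemma cross3_nth:
  "cross3 a b $ 1 = a$2 * b$3 - a$3 * b$2" "cross3 a b $ 2 = a$3 * b$1 - a$1 * b$3"
  "cross3 a b $ 3 = a$1 * b$2 - a$2 * b$1"
  by (auto simp: cross3_def)

lemma exp_weights:
  assumes "\<alpha>$1 + \<alpha>$2 = (1::real)"
  shows "exp s = exp (s * \<alpha>$1) * exp (s * \<alpha>$2)"
proof -
  have "s = s * \<alpha>$1 + s * \<alpha>$2" using assms by (simp flip: distrib_left)
  then show ?thesis by (metis exp_add)
qed

text \<open>A matrix of determinant 1 acts on cross products by its inverse transpose.\<close>

lemma cross3_prim:
  assumes "\<alpha>$1 + \<alpha>$2 = 1"
  shows "cross3 (prim \<alpha> s A z) (prim \<alpha> s A z') = dual \<alpha> s A (cross3 z z')"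
proof -
  define a b where "a = exp (s * \<alpha>$1)" and "b = exp (s * \<alpha>$2)"
  have ab: "a \<noteq> 0" "b \<noteq> 0" by (auto simp: a_def b_def)
  have e: "exp s = a * b" "exp (- s) = inverse (a * b)" "exp (- s * \<alpha>$1) = inverse a" "exp (- s * \<alpha>$2) = inverse b"
    using exp_weights[OF assms, of s] by (auto simp: a_def b_def exp_minus)
  show ?thesis
    unfolding vec_eq_iff forall_3 cross3_nth prim_def dual_def e a_def[symmetric] b_def[symmetric] vector_3 cross3_nth
    using ab by (simp add: field_simps)
qed

lemma cross3_dual:
  assumes "\<alpha>$1 + \<alpha>$2 = 1"
  shows "cross3 (dual \<alpha> s A q) (dual \<alpha> s A q') = prim \<alpha> s A (cross3 q q')"
proof -
  define a b where "a = exp (s * \<alpha>$1)" and "b = exp (s * \<alpha>$2)"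
  have ab: "a \<noteq> 0" "b \<noteq> 0" by (auto simp: a_def b_def)
  have e: "exp s = a * b" "exp (- s) = inverse (a * b)" "exp (- s * \<alpha>$1) = inverse a" "exp (- s * \<alpha>$2) = inverse b"
    using exp_weights[OF assms, of s] by (auto simp: a_def b_def exp_minus)
  show ?thesis
    unfolding vec_eq_iff forall_3 cross3_nth prim_def dual_def e a_def[symmetric] b_def[symmetric] vector_3 cross3_nth
    using ab by (simp add: field_simps)
qed

lemma int_vectors_cross3: "z \<in> int_vectors \<Longrightarrow> z' \<in> int_vectors \<Longrightarrow> cross3 z z' \<in> int_vectors"
  unfolding int_vectors_def by (simp add: forall_3 cross3_nth)

lemma prim_zero_iff: "prim \<alpha> s A z = 0 \<longleftrightarrow> z = 0"
  unfolding vec_eq_iff forall_3 prim_def by auto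

lemma dual_zero_iff: "dual \<alpha> s A z = 0 \<longleftrightarrow> z = 0"
  unfolding vec_eq_iff forall_3 dual_def by auto

lemma abs_cross_component_less:
  fixes a b c d :: real
  assumes "\<bar>a\<bar> \<le> m" "\<bar>b\<bar> \<le> m" "\<bar>c\<bar> \<le> m" "\<bar>d\<bar> \<le> m" "2 * (m * m) < \<delta>"
  shows "\<bar>a * b - c * d\<bar> < \<delta>"
proof -
  have "\<bar>a * b\<bar> \<le> m * m" "\<bar>c * d\<bar> \<le> m * m" unfolding abs_mult using assms by (auto intro!: mult_mono)
  then show ?thesis using assms(5) by linarith
qed

lemma cross3_small:
  fixes a b :: "real^3"
  assumes "\<And>i. \<bar>a$i\<bar> \<le> m" "\<And>i. \<bar>b$i\<bar> \<le> m" "2 * (m * m) < \<delta>"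
  shows "\<bar>cross3 a b $ i\<bar> < \<delta>"
proof -
  have "\<forall>i. \<bar>cross3 a b $ i\<bar> < \<delta>" unfolding forall_3 cross3_nth
    by (intro conjI abs_cross_component_less[of _ m] assms)
  then show ?thesis ..
qed

text \<open>Simplex lemma: the cross product of two lattice vectors of size at most \<open>m\<close>
  has all coordinates below \<open>\<delta>\<close>, and it belongs to the dual lattice, whose
  nonzero vectors are not that short.\<close>

lemma ba_parallel_prim:
  assumes \<alpha>: "\<alpha>$1 + \<alpha>$2 = 1" and ba: "ba \<delta> \<alpha> s A" and z: "z \<in> int_vectors" "z' \<in> int_vectors"
    and m: "\<And>i. \<bar>prim \<alpha> s A z $ i\<bar> \<le> m" "\<And>i. \<bar>prim \<alpha> s A z' $ i\<bar> \<le> m" "2 * (m * m) < \<delta>"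
  shows "cross3 (prim \<alpha> s A z) (prim \<alpha> s A z') = 0"
proof (rule ccontr)
  assume "cross3 (prim \<alpha> s A z) (prim \<alpha> s A z') \<noteq> 0"
  then have "cross3 z z' \<noteq> 0" unfolding cross3_prim[OF \<alpha>] dual_zero_iff .
  then obtain i where "\<delta> \<le> \<bar>dual \<alpha> s A (cross3 z z') $ i\<bar>"
    using ba int_vectors_cross3[OF z] unfolding ba_def by blast
  then show False using cross3_small[OF m, of i] unfolding cross3_prim[OF \<alpha>] by simp
qed

lemma ba_parallel_dual:
  assumes \<alpha>: "\<alpha>$1 + \<alpha>$2 = 1" and ba: "ba \<delta> \<alpha> s A" and z: "z \<in> int_vectors" "z' \<in> int_vectors"
    and m: "\<And>i. \<bar>dual \<alpha> s A z $ i\<bar> \<le> m" "\<And>i. \<bar>dual \<alpha> s A z' $ i\<bar> \<le> m" "2 * (m * m) < \<delta>"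
  shows "cross3 (dual \<alpha> s A z) (dual \<alpha> s A z') = 0"
proof (rule ccontr)
  assume "cross3 (dual \<alpha> s A z) (dual \<alpha> s A z') \<noteq> 0"
  then have "cross3 z z' \<noteq> 0" unfolding cross3_dual[OF \<alpha>] prim_zero_iff .
  then obtain i where "\<delta> \<le> \<bar>prim \<alpha> s A (cross3 z z') $ i\<bar>"
    using ba int_vectors_cross3[OF z] unfolding ba_def by blast
  then show False using cross3_small[OF m, of i] unfolding cross3_dual[OF \<alpha>] by simp
qed

section \<open>Cells in a strip\<close>

lemma card_nat_near: "finite {m::nat. \<bar>real m - x\<bar> \<le> y}" "y \<ge> 0 \<Longrightarrow> real (card {m::nat. \<bar>real m - x\<bar> \<le> y}) \<le> 2 * y + 1"
proof -
  have sub: "int ` {m::nat. \<bar>real m - x\<bar> \<le> y} \<subseteq> {\<lceil>x - y\<rceil>..\<lfloor>x + y\<rfloor>}"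
    by (auto simp: ceiling_le_iff le_floor_iff abs_le_iff)
  then have "finite (int ` {m::nat. \<bar>real m - x\<bar> \<le> y})" by (rule finite_subset) simp
  then show "finite {m::nat. \<bar>real m - x\<bar> \<le> y}" by (rule finite_imageD) (simp add: inj_on_def)
  assume y: "y \<ge> 0"
  have "card {m::nat. \<bar>real m - x\<bar> \<le> y} = card (int ` {m::nat. \<bar>real m - x\<bar> \<le> y})"
    by (rule card_image[symmetric]) (simp add: inj_on_def)
  also have "\<dots> \<le> card {\<lceil>x - y\<rceil>..\<lfloor>x + y\<rfloor>}" by (rule card_mono[OF _ sub]) simp
  also have "\<dots> = nat (\<lfloor>x + y\<rfloor> - \<lceil>x - y\<rceil> + 1)" by simp
  finally have "real (card {m::nat. \<bar>real m - x\<bar> \<le> y}) \<le> real (nat (\<lfloor>x + y\<rfloor> - \<lceil>x - y\<rceil> + 1))"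
    by (rule of_nat_mono)
  also have "\<dots> \<le> 2 * y + 1" using y by linarith
  finally show "real (card {m::nat. \<bar>real m - x\<bar> \<le> y}) \<le> 2 * y + 1" .
qed

lemma card_cells_strip:
  fixes w :: "2 \<times> 1 \<Rightarrow> real"
  assumes i: "i \<noteq> i'" and y: "y \<ge> 0"
  shows "real (card {c\<in>cells w T. \<bar>real (c (i,1)) - F (c (i',1))\<bar> \<le> y}) \<le> (2 * y + 1) * real (nat \<lfloor>exp (T * w (i',1))\<rfloor>)"
proof -
  define M where "M = nat \<lfloor>exp (T * w (i',1))\<rfloor>"
  let ?S = "{c\<in>cells w T. \<bar>real (c (i,1)) - F (c (i',1))\<bar> \<le> y}"
  let ?R = "SIGMA n:{..<M}. {m::nat. \<bar>real m - F n\<bar> \<le> y}"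
  define pr where "pr c = (c (i',1), c (i,1))" for c :: "2 \<times> 1 \<Rightarrow> nat"
  have "inj pr"
  proof (rule injI, rule ext)
    fix c d and l :: "2 \<times> 1" assume eq: "pr c = pr d"
    obtain k where k: "l = (k, 1)" by (cases l) auto
    have "k = i \<or> k = i'" using i exhaust_2[of k] exhaust_2[of i] exhaust_2[of i'] by auto
    then show "c l = d l" using eq unfolding k pr_def by auto
  qed
  moreover have "pr ` ?S \<subseteq> ?R" unfolding pr_def M_def cells_iff by auto
  ultimately have "card ?S \<le> card ?R"
    by (intro card_inj_on_le[of pr]) (auto simp: card_nat_near intro: inj_on_subset)
  also have "card ?R = (\<Sum>n<M. card {m::nat. \<bar>real m - F n\<bar> \<le> y})"
    by (subst card_SigmaI) (auto simp: card_nat_near)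
  finally have "real (card ?S) \<le> (\<Sum>n<M. real (card {m::nat. \<bar>real m - F n\<bar> \<le> y}))"
    using of_nat_mono[where 'a = real] by fastforce
  also have "\<dots> \<le> (\<Sum>n<M. 2 * y + 1)" by (intro sum_mono card_nat_near y)
  finally show ?thesis by (simp add: M_def mult.commute)
qed

section \<open>Children that lose bad approximability\<close>

context
  fixes \<alpha> :: "real^2" and \<beta> :: "real^1"
  assumes wv: "weight_vector \<alpha> \<beta>"
begin

lemma beta1: "\<beta>$1 = 1"
  using weight_vectorD(6)[OF wv] by simp

lemma alpha_sum: "\<alpha>$1 + \<alpha>$2 = 1"
  using weight_vectorD(5)[OF wv] by (simp add: sum_2)

lemma alpha_pos: "0 < \<alpha>$i"
  using weight_vectorD(1)[OF wv] .

lemma rate1: "rate \<alpha> \<beta> (i,1) = \<alpha>$i + 1"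
  by (simp add: rate_def beta1)

lemma child_nth:
  "child (rate \<alpha> \<beta>) (s + T) A c $ i $ 1 = A$i$1 + real (c (i,1)) * exp (- T * (\<alpha>$i + 1)) * exp (- s * (\<alpha>$i + 1))"
  by (simp add: child_def rate1 algebra_simps flip: exp_add)

text \<open>Passing from a corner to the corner of a child is the flow for time \<open>T\<close>
  whose parameter \<open>b\<close> is the position of the cell in the unit box.\<close>

lemma prim_child:
  fixes c T
  defines "b \<equiv> \<lambda>i. real (c (i,1)) * exp (- T * (\<alpha>$i + 1))"
  shows "prim \<alpha> (s + T) (child (rate \<alpha> \<beta>) (s + T) A c) z = vector
     [exp (T * \<alpha>$1) * (prim \<alpha> s A z $ 1 + b 1 * prim \<alpha> s A z $ 3),
      exp (T * \<alpha>$2) * (prim \<alpha> s A z $ 2 + b 2 * prim \<alpha> s A z $ 3), exp (- T) * prim \<alpha> s A z $ 3]"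
proof -
  have 1: "exp (- s * (\<alpha>$i + 1)) * exp (s * \<alpha>$i) = exp (- s)" for i
    unfolding exp_add[symmetric] by (simp add: algebra_simps)
  have e: "exp ((s + T) * \<alpha>$i) * (x + (a + b i * exp (- s * (\<alpha>$i + 1))) * y) =
      exp (T * \<alpha>$i) * (exp (s * \<alpha>$i) * (x + a * y) + b i * (exp (- s) * y))" for i x a y
    unfolding 1[of i, symmetric] distrib_right exp_add by (simp add: algebra_simps)
  have e3: "exp (- (s + T)) * x = exp (- T) * (exp (- s) * x)" for x
    unfolding mult.assoc[symmetric] exp_add[symmetric] by (simp add: algebra_simps)
  show ?thesis unfolding vec_eq_iff forall_3 vector_3 prim_def child_nth b_def
    by (intro conjI e[unfolded b_def] e3)
qed

lemma dual_child:
  fixes c T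
  defines "b \<equiv> \<lambda>i. real (c (i,1)) * exp (- T * (\<alpha>$i + 1))"
  shows "dual \<alpha> (s + T) (child (rate \<alpha> \<beta>) (s + T) A c) q = vector
     [exp (- T * \<alpha>$1) * dual \<alpha> s A q $ 1, exp (- T * \<alpha>$2) * dual \<alpha> s A q $ 2,
      exp T * (dual \<alpha> s A q $ 3 - b 1 * dual \<alpha> s A q $ 1 - b 2 * dual \<alpha> s A q $ 2)]"
proof -
  have e1: "exp (- (s + T) * a) * x = exp (- T * a) * (exp (- s * a) * x)" for a x
    unfolding mult.assoc[symmetric] exp_add[symmetric] by (simp add: algebra_simps)
  have 2: "exp s * exp (- s * (\<alpha>$i + 1)) = exp (- s * \<alpha>$i)" for i
    unfolding exp_add[symmetric] by (simp add: algebra_simps)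
  have e3: "exp (s + T) * (x - (a1 + b 1 * exp (- s * (\<alpha>$1 + 1))) * y1 - (a2 + b 2 * exp (- s * (\<alpha>$2 + 1))) * y2) =
      exp T * (exp s * (x - a1 * y1 - a2 * y2) - b 1 * (exp (- s * \<alpha>$1) * y1) - b 2 * (exp (- s * \<alpha>$2) * y2))" for x a1 a2 y1 y2
    unfolding 2[symmetric] exp_add by (simp add: algebra_simps)
  show ?thesis unfolding dual_def child_nth vector_3 vec_eq_iff forall_3 b_def
    by (intro conjI e1 e3[unfolded b_def])
qed

lemma cell_fraction:
  assumes "c \<in> cells (rate \<alpha> \<beta>) T"
  shows "0 \<le> real (c (i,1)) * exp (- T * (\<alpha>$i + 1))" "real (c (i,1)) * exp (- T * (\<alpha>$i + 1)) \<le> 1"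
proof -
  have "(real (c (i,1)) + 1) * exp (- T * (\<alpha>$i + 1)) \<le> 1"
    using cells_step[OF assms, of "(i,1)" 0] by (simp add: rate1)
  then show "real (c (i,1)) * exp (- T * (\<alpha>$i + 1)) \<le> 1" by (simp add: distrib_right)
      (smt (verit) exp_gt_zero)
qed simp

text \<open>All vectors that become short are parallel, because the cross product of two of them would be a
  short dual vector; so the first coordinate of a killed child is nearly determined by one slope.\<close>

lemma card_prim_short_children:
  assumes \<delta>: "\<delta> > 0" and ba: "ba \<delta> \<alpha> s A" and T: "T > 0" "exp (\<alpha>$1 * T) \<ge> 2" "exp (\<alpha>$2 * T) \<ge> 2"
    and \<delta>T: "18 * \<delta> * exp (2 * T) < 1"
  shows "real (card {c\<in>cells (rate \<alpha> \<beta>) T. \<exists>z\<in>int_vectors. z \<noteq> 0 \<and>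
      (\<forall>i. \<bar>prim \<alpha> (s + T) (child (rate \<alpha> \<beta>) (s + T) A c) z $ i\<bar> < \<delta>)})
    \<le> 7 * exp T * real (nat \<lfloor>exp (T * rate \<alpha> \<beta> (2,1))\<rfloor>)"
proof -
  define S where "S = {c\<in>cells (rate \<alpha> \<beta>) T. \<exists>z\<in>int_vectors. z \<noteq> 0 \<and>
      (\<forall>i. \<bar>prim \<alpha> (s + T) (child (rate \<alpha> \<beta>) (s + T) A c) z $ i\<bar> < \<delta>)}"
  define p where "p z i = prim \<alpha> s A z $ i" for z i
  define b where "b c i = real (c (i,1)) * exp (- T * (\<alpha>$i + 1))" for c :: "2 \<times> 1 \<Rightarrow> nat" and i
  have eT: "exp T \<ge> 1" using T by simp
  \<comment> \<open>If the third coordinate were below \<open>\<delta> / 3\<close>, the other two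
    would be below \<open>\<delta> / 2 + \<delta> / 3\<close>, and \<open>z\<close> would violate
    \<open>ba\<close> already at time \<open>s\<close>. The last bound is small enough for
    \<open>ba_parallel_prim\<close>.\<close>
  have danger: "\<bar>p z 1 + b c 1 * p z 3\<bar> < \<delta> * exp (- T * \<alpha>$1) \<and> \<delta> / 3 \<le> \<bar>p z 3\<bar> \<and> (\<forall>i. \<bar>p z i\<bar> \<le> 2 * \<delta> * exp T)"
    if c: "c \<in> cells (rate \<alpha> \<beta>) T" and z: "z \<in> int_vectors" "z \<noteq> 0"
      and sh: "\<forall>i. \<bar>prim \<alpha> (s + T) (child (rate \<alpha> \<beta>) (s + T) A c) z $ i\<bar> < \<delta>" for c z
  proof -
    have sh': "\<bar>exp (T * \<alpha>$1) * (p z 1 + b c 1 * p z 3)\<bar> < \<delta>" "\<bar>exp (T * \<alpha>$2) * (p z 2 + b c 2 * p z 3)\<bar> < \<delta>"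
      "\<bar>exp (- T) * p z 3\<bar> < \<delta>"
      using sh unfolding prim_child forall_3 vector_3 p_def b_def by auto
    have sm: "\<bar>x\<bar> < \<delta> * exp (- T * a)" if "\<bar>exp (T * a) * x\<bar> < \<delta>" for x a
    proof -
      have "exp (T * a) * \<bar>x\<bar> < \<delta>" using that by (simp add: abs_mult)
      then have "exp (- T * a) * (exp (T * a) * \<bar>x\<bar>) < exp (- T * a) * \<delta>" by (rule mult_strict_left_mono) simp
      moreover have "exp (- T * a) * exp (T * a) = 1" by (simp flip: exp_add)
      ultimately show ?thesis by (simp only: mult.assoc[symmetric] mult_1 mult.commute[of \<delta>])
    qed
    have 1: "\<bar>p z 1 + b c 1 * p z 3\<bar> < \<delta> * exp (- T * \<alpha>$1)" "\<bar>p z 2 + b c 2 * p z 3\<bar> < \<delta> * exp (- T * \<alpha>$2)"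
      using sm sh'(1,2) by blast+
    have 3: "\<bar>p z 3\<bar> < \<delta> * exp T" using sm[of "-1"] sh'(3) by simp
    have half: "\<delta> * exp (- T * \<alpha>$1) \<le> \<delta> / 2" "\<delta> * exp (- T * \<alpha>$2) \<le> \<delta> / 2"
    proof -
      have "exp (- T * a) \<le> 1 / 2" if "exp (a * T) \<ge> 2" for a
        using that by (simp add: exp_minus mult.commute field_simps)
      then show "\<delta> * exp (- T * \<alpha>$1) \<le> \<delta> / 2" "\<delta> * exp (- T * \<alpha>$2) \<le> \<delta> / 2"
        using T(2,3) \<delta> by (auto simp: mult_le_cancel_left_pos dest: mult_left_mono)
    qed
    have bz: "\<bar>b c i * p z 3\<bar> \<le> \<bar>p z 3\<bar>" for i
    proof -
      have "\<bar>b c i\<bar> * \<bar>p z 3\<bar> \<le> 1 * \<bar>p z 3\<bar>" using cell_fraction[OF c, of i] unfolding b_def by (intro mult_right_mono) auto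
      then show ?thesis by (simp add: abs_mult)
    qed
    have p12: "\<bar>p z 1\<bar> \<le> \<delta> / 2 + \<bar>p z 3\<bar>" "\<bar>p z 2\<bar> \<le> \<delta> / 2 + \<bar>p z 3\<bar>"
      using 1 half bz[of 1] bz[of 2] by linarith+
    have "\<delta> / 3 \<le> \<bar>p z 3\<bar>"
    proof (rule ccontr)
      assume n: "\<not> \<delta> / 3 \<le> \<bar>p z 3\<bar>"
      have "\<forall>i. \<bar>p z i\<bar> < \<delta>" unfolding forall_3 using p12 n \<delta> by linarith
      moreover obtain i where "\<delta> \<le> \<bar>p z i\<bar>" using ba z unfolding ba_def p_def by blast
      ultimately show False by (meson not_le)
    qed
    moreover have "\<delta> * 1 \<le> \<delta> * exp T" using eT \<delta> by (intro mult_left_mono) auto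
    then have "\<forall>i. \<bar>p z i\<bar> \<le> 2 * \<delta> * exp T" unfolding forall_3 using p12 3 \<delta> by linarith
    ultimately show ?thesis using 1 by blast
  qed
  show ?thesis
  proof (cases "S = {}")
    case False
    then obtain c0 z0 where c0: "c0 \<in> cells (rate \<alpha> \<beta>) T" "z0 \<in> int_vectors" "z0 \<noteq> 0"
      "\<forall>i. \<bar>prim \<alpha> (s + T) (child (rate \<alpha> \<beta>) (s + T) A c0) z0 $ i\<bar> < \<delta>" unfolding S_def by blast
    define \<zeta> where "\<zeta> = p z0 1 / p z0 3"
    note d0 = danger[OF c0]
    \<comment> \<open>All killing vectors share the slope \<open>\<zeta>\<close>. Dividing the first
      bound of \<open>danger\<close> by \<open>\<delta> / 3\<close> confines the position to
      \<open>3 * exp (- T * \<alpha>$1)\<close> around \<open>- \<zeta>\<close>, that is to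
      \<open>3 * exp T\<close> in the index.\<close>
    have "S \<subseteq> {c\<in>cells (rate \<alpha> \<beta>) T. \<bar>real (c (1,1)) - (\<lambda>_. - \<zeta> * exp (T * (\<alpha>$1 + 1))) (c (2,1))\<bar> \<le> 3 * exp T}"
    proof
      fix c assume "c \<in> S"
      then obtain z where c: "c \<in> cells (rate \<alpha> \<beta>) T" "z \<in> int_vectors" "z \<noteq> 0"
        "\<forall>i. \<bar>prim \<alpha> (s + T) (child (rate \<alpha> \<beta>) (s + T) A c) z $ i\<bar> < \<delta>" unfolding S_def by blast
      note d = danger[OF c]
      have "cross3 (prim \<alpha> s A z) (prim \<alpha> s A z0) = 0"
      proof (rule ba_parallel_prim[OF alpha_sum ba c(2) c0(2)])
        show "\<bar>prim \<alpha> s A z $ i\<bar> \<le> 2 * \<delta> * exp T" "\<bar>prim \<alpha> s A z0 $ i\<bar> \<le> 2 * \<delta> * exp T" for i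
          using d d0 unfolding p_def by auto
        have "exp (2 * T) = exp T * exp T" by (simp flip: exp_add)
        then have "18 * \<delta> * (exp T * exp T) < 1" using \<delta>T by simp
        then have "\<delta> * (18 * \<delta> * (exp T * exp T)) < \<delta> * 1" using \<delta> by (intro mult_strict_left_mono) auto
        moreover have "0 < \<delta> * (\<delta> * (exp T * exp T))" using \<delta> by simp
        moreover have "\<delta> * (18 * \<delta> * (exp T * exp T)) = 18 * (\<delta> * (\<delta> * (exp T * exp T)))"
          "2 * (2 * \<delta> * exp T * (2 * \<delta> * exp T)) = 8 * (\<delta> * (\<delta> * (exp T * exp T)))" by simp_all
        ultimately show "2 * (2 * \<delta> * exp T * (2 * \<delta> * exp T)) < \<delta>" by linarith
      qed
      then have "cross3 (prim \<alpha> s A z) (prim \<alpha> s A z0) $ 2 = 0" by simp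
      then have cr: "p z 3 * p z0 1 = p z 1 * p z0 3" unfolding cross3_nth p_def by simp
      have nz: "p z 3 \<noteq> 0" "p z0 3 \<noteq> 0" using d d0 \<delta> by auto
      have \<zeta>: "p z 1 = \<zeta> * p z 3" using cr nz by (simp add: \<zeta>_def field_simps)
      have "\<bar>(\<zeta> + b c 1) * p z 3\<bar> < \<delta> * exp (- T * \<alpha>$1)" using d unfolding \<zeta> by (simp add: distrib_right)
      then have "\<bar>\<zeta> + b c 1\<bar> * \<bar>p z 3\<bar> < \<delta> * exp (- T * \<alpha>$1)" by (simp add: abs_mult)
      moreover have "\<bar>\<zeta> + b c 1\<bar> * (\<delta> / 3) \<le> \<bar>\<zeta> + b c 1\<bar> * \<bar>p z 3\<bar>" using d by (intro mult_left_mono) auto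
      ultimately have "\<delta> * \<bar>\<zeta> + b c 1\<bar> \<le> \<delta> * (3 * exp (- T * \<alpha>$1))" by (simp add: mult_ac)
      then have "\<bar>\<zeta> + b c 1\<bar> \<le> 3 * exp (- T * \<alpha>$1)" using \<delta> by (simp only: mult_le_cancel_left_pos)
      then have "\<bar>\<zeta> + b c 1\<bar> * exp (T * (\<alpha>$1 + 1)) \<le> 3 * exp (- T * \<alpha>$1) * exp (T * (\<alpha>$1 + 1))"
        by (rule mult_right_mono) simp
      also have "\<dots> = 3 * exp T" by (simp add: mult.assoc algebra_simps flip: exp_add)
      also have "\<bar>\<zeta> + b c 1\<bar> * exp (T * (\<alpha>$1 + 1)) = \<bar>(\<zeta> + b c 1) * exp (T * (\<alpha>$1 + 1))\<bar>" by (simp add: abs_mult)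
      also have "(\<zeta> + b c 1) * exp (T * (\<alpha>$1 + 1)) = real (c (1,1)) - (- \<zeta> * exp (T * (\<alpha>$1 + 1)))"
        by (simp add: b_def distrib_right mult.assoc flip: exp_add)
      finally show "c \<in> {c\<in>cells (rate \<alpha> \<beta>) T. \<bar>real (c (1,1)) - (\<lambda>_. - \<zeta> * exp (T * (\<alpha>$1 + 1))) (c (2,1))\<bar> \<le> 3 * exp T}"
        using c(1) by simp
    qed
    then have "real (card S) \<le> real (card {c\<in>cells (rate \<alpha> \<beta>) T. \<bar>real (c (1,1)) - (\<lambda>_. - \<zeta> * exp (T * (\<alpha>$1 + 1))) (c (2,1))\<bar> \<le> 3 * exp T})"
      by (intro of_nat_mono card_mono) auto
    also have "\<dots> \<le> (2 * (3 * exp T) + 1) * real (nat \<lfloor>exp (T * rate \<alpha> \<beta> (2,1))\<rfloor>)"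
      by (rule card_cells_strip) auto
    also have "\<dots> \<le> 7 * exp T * real (nat \<lfloor>exp (T * rate \<alpha> \<beta> (2,1))\<rfloor>)"
      using eT by (intro mult_right_mono) auto
    finally show ?thesis unfolding S_def .
  qed (simp add: S_def[symmetric])
qed

text \<open>The killing dual vectors are parallel, since the cross product of two of them lies in
  the primal lattice. So the killed children lie near a single line in the plane of the parameter;
  solving for the coordinate \<open>i\<close> with the larger coefficient makes it a graph of slope
  at most 1 over the coordinate \<open>i'\<close>.\<close>

lemma card_dual_short_children:
  assumes \<delta>: "\<delta> > 0" and ba: "ba \<delta> \<alpha> s A" and T: "T > 0" "exp T \<ge> 2"
    and \<delta>T: "18 * \<delta> * exp (2 * T) < 1"
  shows "\<exists>i i'. i \<noteq> i' \<and> real (card {c\<in>cells (rate \<alpha> \<beta>) T. \<exists>q\<in>int_vectors. q \<noteq> 0 \<and>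
      (\<forall>i. \<bar>dual \<alpha> (s + T) (child (rate \<alpha> \<beta>) (s + T) A c) q $ i\<bar> < \<delta>)})
    \<le> 9 * exp (T * \<alpha>$i) * real (nat \<lfloor>exp (T * rate \<alpha> \<beta> (i',1))\<rfloor>)"
proof -
  define S where "S = {c\<in>cells (rate \<alpha> \<beta>) T. \<exists>q\<in>int_vectors. q \<noteq> 0 \<and>
      (\<forall>i. \<bar>dual \<alpha> (s + T) (child (rate \<alpha> \<beta>) (s + T) A c) q $ i\<bar> < \<delta>)}"
  define Q :: "real^3 \<Rightarrow> 2 \<Rightarrow> real" where "Q q i = (if i = 1 then dual \<alpha> s A q $ 1 else dual \<alpha> s A q $ 2)" for q i
  define R where "R q = dual \<alpha> s A q $ 3" for q
  define b where "b c i = real (c (i,1)) * exp (- T * (\<alpha>$i + 1))" for c :: "2 \<times> 1 \<Rightarrow> nat" and i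
  have Q12: "Q q 1 = dual \<alpha> s A q $ 1" "Q q 2 = dual \<alpha> s A q $ 2" for q by (auto simp: Q_def)
  have eT: "exp T \<ge> 1" using T by simp
  \<comment> \<open>With both values of \<open>Q\<close> below \<open>\<delta> / 4\<close> the third
    coordinate would be below \<open>\<delta> / 2 + \<delta> / 4 + \<delta> / 4\<close>, against
    \<open>ba\<close>. The bound \<open>3 * \<delta> * exp T\<close> explains the 18 in the
    hypothesis on \<open>\<delta>\<close>: it is \<open>2 * 3 * 3\<close>, from two products of such
    coordinates.\<close>
  have danger: "\<bar>R q - b c 1 * Q q 1 - b c 2 * Q q 2\<bar> < \<delta> * exp (- T) \<and> (\<exists>i. \<delta> / 4 \<le> \<bar>Q q i\<bar>) \<and>
      (\<forall>i. \<bar>dual \<alpha> s A q $ i\<bar> \<le> 3 * \<delta> * exp T)"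
    if c: "c \<in> cells (rate \<alpha> \<beta>) T" and q: "q \<in> int_vectors" "q \<noteq> 0"
      and sh: "\<forall>i. \<bar>dual \<alpha> (s + T) (child (rate \<alpha> \<beta>) (s + T) A c) q $ i\<bar> < \<delta>" for c q
  proof -
    have sh': "\<bar>exp (T * (- \<alpha>$1)) * Q q 1\<bar> < \<delta>" "\<bar>exp (T * (- \<alpha>$2)) * Q q 2\<bar> < \<delta>"
      "\<bar>exp (T * 1) * (R q - b c 1 * Q q 1 - b c 2 * Q q 2)\<bar> < \<delta>"
      using sh unfolding dual_child forall_3 vector_3 Q12 b_def R_def by auto
    have sm: "\<bar>x\<bar> < \<delta> * exp (- T * a)" if "\<bar>exp (T * a) * x\<bar> < \<delta>" for x a
    proof -
      have "exp (T * a) * \<bar>x\<bar> < \<delta>" using that by (simp add: abs_mult)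
      then have "exp (- T * a) * (exp (T * a) * \<bar>x\<bar>) < exp (- T * a) * \<delta>" by (rule mult_strict_left_mono) simp
      moreover have "exp (- T * a) * exp (T * a) = 1" by (simp flip: exp_add)
      ultimately show ?thesis by (simp only: mult.assoc[symmetric] mult_1 mult.commute[of \<delta>])
    qed
    have Qb: "\<bar>Q q i\<bar> < \<delta> * exp T" if "\<bar>exp (T * (- \<alpha>$i)) * Q q i\<bar> < \<delta>" for i
    proof -
      have "\<bar>Q q i\<bar> < \<delta> * exp (T * \<alpha>$i)" using sm[OF that] by simp
      also have "\<dots> \<le> \<delta> * exp (T * 1)"
        using weight_vectorD(3)[OF wv, of i] T \<delta> by (intro mult_left_mono) auto
      finally show ?thesis by simp
    qed
    have 1: "\<bar>Q q 1\<bar> < \<delta> * exp T" "\<bar>Q q 2\<bar> < \<delta> * exp T" using Qb sh'(1,2) by blast+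
    have 3: "\<bar>R q - b c 1 * Q q 1 - b c 2 * Q q 2\<bar> < \<delta> * exp (- T)" using sm[OF sh'(3)] by simp
    have bz: "\<bar>b c i * x\<bar> \<le> \<bar>x\<bar>" for i x
    proof -
      have "\<bar>b c i\<bar> * \<bar>x\<bar> \<le> 1 * \<bar>x\<bar>" using cell_fraction[OF c, of i] unfolding b_def by (intro mult_right_mono) auto
      then show ?thesis by (simp add: abs_mult)
    qed
    have "exp (- T) \<le> 1 / 2" using T(2) by (simp add: exp_minus field_simps)
    then have half: "\<delta> * exp (- T) \<le> \<delta> / 2" using mult_left_mono[of "exp (- T)" "1/2" \<delta>] \<delta> by simp
    have Rb: "\<bar>R q\<bar> \<le> \<delta> / 2 + \<bar>Q q 1\<bar> + \<bar>Q q 2\<bar>"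
      using 3 half bz[of 1 "Q q 1"] bz[of 2 "Q q 2"] by linarith
    have "\<exists>i. \<delta> / 4 \<le> \<bar>Q q i\<bar>"
    proof (rule ccontr)
      assume "\<not> ?thesis"
      then have n: "\<bar>Q q 1\<bar> < \<delta> / 4" "\<bar>Q q 2\<bar> < \<delta> / 4" by (auto simp: not_le)
      have "\<forall>i. \<bar>dual \<alpha> s A q $ i\<bar> < \<delta>" unfolding forall_3 Q12[symmetric] R_def[symmetric]
        using n Rb \<delta> by linarith
      moreover obtain i where "\<delta> \<le> \<bar>dual \<alpha> s A q $ i\<bar>" using ba q unfolding ba_def by blast
      ultimately show False by (meson not_le)
    qed
    moreover have "\<delta> * 1 \<le> \<delta> * exp T" using eT \<delta> by (intro mult_left_mono) auto
    then have "\<forall>i. \<bar>dual \<alpha> s A q $ i\<bar> \<le> 3 * \<delta> * exp T"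
      unfolding forall_3 Q12[symmetric] R_def[symmetric] using 1 Rb \<delta> by linarith
    ultimately show ?thesis using 3 by blast
  qed
  show ?thesis
  proof (cases "S = {}")
    case False
    then obtain c0 q0 where c0: "c0 \<in> cells (rate \<alpha> \<beta>) T" "q0 \<in> int_vectors" "q0 \<noteq> 0"
      "\<forall>i. \<bar>dual \<alpha> (s + T) (child (rate \<alpha> \<beta>) (s + T) A c0) q0 $ i\<bar> < \<delta>" unfolding S_def by blast
    note d0 = danger[OF c0]
    have "\<exists>i i'. i \<noteq> i' \<and> \<bar>Q q0 i'\<bar> \<le> \<bar>Q q0 i\<bar>"
    proof (cases "\<bar>Q q0 2\<bar> \<le> \<bar>Q q0 1\<bar>")
      case True
      then show ?thesis by (intro exI[of _ 1] exI[of _ 2]) simp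
    next
      case False
      then show ?thesis by (intro exI[of _ 2] exI[of _ 1]) simp
    qed
    then obtain i i' :: 2 where i: "i \<noteq> i'" "\<bar>Q q0 i'\<bar> \<le> \<bar>Q q0 i\<bar>" by blast
    have ii: "(i = 1 \<and> i' = 2) \<or> (i = 2 \<and> i' = 1)" using i(1) exhaust_2[of i] exhaust_2[of i'] by auto
    have split: "\<bar>Q q j\<bar> \<le> max \<bar>Q q i\<bar> \<bar>Q q i'\<bar>" for q j
      using ii exhaust_2[of j] by auto
    have q0i: "\<delta> / 4 \<le> \<bar>Q q0 i\<bar>" using d0 split[of q0] i(2) by (metis max.absorb1 order_trans)
    define \<zeta> \<xi> where "\<zeta> = R q0 / Q q0 i" and "\<xi> = Q q0 i' / Q q0 i"
    \<comment> \<open>The line, solved for the index of the cell in the coordinate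
      \<open>i\<close>.\<close>
    define F where "F m = (\<zeta> - real m * exp (- T * (\<alpha>$i' + 1)) * \<xi>) * exp (T * (\<alpha>$i + 1))" for m :: nat
    have "S \<subseteq> {c\<in>cells (rate \<alpha> \<beta>) T. \<bar>real (c (i,1)) - F (c (i',1))\<bar> \<le> 4 * exp (T * \<alpha>$i)}"
    proof
      fix c assume "c \<in> S"
      then obtain q where c: "c \<in> cells (rate \<alpha> \<beta>) T" "q \<in> int_vectors" "q \<noteq> 0"
        "\<forall>i. \<bar>dual \<alpha> (s + T) (child (rate \<alpha> \<beta>) (s + T) A c) q $ i\<bar> < \<delta>" unfolding S_def by blast
      note d = danger[OF c]
      have "cross3 (dual \<alpha> s A q) (dual \<alpha> s A q0) = 0"
      proof (rule ba_parallel_dual[OF alpha_sum ba c(2) c0(2)])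
        show "\<bar>dual \<alpha> s A q $ i\<bar> \<le> 3 * \<delta> * exp T" "\<bar>dual \<alpha> s A q0 $ i\<bar> \<le> 3 * \<delta> * exp T" for i
          using d d0 by auto
        have "exp (2 * T) = exp T * exp T" by (simp flip: exp_add)
        then have "18 * \<delta> * (exp T * exp T) < 1" using \<delta>T by simp
        then have "\<delta> * (18 * \<delta> * (exp T * exp T)) < \<delta> * 1" using \<delta> by (intro mult_strict_left_mono) auto
        moreover have "\<delta> * (18 * \<delta> * (exp T * exp T)) = 18 * (\<delta> * (\<delta> * (exp T * exp T)))"
          "2 * (3 * \<delta> * exp T * (3 * \<delta> * exp T)) = 18 * (\<delta> * (\<delta> * (exp T * exp T)))" by simp_all
        ultimately show "2 * (3 * \<delta> * exp T * (3 * \<delta> * exp T)) < \<delta>" by linarith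
      qed
      then have cr0: "cross3 (dual \<alpha> s A q) (dual \<alpha> s A q0) $ k = 0" for k by simp
      have cr: "Q q i' * Q q0 i = Q q i * Q q0 i'" "R q * Q q0 i = Q q i * R q0"
        using cr0[of 1] cr0[of 2] cr0[of 3] ii unfolding cross3_nth Q12[symmetric] R_def[symmetric] by (auto simp: mult.commute)
      have nz: "Q q0 i \<noteq> 0" using q0i \<delta> by auto
      have e: "Q q i' = \<xi> * Q q i" "R q = \<zeta> * Q q i" using cr nz by (auto simp: \<zeta>_def \<xi>_def field_simps)
      have "\<bar>\<xi>\<bar> \<le> 1" using i(2) nz by (simp add: \<xi>_def)
      then have "\<bar>\<xi>\<bar> * \<bar>Q q i\<bar> \<le> 1 * \<bar>Q q i\<bar>" by (rule mult_right_mono) simp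
      then have "\<bar>Q q i'\<bar> \<le> \<bar>Q q i\<bar>" unfolding e by (simp add: abs_mult)
      then have qi: "\<delta> / 4 \<le> \<bar>Q q i\<bar>" using d split[of q] by (metis max.absorb1 order_trans)
      have "\<bar>R q - b c i * Q q i - b c i' * Q q i'\<bar> < \<delta> * exp (- T)" using d ii by (auto simp: algebra_simps)
      moreover have "R q - b c i * Q q i - b c i' * Q q i' = (\<zeta> - b c i' * \<xi> - b c i) * Q q i"
        unfolding e by (simp add: algebra_simps)
      ultimately have "\<bar>\<zeta> - b c i' * \<xi> - b c i\<bar> * \<bar>Q q i\<bar> < \<delta> * exp (- T)" by (simp add: abs_mult)
      moreover have "\<bar>\<zeta> - b c i' * \<xi> - b c i\<bar> * (\<delta> / 4) \<le> \<bar>\<zeta> - b c i' * \<xi> - b c i\<bar> * \<bar>Q q i\<bar>"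
        using qi by (intro mult_left_mono) auto
      ultimately have "\<delta> * \<bar>\<zeta> - b c i' * \<xi> - b c i\<bar> \<le> \<delta> * (4 * exp (- T))" by (simp add: mult_ac)
      then have "\<bar>\<zeta> - b c i' * \<xi> - b c i\<bar> \<le> 4 * exp (- T)" using \<delta> by (simp only: mult_le_cancel_left_pos)
      then have "\<bar>\<zeta> - b c i' * \<xi> - b c i\<bar> * exp (T * (\<alpha>$i + 1)) \<le> 4 * exp (- T) * exp (T * (\<alpha>$i + 1))"
        by (rule mult_right_mono) simp
      also have "\<dots> = 4 * exp (T * \<alpha>$i)" by (simp add: mult.assoc algebra_simps flip: exp_add)
      also have "\<bar>\<zeta> - b c i' * \<xi> - b c i\<bar> * exp (T * (\<alpha>$i + 1)) = \<bar>(\<zeta> - b c i' * \<xi> - b c i) * exp (T * (\<alpha>$i + 1))\<bar>"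
        by (simp add: abs_mult)
      also have "(\<zeta> - b c i' * \<xi> - b c i) * exp (T * (\<alpha>$i + 1)) = F (c (i',1)) - real (c (i,1))"
        by (simp add: F_def b_def left_diff_distrib mult.assoc flip: exp_add)
      finally show "c \<in> {c\<in>cells (rate \<alpha> \<beta>) T. \<bar>real (c (i,1)) - F (c (i',1))\<bar> \<le> 4 * exp (T * \<alpha>$i)}"
        using c(1) by (simp add: abs_minus_commute)
    qed
    then have "real (card S) \<le> real (card {c\<in>cells (rate \<alpha> \<beta>) T. \<bar>real (c (i,1)) - F (c (i',1))\<bar> \<le> 4 * exp (T * \<alpha>$i)})"
      by (intro of_nat_mono card_mono) auto
    also have "\<dots> \<le> (2 * (4 * exp (T * \<alpha>$i)) + 1) * real (nat \<lfloor>exp (T * rate \<alpha> \<beta> (i',1))\<rfloor>)"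
      by (rule card_cells_strip) (use i in auto)
    also have "\<dots> \<le> 9 * exp (T * \<alpha>$i) * real (nat \<lfloor>exp (T * rate \<alpha> \<beta> (i',1))\<rfloor>)"
    proof (rule mult_right_mono)
      have "exp (T * \<alpha>$i) \<ge> 1" using T(1) alpha_pos[of i] by simp
      then show "2 * (4 * exp (T * \<alpha>$i)) + 1 \<le> 9 * exp (T * \<alpha>$i)" by linarith
    qed simp
    finally show ?thesis unfolding S_def using i(1) by blast
  next
    case True
    then show ?thesis unfolding S_def[symmetric] by (intro exI[of _ 1] exI[of _ 2]) simp
  qed
qed

end

section \<open>Thickness for cylindrical norms\<close>

definition tri :: "real^(2 + 1) \<Rightarrow> real^3" where
  "tri v = vector [v $ Inl 1, v $ Inl 2, v $ Inr 1]"

lemma tri_nth [simp]: "tri v $ 1 = v $ Inl 1" "tri v $ 2 = v $ Inl 2" "tri v $ 3 = v $ Inr 1"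
  by (auto simp: tri_def)

lemma tri_int: "z \<in> int_vectors \<Longrightarrow> tri z \<in> int_vectors"
  by (simp add: int_vectors_def forall_3)

context
  fixes \<alpha> :: "real^2" and \<beta> :: "real^1"
  assumes wv: "weight_vector \<alpha> \<beta>"
begin

lemma flow_21:
  "(flow \<alpha> \<beta> s A *v v) $ Inl i = exp (s * \<alpha>$i) * (v $ Inl i + A$i$1 * v $ Inr 1)"
  "(flow \<alpha> \<beta> s A *v v) $ Inr 1 = exp (- s) * v $ Inr 1"
  by (auto simp: flow_Inl flow_Inr beta1[OF wv])

lemma prim_tri: "prim \<alpha> s A (tri z) = tri (flow \<alpha> \<beta> s A *v z)"
  unfolding vec_eq_iff forall_3 prim_def vector_3 tri_nth flow_21 by simp

lemma card_cells_21:
  "card (cells w T) = nat \<lfloor>exp (T * w (1,1))\<rfloor> * nat \<lfloor>exp (T * w (2,1))\<rfloor>" for w :: "2 \<times> 1 \<Rightarrow> real"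
proof -
  have U: "(UNIV :: (2 \<times> 1) set) = {(1,1), (2,1)}"
  proof -
    have "l \<in> {(1,1), (2,1)}" for l :: "2 \<times> 1" using exhaust_2[of "fst l"] by (cases l) auto
    then show ?thesis by blast
  qed
  show ?thesis unfolding card_cells U by simp
qed

text \<open>The exponent 3 turns the condition \<open>18 * \<delta> * exp (2 * T) < 1\<close> into
  \<open>18 * exp (- T) < 1\<close>. Each of the two kinds of killed children is then at most an
  eighth of all.\<close>

lemma ba_children:
  "\<exists>T1. \<forall>T\<ge>T1. \<forall>s A. ba (exp (- 3 * T)) \<alpha> s A \<longrightarrow>
    4 * card {c\<in>cells (rate \<alpha> \<beta>) T. \<not> ba (exp (- 3 * T)) \<alpha> (s + T) (child (rate \<alpha> \<beta>) (s + T) A c)}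
      \<le> card (cells (rate \<alpha> \<beta>) T)"
\<comment> \<open>\<open>112 = 2 * 8 * 7\<close> and \<open>144 = 2 * 8 * 9\<close>: the constants 7
  and 9 of the two counts, the eighth, and the factor 2 lost by rounding down.\<close>
proof (intro exI[of _ "max 144 (max (112 / \<alpha>$1) (112 / \<alpha>$2))"] allI impI)
  fix T s A
  assume T: "max 144 (max (112 / \<alpha>$1) (112 / \<alpha>$2)) \<le> T" and ba: "ba (exp (- 3 * T)) \<alpha> s A"
  define W where "W = rate \<alpha> \<beta>"
  define M where "M i = real (nat \<lfloor>exp (T * W (i,1))\<rfloor>)" for i
  define \<delta> where "\<delta> = exp (- 3 * T)"
  have T0: "T > 0" using T by linarith
  have eT: "exp T \<ge> 144" using T exp_ge_add_one_self[of T] by linarith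
  have ea: "exp (T * \<alpha>$i) \<ge> 112" for i
  proof -
    have "112 / \<alpha>$i \<le> T" using T exhaust_2[of i] by auto
    then have "112 \<le> T * \<alpha>$i" using alpha_pos[OF wv, of i] by (simp add: divide_le_eq)
    then show ?thesis using exp_ge_add_one_self[of "T * \<alpha>$i"] by linarith
  qed
  have M: "exp (T * \<alpha>$i) * exp T \<le> 2 * M i" for i
  proof -
    have "exp (T * W (i,1)) = exp (T * \<alpha>$i) * exp T" by (simp add: W_def rate1[OF wv] distrib_left exp_add)
    moreover have "0 \<le> T * W (i,1)" using T0 alpha_pos[OF wv, of i] by (simp add: W_def rate1[OF wv])
    ultimately show ?thesis using floor_exp_ge_half[of "T * W (i,1)"] unfolding M_def by simp
  qed
  have "18 * \<delta> * exp (2 * T) = 18 * exp (- T)" unfolding \<delta>_def mult.assoc exp_add[symmetric] by simp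
  also have "\<dots> < 1" using eT by (simp add: exp_minus divide_less_eq flip: divide_inverse)
  finally have \<delta>T: "18 * \<delta> * exp (2 * T) < 1" .
  define S1 where "S1 = {c\<in>cells W T. \<exists>z\<in>int_vectors. z \<noteq> 0 \<and>
      (\<forall>i. \<bar>prim \<alpha> (s + T) (child W (s + T) A c) z $ i\<bar> < \<delta>)}"
  define S2 where "S2 = {c\<in>cells W T. \<exists>q\<in>int_vectors. q \<noteq> 0 \<and>
      (\<forall>i. \<bar>dual \<alpha> (s + T) (child W (s + T) A c) q $ i\<bar> < \<delta>)}"
  have "real (card S1) \<le> 7 * exp T * M 2" unfolding S1_def M_def W_def
    by (rule card_prim_short_children[OF wv _ ba[folded \<delta>_def] T0 _ _ \<delta>T])
      (use ea[of 1] ea[of 2] in \<open>auto simp: \<delta>_def mult.commute\<close>)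
  moreover have "112 * exp T \<le> exp (T * \<alpha>$1) * exp T" by (rule mult_right_mono[OF ea]) simp
  then have "56 * exp T \<le> M 1" using M[of 1] by linarith
  then have "56 * exp T * M 2 \<le> M 1 * M 2" by (rule mult_right_mono) (simp add: M_def)
  ultimately have c1: "8 * real (card S1) \<le> M 1 * M 2" by linarith
  obtain i i' where i: "i \<noteq> i'" "real (card S2) \<le> 9 * exp (T * \<alpha>$i) * M i'"
    using card_dual_short_children[OF wv _ ba[folded \<delta>_def] T0 _ \<delta>T] eT
    unfolding S2_def M_def W_def by (auto simp: \<delta>_def)
  have "exp (T * \<alpha>$i) * 144 \<le> exp (T * \<alpha>$i) * exp T" using eT by (intro mult_left_mono) auto
  then have "72 * exp (T * \<alpha>$i) \<le> M i" using M[of i] by linarith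
  then have "72 * exp (T * \<alpha>$i) * M i' \<le> M i * M i'" by (rule mult_right_mono) (simp add: M_def)
  also have "M i * M i' = M 1 * M 2" using i(1) exhaust_2[of i] exhaust_2[of i'] by (auto simp: mult.commute)
  finally have c2: "8 * real (card S2) \<le> M 1 * M 2" using i(2) by linarith
  have "{c\<in>cells W T. \<not> ba \<delta> \<alpha> (s + T) (child W (s + T) A c)} \<subseteq> S1 \<union> S2"
    unfolding ba_def S1_def S2_def by (auto simp: not_le)
  then have "card {c\<in>cells W T. \<not> ba \<delta> \<alpha> (s + T) (child W (s + T) A c)} \<le> card (S1 \<union> S2)"
    by (intro card_mono) (auto simp: S1_def S2_def)
  also have "\<dots> \<le> card S1 + card S2" by (rule card_Un_le)
  finally have "4 * real (card {c\<in>cells W T. \<not> ba \<delta> \<alpha> (s + T) (child W (s + T) A c)}) \<le> M 1 * M 2"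
    using c1 c2 by linarith
  also have "M 1 * M 2 = real (card (cells W T))" unfolding card_cells_21 M_def by simp
  finally show "4 * card {c\<in>cells (rate \<alpha> \<beta>) T. \<not> ba (exp (- 3 * T)) \<alpha> (s + T) (child (rate \<alpha> \<beta>) (s + T) A c)}
      \<le> card (cells (rate \<alpha> \<beta>) T)" unfolding W_def \<delta>_def by linarith
qed

text \<open>Always some nonzero integer coordinate is met by a pure factor of at least
  \<open>exp (- s)\<close>: in \<open>prim\<close> the third, or, if that vanishes, one of the
  others, from which \<open>A\<close> has then dropped out; in \<open>dual\<close> one of the first
  two, or, if both vanish, the third.\<close>

lemma ba_initial:
  assumes "s \<ge> 0" "\<delta> \<le> exp (- s)"
  shows "ba \<delta> \<alpha> s A"
  unfolding ba_def
proof (intro ballI impI)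
  fix z assume z: "z \<in> int_vectors" "z \<noteq> (0::real^3)"
  have one: "1 \<le> \<bar>z$i\<bar>" if "z$i \<noteq> 0" for i
  proof -
    have "z$i \<in> \<int>" using z(1) by (auto simp: int_vectors_def)
    then show ?thesis using that by (auto elim!: Ints_cases)
  qed
  have big: "\<delta> \<le> \<bar>exp t * x\<bar>" if "- s \<le> t" "1 \<le> \<bar>x\<bar>" for t x
  proof -
    have "exp (- s) * 1 \<le> exp t * \<bar>x\<bar>" using that by (intro mult_mono) auto
    then show ?thesis using assms(2) by (simp add: abs_mult)
  qed
  have sa: "- s \<le> s * \<alpha>$i" "- s \<le> - s * \<alpha>$i" for i
  proof -
    have "0 \<le> s * \<alpha>$i" "s * \<alpha>$i \<le> s * 1"
      by (intro mult_nonneg_nonneg mult_left_mono assms(1) weight_vectorD(3)[OF wv] less_imp_le[OF alpha_pos[OF wv]])+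
    then show "- s \<le> s * \<alpha>$i" "- s \<le> - s * \<alpha>$i" using assms(1) by auto
  qed
  have ne: "z$1 \<noteq> 0 \<or> z$2 \<noteq> 0 \<or> z$3 \<noteq> 0" using z(2) by (auto simp: vec_eq_iff forall_3)
  have "\<exists>i. \<delta> \<le> \<bar>prim \<alpha> s A z $ i\<bar>"
  proof (cases "z$3 = 0")
    case True
    show ?thesis
    proof (cases "z$1 = 0")
      case False
      then show ?thesis using big[OF sa(1)[of 1] one] True by (intro exI[of _ 1]) (simp add: prim_def)
    next
      case z1: True
      then have "z$2 \<noteq> 0" using True ne by auto
      then show ?thesis using big[OF sa(1)[of 2] one] True by (intro exI[of _ 2]) (simp add: prim_def)
    qed
  next
    case False
    then show ?thesis using big[OF order_refl one] by (intro exI[of _ 3]) (simp add: prim_def)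
  qed
  moreover have "\<exists>i. \<delta> \<le> \<bar>dual \<alpha> s A z $ i\<bar>"
  proof (cases "z$1 = 0")
    case True
    show ?thesis
    proof (cases "z$2 = 0")
      case False
      then show ?thesis using big[OF sa(2)[of 2] one] by (intro exI[of _ 2]) (simp add: dual_def)
    next
      case z2: True
      then have "z$3 \<noteq> 0" using True ne by auto
      then show ?thesis using big[of s "z$3"] one assms(1) True z2 by (intro exI[of _ 3]) (simp add: dual_def)
    qed
  next
    case False
    then show ?thesis using big[OF sa(2)[of 1] one] by (intro exI[of _ 1]) (simp add: dual_def)
  qed
  ultimately show "(\<exists>i. \<delta> \<le> \<bar>prim \<alpha> s A z $ i\<bar>) \<and> (\<exists>i. \<delta> \<le> \<bar>dual \<alpha> s A z $ i\<bar>)" by blast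
qed

text \<open>Moving within the box changes only the third dual coordinate, by at most the sum of the
  sizes of the other two; hence the factor 3. This carries \<open>ba\<close> from the corner of an
  old box to all later corners inside it.\<close>

lemma dual_large_in_box:
  assumes ba: "ba \<delta> \<alpha> s B" and \<delta>: "\<delta> > 0" and A: "A \<in> wbox (rate \<alpha> \<beta>) s B" and q: "q \<in> int_vectors" "q \<noteq> 0"
  shows "\<exists>i. \<delta> / 3 \<le> \<bar>dual \<alpha> s A q $ i\<bar>"
proof (rule ccontr)
  assume "\<not> ?thesis"
  then have lt: "\<bar>dual \<alpha> s A q $ i\<bar> < \<delta> / 3" for i by (meson not_le)
  have d: "\<bar>exp s * ((A$i$1 - B$i$1) * v)\<bar> \<le> \<bar>exp (- s * \<alpha>$i) * v\<bar>" for i v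
  proof -
    have "\<bar>A$i$1 - B$i$1\<bar> \<le> exp (- s * (\<alpha>$i + 1))"
      using A unfolding wbox_def by (auto simp: abs_le_iff rate1[OF wv])
        (smt (verit) exp_gt_zero)
    then have "exp s * (\<bar>A$i$1 - B$i$1\<bar> * \<bar>v\<bar>) \<le> exp s * (exp (- s * (\<alpha>$i + 1)) * \<bar>v\<bar>)"
      by (intro mult_left_mono mult_right_mono) auto
    also have "\<dots> = (exp s * exp (- s * (\<alpha>$i + 1))) * \<bar>v\<bar>" by simp
    also have "exp s * exp (- s * (\<alpha>$i + 1)) = exp (- s * \<alpha>$i)"
      unfolding exp_add[symmetric] by (simp add: algebra_simps)
    finally show ?thesis by (simp add: abs_mult)
  qed
  have D: "dual \<alpha> s B q $ 1 = dual \<alpha> s A q $ 1" "dual \<alpha> s B q $ 2 = dual \<alpha> s A q $ 2"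
    "dual \<alpha> s B q $ 3 = dual \<alpha> s A q $ 3 + exp s * ((A$1$1 - B$1$1) * q$1) + exp s * ((A$2$1 - B$2$1) * q$2)"
    by (auto simp: dual_def algebra_simps)
  have "\<bar>exp s * ((A$1$1 - B$1$1) * q$1)\<bar> \<le> \<bar>dual \<alpha> s A q $ 1\<bar>" "\<bar>exp s * ((A$2$1 - B$2$1) * q$2)\<bar> \<le> \<bar>dual \<alpha> s A q $ 2\<bar>"
    using d[of 1 "q$1"] d[of 2 "q$2"] by (auto simp: dual_def)
  then have "\<forall>i. \<bar>dual \<alpha> s B q $ i\<bar> < \<delta>" unfolding forall_3 D
    using lt[of 1] lt[of 2] lt[of 3] \<delta> by linarith
  moreover obtain i where "\<delta> \<le> \<bar>dual \<alpha> s B q $ i\<bar>" using ba q unfolding ba_def by blast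
  ultimately show False by (meson not_le)
qed

lemma dual_rescale:
  "dual \<alpha> (s - t) A q $ 1 = exp (t * \<alpha>$1) * dual \<alpha> s A q $ 1"
  "dual \<alpha> (s - t) A q $ 2 = exp (t * \<alpha>$2) * dual \<alpha> s A q $ 2"
  "dual \<alpha> (s - t) A q $ 3 = exp (- t) * dual \<alpha> s A q $ 3"
proof -
  have e: "exp (- (s - t) * a) * x = exp (t * a) * (exp (- s * a) * x)" for a x
    unfolding mult.assoc[symmetric] exp_add[symmetric] by (simp add: algebra_simps)
  have e': "exp (s - t) * x = exp (- t) * (exp s * x)" for x
    unfolding mult.assoc[symmetric] exp_add[symmetric] by simp
  show "dual \<alpha> (s - t) A q $ 1 = exp (t * \<alpha>$1) * dual \<alpha> s A q $ 1"
    "dual \<alpha> (s - t) A q $ 2 = exp (t * \<alpha>$2) * dual \<alpha> s A q $ 2"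
    "dual \<alpha> (s - t) A q $ 3 = exp (- t) * dual \<alpha> s A q $ 3"
    unfolding dual_def vector_3 by (rule e e e')+
qed

text \<open>A lattice with a horizontal plane of covolume \<open>\<kappa>\<close> in the closure would yield, at time
  \<open>s - t\<close>, dual vectors of length about \<open>exp (- t) \<kappa>\<close>.\<close>

lemma horizontal_plane_covolume:
  assumes h: "h \<in> closure {flow \<alpha> \<beta> s A ** g |A s g. (A, s) \<in> Y \<and> unim g}"
    and Y: "\<And>A s q. (A, s) \<in> Y \<Longrightarrow> q \<in> int_vectors \<Longrightarrow> q \<noteq> 0 \<Longrightarrow> \<exists>i. \<delta> \<le> \<bar>dual \<alpha> (s - t) A q $ i\<bar>"
    and z: "z \<in> int_vectors" "z' \<in> int_vectors" "(h *v z) $ Inr 1 = 0" "(h *v z') $ Inr 1 = 0"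
    and \<kappa>: "cross2 (hor (h *v z)) (hor (h *v z')) \<noteq> 0" and \<delta>: "\<delta> > 0"
  shows "\<delta> \<le> exp (- t) * \<bar>cross2 (hor (h *v z)) (hor (h *v z'))\<bar>"
proof (rule ccontr)
  assume n: "\<not> ?thesis"
  define D where "D X = cross3 (tri (X *v z)) (tri (X *v z'))" for X
  \<comment> \<open>Open conditions that \<open>h\<close> satisfies. The last one makes the integer
    vector \<open>q\<close> of an approximating lattice nonzero.\<close>
  define G where "G = {X. \<bar>exp (t * \<alpha>$1) * D X $ 1\<bar> < \<delta>} \<inter> {X. \<bar>exp (t * \<alpha>$2) * D X $ 2\<bar> < \<delta>} \<inter>
     {X. \<bar>exp (- t) * D X $ 3\<bar> < \<delta>} \<inter> {X. D X $ 3 \<noteq> 0}"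
  have cD: "continuous_on UNIV (\<lambda>X. D X $ i)" for i
  proof -
    have "\<forall>i. continuous_on UNIV (\<lambda>X. D X $ i)"
      unfolding D_def forall_3 cross3_nth tri_nth by (intro conjI continuous_intros)
    then show ?thesis ..
  qed
  have "open G" unfolding G_def
    by (intro open_Int open_Collect_less open_Collect_neq continuous_intros cD)
  moreover have "h \<in> G"
  proof -
    have "D h $ 1 = 0" "D h $ 2 = 0" "D h $ 3 = cross2 (hor (h *v z)) (hor (h *v z'))"
      using z(3,4) by (auto simp: D_def cross3_nth cross2_def)
    then show ?thesis unfolding G_def using n \<kappa> \<delta> by (simp add: abs_mult)
  qed
  ultimately have oG: "open G" and hG: "h \<in> G" by auto
  define SS where "SS = {flow \<alpha> \<beta> s A ** g |A s g. (A, s) \<in> Y \<and> unim g}"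
  have "G \<inter> closure SS \<noteq> {}" using hG h unfolding SS_def by blast
  then have "G \<inter> SS \<noteq> {}" using open_Int_closure_eq_empty[OF oG] by blast
  then obtain X where X: "X \<in> G" "X \<in> SS" by blast
  then obtain A s g where A: "X = flow \<alpha> \<beta> s A ** g" "(A, s) \<in> Y" "unim g" unfolding SS_def by blast
  define q where "q = cross3 (tri (g *v z)) (tri (g *v z'))"
  have DX: "D X = dual \<alpha> s A q" unfolding D_def q_def A(1) cross3_prim[OF alpha_sum[OF wv], symmetric] prim_tri
    by (simp add: matrix_vector_mul_assoc)
  have "D X $ 3 \<noteq> 0" using X(1) unfolding G_def by simp
  then have "dual \<alpha> s A q \<noteq> 0" unfolding DX by (metis zero_index)
  then have "q \<noteq> 0" unfolding dual_zero_iff .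
  moreover have "q \<in> int_vectors" unfolding q_def
    using A(3) z(1,2) unfolding unim_def by (intro int_vectors_cross3 tri_int) auto
  ultimately obtain i where "\<delta> \<le> \<bar>dual \<alpha> (s - t) A q $ i\<bar>" using Y[OF A(2)] by blast
  moreover have "\<forall>i. \<bar>dual \<alpha> (s - t) A q $ i\<bar> < \<delta>"
    unfolding forall_3 dual_rescale DX[symmetric] using X(1) unfolding G_def by simp
  ultimately show False by (meson not_le)
qed

lemma cross2_scaled: "cross2 (vector [a * x1, b * x2]) (vector [a * y1, b * y2]) = a * b * (x1 * y2 - x2 * y1)"
  by (simp add: cross2_def algebra_simps)

text \<open>The hypothesis on \<open>h\<close> excludes two independent horizontal contacts, so
  \<open>critical_cyl\<close> gives a lateral contact \<open>z\<close> that is not horizontal. A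
  contact \<open>z0\<close> on the top face fixes the time, and the equation of the lateral face for
  \<open>z\<close> becomes a curve in \<open>b\<close> with nonzero slopes. Each curve comes from a
  pair of elements of the finite \<open>Z\<close>.\<close>

lemma hits_curves:
  fixes \<eta> :: "real^2 \<Rightarrow> real"
  assumes \<eta>: "is_norm \<eta>"
  shows "\<exists>N0 Kc. \<forall>h. \<bar>det h\<bar> = 1 \<longrightarrow>
    (\<forall>z\<in>int_vectors. \<forall>z'\<in>int_vectors. (h *v z) $ Inr 1 = 0 \<longrightarrow> (h *v z') $ Inr 1 = 0 \<longrightarrow>
       cross2 (hor (h *v z)) (hor (h *v z')) \<noteq> 0 \<longrightarrow> Kc < \<bar>cross2 (hor (h *v z)) (hor (h *v z'))\<bar>) \<longrightarrow>
    (\<exists>Q :: ((real^2) \<times> (real^2)) set. finite Q \<and> card Q \<le> N0 \<and> (\<forall>p\<in>Q. snd p $ 1 \<noteq> (0::real) \<and> snd p $ 2 \<noteq> (0::real)) \<and>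
      hits (cyl \<eta>) \<alpha> \<beta> h \<subseteq> {b. \<exists>p\<in>Q. \<eta> (vector [fst p $ 1 + snd p $ 1 * b$1$1, fst p $ 2 + snd p $ 2 * b$2$1]) =
         critical_radius (cyl \<eta>)})"
proof -
  note \<nu> = is_norm_cyl[OF \<eta>]
  define r where "r = critical_radius (cyl \<eta>)"
  have r: "r > 0" unfolding r_def by (rule critical_radius_pos[OF \<nu>])
  obtain c0 where c0: "c0 > 0" "\<And>x. c0 * norm x \<le> \<eta> x" using is_norm_lower[OF \<eta>] by blast
  define m where "m = r / c0"
  \<comment> \<open>The horizontal parts of contacts have coordinates at most \<open>m\<close>, so
    their cross product is below \<open>2 * (m * m) + 1\<close>; \<open>exp 1\<close> accounts for
    the times in \<open>{-1..0}\<close>.\<close>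
  define Kc where "Kc = exp 1 * (2 * (m * m) + 1)"
  obtain B where B: "\<And>h. \<bar>det h\<bar> = 1 \<Longrightarrow> hits (cyl \<eta>) \<alpha> \<beta> h \<noteq> {} \<Longrightarrow> \<exists>g. unim g \<and> norm (h ** g) \<le> B"
    using hits_bounded_representative[OF wv \<nu>] by blast
  obtain Z where Z: "finite Z" "Z \<subseteq> int_vectors" "\<And>h \<sigma> b. \<bar>det h\<bar> = 1 \<Longrightarrow> norm h \<le> B \<Longrightarrow> \<sigma> \<in> {-1..0} \<Longrightarrow> b \<in> unit_box \<Longrightarrow>
     contact (cyl \<eta>) (flow \<alpha> \<beta> \<sigma> b ** h) \<subseteq> Z"
    using contacts_finite[OF wv \<nu>, of B] by blast
  have main: "\<exists>Q :: ((real^2) \<times> (real^2)) set. finite Q \<and> card Q \<le> card (Z \<times> Z) \<and> (\<forall>p\<in>Q. snd p $ 1 \<noteq> (0::real) \<and> snd p $ 2 \<noteq> (0::real)) \<and>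
      hits (cyl \<eta>) \<alpha> \<beta> h0 \<subseteq> {b. \<exists>p\<in>Q. \<eta> (vector [fst p $ 1 + snd p $ 1 * b$1$1, fst p $ 2 + snd p $ 2 * b$2$1]) = r}"
    if h0: "\<bar>det h0\<bar> = 1" and NH0: "\<forall>z\<in>int_vectors. \<forall>z'\<in>int_vectors. (h0 *v z) $ Inr 1 = 0 \<longrightarrow> (h0 *v z') $ Inr 1 = 0 \<longrightarrow>
       cross2 (hor (h0 *v z)) (hor (h0 *v z')) \<noteq> 0 \<longrightarrow> Kc < \<bar>cross2 (hor (h0 *v z)) (hor (h0 *v z'))\<bar>" for h0
  proof (cases "hits (cyl \<eta>) \<alpha> \<beta> h0 = {}")
    case True
    then show ?thesis by (intro exI[of _ "{}"]) simp
  next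
    case False
    obtain g where g: "unim g" "norm (h0 ** g) \<le> B" using B[OF h0 False] by blast
    define h where "h = h0 ** g"
    have h: "\<bar>det h\<bar> = 1" "norm h \<le> B" using h0 g det_unim by (auto simp: h_def det_mul abs_mult)
    have gz: "g *v z \<in> int_vectors" if "z \<in> int_vectors" for z using g(1) that unfolding unim_def by blast
    have hh: "hits (cyl \<eta>) \<alpha> \<beta> h0 = hits (cyl \<eta>) \<alpha> \<beta> h" using hits_unim[OF g(1)] by (simp add: h_def)
    have NH: "Kc < \<bar>cross2 (hor (h *v z)) (hor (h *v z'))\<bar>"
      if "z \<in> int_vectors" "z' \<in> int_vectors" "(h *v z) $ Inr 1 = 0" "(h *v z') $ Inr 1 = 0"
        "cross2 (hor (h *v z)) (hor (h *v z')) \<noteq> 0" for z z'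
      using NH0[rule_format, OF gz[OF that(1)] gz[OF that(2)]] that(3-5)
      by (simp add: h_def matrix_vector_mul_assoc)
    \<comment> \<open>Solves \<open>exp (- \<sigma>)\<close> times the height of
      \<open>h *v z\<close> equal to \<open>r\<close> for the time \<open>\<sigma>\<close>.\<close>
    define time where "time z = ln (\<bar>(h *v z) $ Inr 1\<bar> / r)" for z
    define par :: "real^(2+1) \<Rightarrow> real^(2+1) \<Rightarrow> (real^2) \<times> (real^2)" where
      "par z0 z = ((\<chi> i. exp (time z0 * \<alpha>$i) * (h *v z) $ Inl i), (\<chi> i. exp (time z0 * \<alpha>$i) * (h *v z) $ Inr 1))" for z0 z
    define ZZ where "ZZ = {p \<in> Z \<times> Z. (h *v snd p) $ Inr 1 \<noteq> 0}"
    define Q where "Q = (\<lambda>p. par (fst p) (snd p)) ` ZZ"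
    have sub: "ZZ \<subseteq> Z \<times> Z" unfolding ZZ_def by blast
    have fZ: "finite (Z \<times> Z)" using Z(1) by simp
    have "finite Q" unfolding Q_def using finite_subset[OF sub fZ] by simp
    moreover have "card Q \<le> card (Z \<times> Z)" unfolding Q_def
      by (rule order_trans[OF card_image_le[OF finite_subset[OF sub fZ]] card_mono[OF fZ sub]])
    moreover have "\<forall>p\<in>Q. snd p $ 1 \<noteq> 0 \<and> snd p $ 2 \<noteq> 0" unfolding Q_def ZZ_def par_def by auto
    moreover have "hits (cyl \<eta>) \<alpha> \<beta> h \<subseteq> {b. \<exists>p\<in>Q. \<eta> (vector [fst p $ 1 + snd p $ 1 * b$1$1, fst p $ 2 + snd p $ 2 * b$2$1]) = r}"
    proof
      fix b assume "b \<in> hits (cyl \<eta>) \<alpha> \<beta> h"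
      then obtain \<sigma> where b: "b \<in> unit_box" and \<sigma>: "\<sigma> \<in> {-1..0}" and crit: "critical (cyl \<eta>) (flow \<alpha> \<beta> \<sigma> b ** h)"
        unfolding hits_def by blast
      define y where "y = flow \<alpha> \<beta> \<sigma> b ** h"
      have yv: "y *v z = flow \<alpha> \<beta> \<sigma> b *v (h *v z)" for z by (simp add: y_def matrix_vector_mul_assoc)
      have y3: "(y *v z) $ Inr 1 = exp (- \<sigma>) * (h *v z) $ Inr 1" for z unfolding yv flow_21 ..
      have conZ: "contact (cyl \<eta>) y \<subseteq> Z" unfolding y_def by (rule Z(3)[OF h \<sigma> b])
      obtain z0 where z0: "z0 \<in> contact (cyl \<eta>) y" "\<bar>(y *v z0) $ Inr 1\<bar> = r"
        using critical_cyl(1)[OF \<eta> crit[folded y_def]] unfolding r_def by blast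
      have t0: "time z0 = \<sigma>"
      proof -
        have "\<bar>(h *v z0) $ Inr 1\<bar> = exp \<sigma> * r" using z0(2) unfolding y3 abs_mult by (simp add: exp_minus field_simps)
        then show ?thesis using r by (simp add: time_def)
      qed
      have "\<exists>z \<in> contact (cyl \<eta>) y. \<eta> (hor (y *v z)) = r \<and> (y *v z) $ Inr 1 \<noteq> 0"
      proof (rule ccontr)
        assume "\<not> ?thesis"
        then obtain z z' where z: "z \<in> contact (cyl \<eta>) y" "z' \<in> contact (cyl \<eta>) y" "(y *v z) $ Inr 1 = 0" "(y *v z') $ Inr 1 = 0"
          "cross2 (hor (y *v z)) (hor (y *v z')) \<noteq> 0"
          using critical_cyl(2)[OF \<eta> crit[folded y_def]] unfolding r_def by blast
        have h3: "(h *v z) $ Inr 1 = 0" "(h *v z') $ Inr 1 = 0" using z(3,4) unfolding y3 by auto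
        have yh: "hor (y *v u) = vector [exp (\<sigma> * \<alpha>$1) * (h *v u) $ Inl 1, exp (\<sigma> * \<alpha>$2) * (h *v u) $ Inl 2]"
          if "(h *v u) $ Inr 1 = 0" for u
          unfolding hor_def yv flow_21 that by simp
        have cr: "cross2 (hor (y *v z)) (hor (y *v z')) = exp \<sigma> * cross2 (hor (h *v z)) (hor (h *v z'))"
          unfolding yh[OF h3(1)] yh[OF h3(2)] cross2_scaled exp_weights[OF alpha_sum[OF wv], of \<sigma>]
          by (simp add: cross2_def)
        have bd: "\<bar>hor (y *v u) $ i\<bar> \<le> m" if "u \<in> contact (cyl \<eta>) y" for u i
        proof -
          have "\<eta> (hor (y *v u)) \<le> r" using that unfolding contact_def r_def[symmetric] cyl_def by auto
          then have "c0 * norm (hor (y *v u)) \<le> r" using c0(2) order_trans by blast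
          then have "norm (hor (y *v u)) \<le> m" using c0(1) by (simp add: m_def field_simps)
          then show ?thesis using component_le_norm_cart order_trans by blast
        qed
        have "\<bar>cross2 (hor (y *v z)) (hor (y *v z'))\<bar> < 2 * (m * m) + 1"
          unfolding cross2_def by (intro abs_cross_component_less[of _ m] bd z less_add_one)
        then have "exp \<sigma> * \<bar>cross2 (hor (h *v z)) (hor (h *v z'))\<bar> < 2 * (m * m) + 1" unfolding cr by (simp add: abs_mult)
        moreover have "cross2 (hor (h *v z)) (hor (h *v z')) \<noteq> 0" using z(5) cr by auto
        then have "Kc < \<bar>cross2 (hor (h *v z)) (hor (h *v z'))\<bar>"
          using NH[OF _ _ h3] z(1,2) unfolding contact_def by blast
        then have "exp \<sigma> * Kc \<le> exp \<sigma> * \<bar>cross2 (hor (h *v z)) (hor (h *v z'))\<bar>" by simp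
        moreover have "1 * (2 * (m * m) + 1) \<le> exp (\<sigma> + 1) * (2 * (m * m) + 1)"
          using \<sigma> by (intro mult_right_mono) (auto simp: add_nonneg_nonneg)
        then have "2 * (m * m) + 1 \<le> exp \<sigma> * Kc" unfolding Kc_def by (simp add: exp_add mult.assoc)
        ultimately show False by linarith
      qed
      then obtain z where z: "z \<in> contact (cyl \<eta>) y" "\<eta> (hor (y *v z)) = r" "(y *v z) $ Inr 1 \<noteq> 0" by blast
      have "(h *v z) $ Inr 1 \<noteq> 0" using z(3) unfolding y3 by auto
      then have "par z0 z \<in> Q" unfolding Q_def ZZ_def using conZ z0(1) z(1) by (auto intro!: image_eqI[of _ _ "(z0, z)"])
      moreover have "hor (y *v z) = vector [fst (par z0 z) $ 1 + snd (par z0 z) $ 1 * b$1$1, fst (par z0 z) $ 2 + snd (par z0 z) $ 2 * b$2$1]"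
        unfolding hor_def yv flow_21 par_def t0 by (simp add: algebra_simps)
      ultimately show "b \<in> {b. \<exists>p\<in>Q. \<eta> (vector [fst p $ 1 + snd p $ 1 * b$1$1, fst p $ 2 + snd p $ 2 * b$2$1]) = r}"
        using z(2) by auto
    qed
    ultimately show ?thesis unfolding hh by blast
  qed
  show ?thesis unfolding r_def[symmetric] by (intro exI[of _ "card (Z \<times> Z)"] exI[of _ Kc] allI impI main)
qed

lemma thick_DI_cyl:
  fixes \<eta> :: "real^2 \<Rightarrow> real"
  assumes \<eta>: "is_norm \<eta>"
  shows "thick (DI (cyl \<eta>) \<alpha> \<beta>)"
proof (rule thick_DI_criterion[OF wv is_norm_cyl[OF \<eta>]])
  fix A0 :: "real^1^2" and s0 T0 :: real
  assume s0: "s0 \<ge> 0"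
  define W where "W = rate \<alpha> \<beta>"
  define r where "r = critical_radius (cyl \<eta>)"
  have r: "r > 0" unfolding r_def by (rule critical_radius_pos[OF is_norm_cyl[OF \<eta>]])
  obtain N0 Kc where curves: "\<And>h. \<bar>det h\<bar> = 1 \<Longrightarrow>
    \<forall>z\<in>int_vectors. \<forall>z'\<in>int_vectors. (h *v z) $ Inr 1 = 0 \<longrightarrow> (h *v z') $ Inr 1 = 0 \<longrightarrow>
       cross2 (hor (h *v z)) (hor (h *v z')) \<noteq> 0 \<longrightarrow> Kc < \<bar>cross2 (hor (h *v z)) (hor (h *v z'))\<bar> \<Longrightarrow>
    \<exists>Q :: ((real^2) \<times> (real^2)) set. finite Q \<and> card Q \<le> N0 \<and> (\<forall>p\<in>Q. snd p $ 1 \<noteq> (0::real) \<and> snd p $ 2 \<noteq> (0::real)) \<and>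
      hits (cyl \<eta>) \<alpha> \<beta> h \<subseteq> {b. \<exists>p\<in>Q. \<eta> (vector [fst p $ 1 + snd p $ 1 * b$1$1, fst p $ 2 + snd p $ 2 * b$2$1]) = r}"
    using hits_curves[OF \<eta>] unfolding r_def[symmetric] by blast
  obtain T1 where T1: "\<And>T s A. T1 \<le> T \<Longrightarrow> ba (exp (- 3 * T)) \<alpha> s A \<Longrightarrow>
    4 * card {c\<in>cells W T. \<not> ba (exp (- 3 * T)) \<alpha> (s + T) (child W (s + T) A c)} \<le> card (cells W T)"
    using ba_children unfolding W_def by blast
  \<comment> \<open>\<open>s0\<close> lets the root satisfy \<open>ba\<close>,
    \<open>768 * N0\<close> is the threshold of \<open>linear_le_exp\<close> for the factor
    \<open>384 * N0\<close>, and \<open>3 * Kc\<close> ensures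
    \<open>Kc < exp T / 3\<close>.\<close>
  obtain N :: nat where N: "max (max T0 T1) (max (max 1 s0) (max (768 * real N0) (3 * Kc))) \<le> real N"
    using real_arch_simple by blast
  define T where "T = real N"
  have T: "T0 \<le> T" "T1 \<le> T" "1 \<le> T" "s0 \<le> T" "768 * real N0 \<le> T" "3 * Kc \<le> T" using N unfolding T_def by auto
  have N1: "N > 0" using T(3) unfolding T_def by simp
  define \<delta> where "\<delta> = exp (- 3 * T)"
  have \<delta>: "\<delta> > 0" by (simp add: \<delta>_def)
  define M where "M l = nat \<lfloor>exp (T * W l)\<rfloor>" for l
  have M: "exp T \<le> 2 * real (M (i,1))" "1 \<le> M (i,1)" for i
  proof -
    have "exp T \<le> exp (T * W (i,1))" using T(3) alpha_pos[OF wv, of i] by (simp add: W_def rate1[OF wv])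
    moreover have p: "0 \<le> T * W (i,1)" using T(3) alpha_pos[OF wv, of i] by (simp add: W_def rate1[OF wv])
    ultimately show "exp T \<le> 2 * real (M (i,1))" using floor_exp_ge_half[OF p] unfolding M_def by linarith
    have "1 \<le> exp (T * W (i,1))" using p by simp
    then show "1 \<le> M (i,1)" unfolding M_def by linarith
  qed
  \<comment> \<open>Five generations back: \<open>exp (5 * T) * (\<delta> / 3)\<close> is
    \<open>exp (2 * T) / 3\<close>, and flowing back by \<open>j < T\<close> leaves a covolume of at
    least \<open>exp T / 3\<close>.\<close>
  define Y where "Y = {(A, s). \<forall>q\<in>int_vectors. q \<noteq> 0 \<longrightarrow> (\<exists>i. \<delta> / 3 \<le> \<bar>dual \<alpha> (s - 5 * T) A q $ i\<bar>)}"
  have hist: "(A, s0 + real k * T) \<in> Y"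
    if k: "5 \<le> k" and B: "\<forall>j\<le>k. \<exists>B. ba \<delta> \<alpha> (s0 + real j * T) B \<and> A \<in> wbox W (s0 + real j * T) B" for k A
  proof -
    have e: "s0 + real (k - 5) * T = s0 + real k * T - 5 * T" using k by (simp add: of_nat_diff algebra_simps)
    obtain B where "ba \<delta> \<alpha> (s0 + real k * T - 5 * T) B" "A \<in> wbox W (s0 + real k * T - 5 * T) B"
      using B[rule_format, of "k - 5"] unfolding e by auto
    then show ?thesis unfolding Y_def using dual_large_in_box[OF _ \<delta>] unfolding W_def by blast
  qed
  have hit: "4 * card (hit_cells (cyl \<eta>) \<alpha> \<beta> T h) \<le> card (cells W T)"
    if hcl: "h \<in> closure {flow \<alpha> \<beta> s A ** g |A s g. (A, s) \<in> Y \<and> unim g}" and h: "\<bar>det h\<bar> = 1" for h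
  proof -
    define H where "H j = flow \<alpha> \<beta> (- real j) 0 ** h" for j
    have Hz: "(H j *v z) $ Inr 1 = exp (real j) * (h *v z) $ Inr 1"
      "hor (H j *v z) = vector [exp (- real j * \<alpha>$1) * (h *v z) $ Inl 1, exp (- real j * \<alpha>$2) * (h *v z) $ Inl 2]" for j z
      unfolding H_def hor_def matrix_vector_mul_assoc[symmetric] flow_21 by simp_all
    define good where "good j Q \<longleftrightarrow> finite Q \<and> card Q \<le> N0 \<and> (\<forall>p\<in>Q. snd p $ 1 \<noteq> (0::real) \<and> snd p $ 2 \<noteq> (0::real)) \<and>
      hits (cyl \<eta>) \<alpha> \<beta> (H j) \<subseteq> {b. \<exists>p\<in>Q. \<eta> (vector [fst p $ 1 + snd p $ 1 * b$1$1, fst p $ 2 + snd p $ 2 * b$2$1]) = r}" for j and Q :: "((real^2) \<times> (real^2)) set"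
    have "\<exists>Q. good j Q" if j: "j < N" for j unfolding good_def
    proof (intro curves ballI impI)
      show "\<bar>det (H j)\<bar> = 1" using h det_flow[OF wv] by (simp add: H_def det_mul)
      fix z z' assume z: "z \<in> int_vectors" "z' \<in> int_vectors" "(H j *v z) $ Inr 1 = 0" "(H j *v z') $ Inr 1 = 0"
        "cross2 (hor (H j *v z)) (hor (H j *v z')) \<noteq> 0"
      define X where "X = cross2 (hor (h *v z)) (hor (h *v z'))"
      have cr: "cross2 (hor (H j *v z)) (hor (H j *v z')) = exp (- real j) * X"
        unfolding Hz cross2_scaled exp_weights[OF alpha_sum[OF wv], of "- real j"] X_def by (simp add: cross2_def)
      have "\<delta> / 3 \<le> exp (- (5 * T)) * \<bar>X\<bar>" unfolding X_def
        by (rule horizontal_plane_covolume[OF hcl]) (use z cr \<delta> in \<open>auto simp: Hz(1) X_def Y_def\<close>)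
      then have "exp (5 * T) * (\<delta> / 3) \<le> exp (5 * T) * (exp (- (5 * T)) * \<bar>X\<bar>)" by (intro mult_left_mono) auto
      also have "\<dots> = \<bar>X\<bar>" by (simp flip: exp_add mult.assoc)
      also have "exp (5 * T) * (\<delta> / 3) = exp (2 * T) / 3" by (simp add: \<delta>_def flip: exp_add)
      finally have "exp (- real j) * (exp (2 * T) / 3) \<le> exp (- real j) * \<bar>X\<bar>" by (intro mult_left_mono) auto
      moreover have "exp (- real j) * (exp (2 * T) / 3) = exp (2 * T - real j) / 3" by (simp add: exp_diff exp_minus field_simps)
      moreover have "exp T \<le> exp (2 * T - real j)" using j by (simp add: T_def)
      moreover have "T < exp T" using exp_ge_add_one_self[of T] by linarith
      ultimately show "Kc < \<bar>cross2 (hor (H j *v z)) (hor (H j *v z'))\<bar>" unfolding cr abs_mult abs_exp_cancel using T(6) by linarith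
    qed
    then obtain Q where "\<And>j. j < N \<Longrightarrow> good j (Q j)" by metis
    then have Q: "\<And>j. j < N \<Longrightarrow> finite (Q j)" "\<And>j. j < N \<Longrightarrow> card (Q j) \<le> N0"
      "\<And>j p. j < N \<Longrightarrow> p \<in> Q j \<Longrightarrow> snd p $ 1 \<noteq> (0::real) \<and> snd p $ 2 \<noteq> (0::real)"
      "\<And>j. j < N \<Longrightarrow> hits (cyl \<eta>) \<alpha> \<beta> (H j) \<subseteq> {b. \<exists>p\<in>Q j. \<eta> (vector [fst p $ 1 + snd p $ 1 * b$1$1, fst p $ 2 + snd p $ 2 * b$2$1]) = r}"
      unfolding good_def by auto
    define C where "C j p = {c\<in>cells W T. \<exists>b\<in>wbox W T (child W T 0 c). \<eta> (vector
      [fst p $ 1 + (snd p $ 1 * exp (- real j * (\<alpha>$1 + \<beta>$1))) * b$1$1,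
       fst p $ 2 + (snd p $ 2 * exp (- real j * (\<alpha>$2 + \<beta>$1))) * b$2$1]) = r}" for j and p :: "(real^2) \<times> (real^2)"
    define L where "L = 16 * (M (1,1) + M (2,1)) + 8"
    have C: "finite (C j p)" for j p unfolding C_def by simp
    have CL: "card (C j p) \<le> L" if "j < N" "p \<in> Q j" for j p
      unfolding C_def L_def M_def using Q(3)[OF that] by (intro card_cells_curve[OF \<eta> _ _ r]) auto
    have "hit_cells (cyl \<eta>) \<alpha> \<beta> T h \<subseteq> (\<Union>j<N. \<Union>p\<in>Q j. C j p)"
    proof
      fix c assume "c \<in> hit_cells (cyl \<eta>) \<alpha> \<beta> T h"
      then obtain j b where j: "j < N" "c \<in> cells W T" "b \<in> wbox W T (child W T 0 c)"
        "shrink \<alpha> \<beta> (real j) b \<in> hits (cyl \<eta>) \<alpha> \<beta> (H j)"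
        using hit_cells_subset_hits[OF wv N1 h] unfolding H_def W_def T_def by blast
      obtain p where p: "p \<in> Q j" "\<eta> (vector [fst p $ 1 + snd p $ 1 * shrink \<alpha> \<beta> (real j) b$1$1,
          fst p $ 2 + snd p $ 2 * shrink \<alpha> \<beta> (real j) b$2$1]) = r"
        using Q(4)[OF j(1)] j(4) by blast
      have "c \<in> C j p" unfolding C_def using j(2,3) p(2) by (auto simp: shrink_def mult.assoc)
      then show "c \<in> (\<Union>j<N. \<Union>p\<in>Q j. C j p)" using j(1) p(1) by blast
    qed
    then have "card (hit_cells (cyl \<eta>) \<alpha> \<beta> T h) \<le> card (\<Union>j<N. \<Union>p\<in>Q j. C j p)"
      by (intro card_mono finite_UN_I C Q(1)) auto
    also have "\<dots> \<le> (\<Sum>j<N. card (\<Union>p\<in>Q j. C j p))" by (rule card_UN_le) simp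
    also have "\<dots> \<le> (\<Sum>j<N. N0 * L)"
    proof (rule sum_mono)
      fix j assume "j \<in> {..<N}"
      then have j: "j < N" by simp
      have "card (\<Union>p\<in>Q j. C j p) \<le> (\<Sum>p\<in>Q j. card (C j p))" by (rule card_UN_le[OF Q(1)[OF j]])
      also have "\<dots> \<le> (\<Sum>p\<in>Q j. L)" by (intro sum_mono CL[OF j])
      also have "\<dots> \<le> N0 * L" using Q(2)[OF j] by simp
      finally show "card (\<Union>p\<in>Q j. C j p) \<le> N0 * L" .
    qed
    also have "\<dots> = N * N0 * L" by simp
    also have "\<dots> \<le> N * N0 * (24 * (M (1,1) + M (2,1)))"
      using M(2)[of 1] unfolding L_def by (intro mult_left_mono) auto
    finally have "real (4 * card (hit_cells (cyl \<eta>) \<alpha> \<beta> T h)) \<le> real (4 * (N * N0 * (24 * (M (1,1) + M (2,1)))))"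
      by (intro of_nat_mono mult_left_mono) auto
    \<comment> \<open>Written over 4 because \<open>exp T * (M (1,1) + M (2,1))\<close> is at most
      \<open>4 * M (1,1) * M (2,1)\<close>.\<close>
    also have "\<dots> = (384 * real N0 * T) / 4 * (real (M (1,1)) + real (M (2,1)))" by (simp add: T_def)
    also have "\<dots> \<le> exp T / 4 * (real (M (1,1)) + real (M (2,1)))"
      using linear_le_exp[of 1 "384 * real N0" T] T(3,5) by (intro mult_right_mono divide_right_mono) auto
    also have "\<dots> \<le> real (M (1,1)) * real (M (2,1))"
    proof -
      have "exp T * real (M (1,1)) \<le> (2 * real (M (2,1))) * real (M (1,1))" "exp T * real (M (2,1)) \<le> (2 * real (M (1,1))) * real (M (2,1))"
        by (intro mult_right_mono M(1), simp)+
      then show ?thesis by (simp add: algebra_simps)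
    qed
    also have "\<dots> = real (card (cells W T))" unfolding card_cells_21 M_def by simp
    finally show ?thesis by linarith
  qed
  have root: "ba \<delta> \<alpha> s0 A0" by (rule ba_initial[OF s0]) (use s0 T in \<open>simp add: \<delta>_def\<close>)
  show "\<exists>T Pr Y K0. T \<ge> T0 \<and> T > 0 \<and> Pr A0 s0 \<and>
      (\<forall>k A. K0 \<le> k \<longrightarrow> (\<forall>j\<le>k. \<exists>B. Pr B (s0 + real j * T) \<and> A \<in> wbox (rate \<alpha> \<beta>) (s0 + real j * T) B) \<longrightarrow> (A, s0 + real k * T) \<in> Y) \<and>
      (\<forall>A s. Pr A s \<longrightarrow> 4 * card {c\<in>cells (rate \<alpha> \<beta>) T. \<not> Pr (child (rate \<alpha> \<beta>) (s + T) A c) (s + T)} \<le> card (cells (rate \<alpha> \<beta>) T)) \<and>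
      (\<forall>h \<in> closure {flow \<alpha> \<beta> s A ** g |A s g. (A, s) \<in> Y \<and> unim g}. \<bar>det h\<bar> = 1 \<longrightarrow>
         4 * card (hit_cells (cyl \<eta>) \<alpha> \<beta> T h) \<le> card (cells (rate \<alpha> \<beta>) T))"
    unfolding W_def[symmetric]
  proof (intro exI[of _ T] exI[of _ "\<lambda>A s. ba \<delta> \<alpha> s A"] exI[of _ Y] exI[of _ 5] conjI allI ballI impI)
    show "T0 \<le> T" "0 < T" "ba \<delta> \<alpha> s0 A0" using T root by auto
  qed (use hist hit T1[OF T(2), folded \<delta>_def] in auto)
qed

end

theorem theorem1p6:
  shows "(\<forall>(\<alpha>::real^'m) (\<beta>::real^'n).
            weight_vector \<alpha> \<beta> \<longrightarrow> thick (DI (norm :: real^('m + 'n) \<Rightarrow> real) \<alpha> \<beta>)) \<and>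
         (\<forall>(\<alpha>::real^2) (\<beta>::real^1) (\<eta>::real^2 \<Rightarrow> real) (\<nu>::real^(2 + 1) \<Rightarrow> real).
            weight_vector \<alpha> \<beta> \<and> is_norm \<eta> \<and>
            (\<forall>v. \<nu> v = max (\<eta> (vector [v $ Inl 1, v $ Inl 2])) \<bar>v $ Inr 1\<bar>) \<longrightarrow>
            thick (DI \<nu> \<alpha> \<beta>))"
proof (intro conjI allI impI)
  fix \<alpha> :: "real^'m" and \<beta> :: "real^'n"
  assume "weight_vector \<alpha> \<beta>"
  then show "thick (DI (norm :: real^('m + 'n) \<Rightarrow> real) \<alpha> \<beta>)" by (rule thick_DI_euclidean)
next
  fix \<alpha> :: "real^2" and \<beta> :: "real^1" and \<eta> :: "real^2 \<Rightarrow> real" and \<nu> :: "real^(2 + 1) \<Rightarrow> real"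
  assume *: "weight_vector \<alpha> \<beta> \<and> is_norm \<eta> \<and> (\<forall>v. \<nu> v = max (\<eta> (vector [v $ Inl 1, v $ Inl 2])) \<bar>v $ Inr 1\<bar>)"
  then have "\<nu> = cyl \<eta>" by (auto simp: cyl_def hor_def)
  then show "thick (DI \<nu> \<alpha> \<beta>)" using thick_DI_cyl * by blast
qed

end
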